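(* Let $\alpha\in(0,1)$ and let $\xi_\alpha$ be the upper $\alpha$ quantile of the standard normal distribution. In the $k$-sample factor model described in the context, assume (A1) $\lim_{n\to\infty} n_l/n=\lambda_l\in(0,1)$ for $l=1,\dots,k$; (A3) $\mathrm{tr}(\Sigma_l\Sigma_s\Sigma_i\Sigma_j)=o\{[\mathrm{tr}(A^2)]^2\}$ as $p\to\infty$ for all $l,s,i,j\in\{1,\dots,k\}$, where $A=\sum_{i=1}^k\Sigma_i$; and assume that the null hypothesis $H_0:\mu_1=\cdots=\mu_k$ holds. Then, as $n,p\to\infty$, $$P(\widehat T\ge \xi_\alpha)=\alpha+o(1),$$ where $\widehat T$ is either $\widehat T_1=T/\widehat{\sigma_T}$ or $\widehat T_2=T/\widetilde{\sigma_T}$.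
   Context: Model. $k\ge 2$ is a fixed number of groups, with sample sizes $n_1,\dots,n_k$ and $n=\sum_{l=1}^k n_l$. For $l=1,\dots,k$ and $i=1,\dots,n_l$, the $p$-dimensional observations are $X_{li}=\Gamma_l Z_{li}+\mu_l$, where $\mu_l\in\mathbb R^p$, $\Gamma_l$ is a (deterministic) $p\times r$ matrix with $r\ge p$ and $\Gamma_l\Gamma_l^{\mathrm T}=\Sigma_l$ positive definite, and $Z_{li}=(z_{li1},\dots,z_{lir})^{\mathrm T}$ are, for each $l$, i.i.d. in $i$ with mean $0$ and covariance $I_r$. The variables $z_{lij}$ are independent over all $l,i,j$, and $E(z_{lij}^4)=3+\gamma_l<\infty$ with $\gamma_l$ constants. Asymptotics: $n,p\to\infty$ jointly, with $k$ and $\gamma_l$ fixed; $p$, $r$, $n_l$, $\mu_l$, $\Gamma_l$, $\Sigma_l$ may all vary along the sequence. Statistics. $\overline X_l$ is the sample mean and $S_{ln_l}$ the (unbiased, divisor $n_l-1$) sample covariance matrix of group $l$. With $n_{l1}=[n_l/2]+1$ and $n_{l2}=n_l-n_{l1}$ ($[\cdot]$ is the integer part), $S_{ln_{l1}}$ and $S_{ln_{l2}}$ are the unbiased sample covariance matrices of the first $n_{l1}$ and of the remaining $n_{l2}$ observations of group $l$. Define $$T=\sum_{l=1}^k\frac{n-n_l}{n(n_l-1)}\sum_{i\ne j}^{n_l}X_{li}^{\mathrm T}X_{lj}-\sum_{l\ne s}^k\frac{n_ln_s}{n}\overline X_l^{\mathrm T}\overline X_s,$$ $\widehat{\mathrm{tr}(\Sigma_l^2)}=\mathrm{tr}(S_{ln_{l1}}S_{ln_{l2}})$;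 $\widehat{\mathrm{tr}(\Sigma_l\Sigma_s)}=\mathrm{tr}(S_{ln_l}S_{sn_s})$ for $l\neq s$; $$\widetilde{\mathrm{tr}(\Sigma_l^2)}=\frac{(n_l-1)^2}{(n_l+1)(n_l-2)}\Big\{\mathrm{tr}(S_{ln_l}^2)-\frac{1}{n_l-1}[\mathrm{tr}(S_{ln_l})]^2\Big\},$$ $$\widehat{\sigma_T}^2=\frac{2}{n^2}\Big\{\sum_{l=1}^k\frac{n_l(n-n_l)^2}{n_l-1}\widehat{\mathrm{tr}(\Sigma_l^2)}+\sum_{l\ne s}^k n_ln_s\widehat{\mathrm{tr}(\Sigma_l\Sigma_s)}\Big\},$$ $$\widetilde{\sigma_T}^2=\frac{2}{n^2}\Big\{\sum_{l=1}^k\frac{n_l(n-n_l)^2}{n_l-1}\widetilde{\mathrm{tr}(\Sigma_l^2)}+\sum_{l\ne s}^k n_ln_s\widehat{\mathrm{tr}(\Sigma_l\Sigma_s)}\Big\}.$$ Sums over $i\ne j$ and $l\ne s$ run over ordered pairs. *)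

theory Defs
  imports "HOL-Probability.Probability" "Jordan_Normal_Form.Matrix"
begin

(* Both HOL-Analysis and Jordan_Normal_Form have vectors and matrices; those of
   Jordan_Normal_Form are used, because the dimensions p and r vary along the sequence. *)
hide_type (open) Finite_Cartesian_Product.vec
hide_const (open) Finite_Cartesian_Product.vec Finite_Cartesian_Product.mat
no_notation vec_nth (infixl "$" 90)
no_notation inner (infix "\<bullet>" 70)

definition mat_trace :: "real Matrix.mat \<Rightarrow> real" where
  "mat_trace A = (\<Sum>i<dim_row A. A $$ (i, i))"

definition pos_def_mat :: "real Matrix.mat \<Rightarrow> bool" where
  "pos_def_mat A \<longleftrightarrow> square_mat A \<and> transpose_mat A = A \<and>
     (\<forall>x \<in> carrier_vec (dim_row A). x \<noteq> 0\<^sub>v (dim_row A) \<longrightarrow> x \<bullet> (A *\<^sub>v x) > 0)"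

definition pop_cov :: "(nat \<Rightarrow> real Matrix.mat) \<Rightarrow> nat \<Rightarrow> real Matrix.mat" where
  "pop_cov \<Gamma> l = \<Gamma> l * transpose_mat (\<Gamma> l)"

(* Entrywise sum, since real matrices of unspecified size do not form a monoid. *)
definition pop_cov_sum :: "nat \<Rightarrow> nat \<Rightarrow> (nat \<Rightarrow> real Matrix.mat) \<Rightarrow> real Matrix.mat" where
  "pop_cov_sum k p \<Gamma> = Matrix.mat p p (\<lambda>(a, b). \<Sum>i=1..k. pop_cov \<Gamma> i $$ (a, b))"

(* Groups and observations are numbered from 1, coordinates of vectors from 0.
   N l is the sample size of group l, and z l i j is the j-th coordinate of Z_li. *)
locale factor_model = prob_space M for M :: "'a measure" +
  fixes k :: nat and N :: "nat \<Rightarrow> nat" and p r :: nat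
    and \<mu> :: "nat \<Rightarrow> real Matrix.vec" and \<Gamma> :: "nat \<Rightarrow> real Matrix.mat"
    and z :: "nat \<Rightarrow> nat \<Rightarrow> nat \<Rightarrow> 'a \<Rightarrow> real" and \<gamma> :: "nat \<Rightarrow> real"
  assumes groups: "k \<ge> 2"
    and dims: "p \<le> r"
    and mean_dim: "\<And>l. l \<in> {1..k} \<Longrightarrow> \<mu> l \<in> carrier_vec p"
    and loading_dim: "\<And>l. l \<in> {1..k} \<Longrightarrow> \<Gamma> l \<in> carrier_mat p r"
    and pos_def: "\<And>l. l \<in> {1..k} \<Longrightarrow> pos_def_mat (pop_cov \<Gamma> l)"
    and indep: "indep_vars (\<lambda>_. borel) (\<lambda>(l, i, j). z l i j)
                  {(l, i, j). l \<in> {1..k} \<and> i \<in> {1..N l} \<and> j < r}"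
    and ident_distr: "\<And>l i i'. l \<in> {1..k} \<Longrightarrow> i \<in> {1..N l} \<Longrightarrow> i' \<in> {1..N l} \<Longrightarrow>
          distr M (\<Pi>\<^sub>M j\<in>{..<r}. borel) (\<lambda>\<omega>. \<lambda>j\<in>{..<r}. z l i j \<omega>) =
          distr M (\<Pi>\<^sub>M j\<in>{..<r}. borel) (\<lambda>\<omega>. \<lambda>j\<in>{..<r}. z l i' j \<omega>)"
    and fourth_moment_finite: "\<And>l i j. l \<in> {1..k} \<Longrightarrow> i \<in> {1..N l} \<Longrightarrow> j < r \<Longrightarrow>
          integrable M (\<lambda>\<omega>. z l i j \<omega> ^ 4)"
    and fourth_moment: "\<And>l i j. l \<in> {1..k} \<Longrightarrow> i \<in> {1..N l} \<Longrightarrow> j < r \<Longrightarrow>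
          expectation (\<lambda>\<omega>. z l i j \<omega> ^ 4) = 3 + \<gamma> l"
    and mean_zero: "\<And>l i j. l \<in> {1..k} \<Longrightarrow> i \<in> {1..N l} \<Longrightarrow> j < r \<Longrightarrow>
          expectation (z l i j) = 0"
    and cov_identity: "\<And>l i j j'. l \<in> {1..k} \<Longrightarrow> i \<in> {1..N l} \<Longrightarrow> j < r \<Longrightarrow> j' < r \<Longrightarrow>
          expectation (\<lambda>\<omega>. z l i j \<omega> * z l i j' \<omega>) = (if j = j' then 1 else 0)"

definition factor_obs :: "nat \<Rightarrow> (nat \<Rightarrow> real Matrix.vec) \<Rightarrow> (nat \<Rightarrow> real Matrix.mat) \<Rightarrow>
    (nat \<Rightarrow> nat \<Rightarrow> nat \<Rightarrow> 'a \<Rightarrow> real) \<Rightarrow> 'a \<Rightarrow> nat \<Rightarrow> nat \<Rightarrow> real Matrix.vec" where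
  "factor_obs r \<mu> \<Gamma> z \<omega> l i = \<Gamma> l *\<^sub>v Matrix.vec r (\<lambda>j. z l i j \<omega>) + \<mu> l"

(* All statistics below are functions of the data X, where X l i is observation i of group l. *)

definition sample_mean :: "nat \<Rightarrow> nat set \<Rightarrow> (nat \<Rightarrow> real Matrix.vec) \<Rightarrow> real Matrix.vec" where
  "sample_mean p I Y = Matrix.vec p (\<lambda>a. (\<Sum>i\<in>I. Y i $ a) / real (card I))"

definition sample_cov :: "nat \<Rightarrow> nat set \<Rightarrow> (nat \<Rightarrow> real Matrix.vec) \<Rightarrow> real Matrix.mat" where
  "sample_cov p I Y = Matrix.mat p p (\<lambda>(a, b).
     (\<Sum>i\<in>I. (Y i $ a - sample_mean p I Y $ a) * (Y i $ b - sample_mean p I Y $ b))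
       / (real (card I) - 1))"

definition total_size :: "nat \<Rightarrow> (nat \<Rightarrow> nat) \<Rightarrow> nat" where
  "total_size k N = (\<Sum>l=1..k. N l)"

definition T_stat ::
  "nat \<Rightarrow> (nat \<Rightarrow> nat) \<Rightarrow> nat \<Rightarrow> (nat \<Rightarrow> nat \<Rightarrow> real Matrix.vec) \<Rightarrow> real" where
  "T_stat k N p X = (let n = real (total_size k N) in
     (\<Sum>l=1..k. (n - real (N l)) / (n * (real (N l) - 1)) *
        (\<Sum>i=1..N l. \<Sum>j\<in>{1..N l} - {i}. X l i \<bullet> X l j))
     - (\<Sum>l=1..k. \<Sum>s\<in>{1..k} - {l}. real (N l) * real (N s) / n *
        (sample_mean p {1..N l} (X l) \<bullet> sample_mean p {1..N s} (X s))))"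

definition tr_sq_hat ::
  "(nat \<Rightarrow> nat) \<Rightarrow> nat \<Rightarrow> (nat \<Rightarrow> nat \<Rightarrow> real Matrix.vec) \<Rightarrow> nat \<Rightarrow> real" where
  "tr_sq_hat N p X l = (let n1 = N l div 2 + 1 in
     mat_trace (sample_cov p {1..n1} (X l) * sample_cov p {n1 + 1..N l} (X l)))"

definition tr_sq_tilde ::
  "(nat \<Rightarrow> nat) \<Rightarrow> nat \<Rightarrow> (nat \<Rightarrow> nat \<Rightarrow> real Matrix.vec) \<Rightarrow> nat \<Rightarrow> real" where
  "tr_sq_tilde N p X l = (let m = real (N l); S = sample_cov p {1..N l} (X l) in
     (m - 1)^2 / ((m + 1) * (m - 2)) * (mat_trace (S * S) - 1 / (m - 1) * (mat_trace S)^2))"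

definition tr_cross_hat ::
  "(nat \<Rightarrow> nat) \<Rightarrow> nat \<Rightarrow> (nat \<Rightarrow> nat \<Rightarrow> real Matrix.vec) \<Rightarrow> nat \<Rightarrow> nat \<Rightarrow> real" where
  "tr_cross_hat N p X l s =
     mat_trace (sample_cov p {1..N l} (X l) * sample_cov p {1..N s} (X s))"

(* The common form of the two variance estimators; q l is the estimate of tr(Sigma_l^2). *)
definition var_est ::
  "nat \<Rightarrow> (nat \<Rightarrow> nat) \<Rightarrow> nat \<Rightarrow> (nat \<Rightarrow> nat \<Rightarrow> real Matrix.vec) \<Rightarrow> (nat \<Rightarrow> real) \<Rightarrow> real" where
  "var_est k N p X q = (let n = real (total_size k N) in
     2 / n^2 * ((\<Sum>l=1..k. real (N l) * (n - real (N l))^2 / (real (N l) - 1) * q l)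
              + (\<Sum>l=1..k. \<Sum>s\<in>{1..k} - {l}. real (N l) * real (N s) * tr_cross_hat N p X l s)))"

definition T1_hat ::
  "nat \<Rightarrow> (nat \<Rightarrow> nat) \<Rightarrow> nat \<Rightarrow> (nat \<Rightarrow> nat \<Rightarrow> real Matrix.vec) \<Rightarrow> real" where
  "T1_hat k N p X = T_stat k N p X / sqrt (var_est k N p X (tr_sq_hat N p X))"

definition T2_hat ::
  "nat \<Rightarrow> (nat \<Rightarrow> nat) \<Rightarrow> nat \<Rightarrow> (nat \<Rightarrow> nat \<Rightarrow> real Matrix.vec) \<Rightarrow> real" where
  "T2_hat k N p X = T_stat k N p X / sqrt (var_est k N p X (tr_sq_tilde N p X))"

end

theory Submission
  imports Defs
begin

text \<open>Under the null hypothesis the common mean cancels, so that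
  \<open>T = \<Sum>\<^bsub>a \<noteq> b\<^esub> w\<^sub>a\<^sub>b Y\<^sub>a\<^sup>T Y\<^sub>b\<close> with \<open>Y\<^sub>a = \<Gamma>\<^sub>a Z\<^sub>a\<close>. After division by its standard
  deviation it is a quadratic form \<open>\<zeta>\<^sup>T W \<zeta>\<close> in the independent scalar variables \<open>z\<^sub>l\<^sub>i\<^sub>j\<close>, where \<open>W\<close> is
  symmetric with zero diagonal. Splitting off one variable \<open>x\<close> at a time, \<open>T = U + 2 x v\<close> with \<open>U\<close> and
  \<open>v\<close> independent of \<open>x\<close>, and expanding \<open>E x v exp (i t T)\<close> to second order in \<open>x\<close> shows that the
  characteristic function \<open>\<phi>\<close> satisfies \<open>\<phi>' = - t \<phi>\<close> up to an error controlled by \<open>tr (W\<^sup>4)\<close>, which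
  also bounds the variance of \<open>\<Sum> v\<^sup>2\<close>. By (A3), \<open>tr (W\<^sup>4)\<close> tends to zero. No martingale is needed.

  All trace estimators are, up to terms that are small in mean, averages of the squares
  \<open>(Y\<^sub>a\<^sup>T Y\<^sub>b)\<^sup>2\<close> over pairs \<open>a \<noteq> b\<close>. These have the right mean and a second moment of the order of the
  squared mean, and disjoint pairs are independent, so the averages have small relative variance.
  Slutsky's theorem concludes.\<close>

section \<open>Moments of linear and quadratic forms in independent variables\<close>

text \<open>Nothing ties the growth of \<open>p\<close> to that of \<open>n\<close>, and the
  probability space, the dimensions and the matrices all change along the sequence. The analytic
  work is therefore done for one fixed model, as inequalities whose constants depend only on
  \<open>k\<close>, on the fourth moments and on a lower bound \<delta> of the group proportions;
  limits are taken only in the final theorem. The scale is the exact variance of T. Balance of the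
  groups bounds it below by a multiple of tr (A^2), and every weight is of order 1/n. The trace of
  W^4 is a sum over n^4 closed cycles of four observations, so the powers of n cancel and only the
  ratio in (A3) is left. The zero diagonal of W is what lets fourth moments suffice: a diagonal term
  would put the square of a variable into T, and its fourth power would call for eighth moments. In
  the trace estimators that use a whole group the diagonal Gram entries do occur. Their mean tr
  \<Sigma> may exceed the off-diagonal entries by far, so it has to cancel exactly, and only second
  moments of the remainder are used.\<close>

lemma abs_power_mult_le:
  fixes a b :: real
  assumes "i + j \<le> 4"
  shows "\<bar>a ^ i * b ^ j\<bar> \<le> 1 + a ^ 4 + b ^ 4"
proof -
  define c where "c = max 1 (max \<bar>a\<bar> \<bar>b\<bar>)"
  have c: "1 \<le> c" "\<bar>a\<bar> \<le> c" "\<bar>b\<bar> \<le> c" by (auto simp: c_def)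
  have "\<bar>a ^ i * b ^ j\<bar> \<le> c ^ i * c ^ j"
    unfolding abs_mult power_abs using c by (intro mult_mono power_mono) auto
  also have "\<dots> \<le> c ^ 4" using c assms by (simp flip: power_add add: power_increasing)
  also have "\<dots> \<le> 1 + a ^ 4 + b ^ 4" by (auto simp: c_def max_def)
  finally show ?thesis .
qed

section \<open>Random variables with a finite fourth moment\<close>

context prob_space
begin

text \<open>Measurability is stated separately because integrability of the fourth power would not
  detect a non-measurable sign. These variables form a vector space in which all products of total
  degree at most four are integrable.\<close>

definition L4 :: "('a \<Rightarrow> real) \<Rightarrow> bool" where
  "L4 f \<longleftrightarrow> f \<in> borel_measurable M \<and> integrable M (\<lambda>\<omega>. f \<omega> ^ 4)"

lemma L4_measurable: "L4 f \<Longrightarrow> f \<in> borel_measurable M"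
  by (simp add: L4_def)

lemma L4_integrable_mult:
  assumes "L4 f" "L4 g" "i + j \<le> 4"
  shows "integrable M (\<lambda>\<omega>. f \<omega> ^ i * g \<omega> ^ j)"
proof (rule Bochner_Integration.integrable_bound)
  show "integrable M (\<lambda>\<omega>. 1 + f \<omega> ^ 4 + g \<omega> ^ 4)"
    using assms by (auto simp: L4_def)
  show "(\<lambda>\<omega>. f \<omega> ^ i * g \<omega> ^ j) \<in> borel_measurable M"
    using assms by (auto simp: L4_def)
  show "AE \<omega> in M. norm (f \<omega> ^ i * g \<omega> ^ j) \<le> norm (1 + f \<omega> ^ 4 + g \<omega> ^ 4)"
    using abs_power_mult_le[OF assms(3)] by (auto intro!: AE_I2 order_trans[OF _ abs_ge_self])
qed

lemma L4_integrable_power: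
  assumes "L4 f" "i \<le> 4"
  shows "integrable M (\<lambda>\<omega>. f \<omega> ^ i)"
  using L4_integrable_mult[OF assms(1) assms(1), of i 0] assms(2) by simp

lemma L4_integrable: "L4 f \<Longrightarrow> integrable M f"
  using L4_integrable_power[of f 1] by simp

lemma L4_integrable_prod: "L4 f \<Longrightarrow> L4 g \<Longrightarrow> integrable M (\<lambda>\<omega>. f \<omega> * g \<omega>)"
  using L4_integrable_mult[of f g 1 1] by simp

lemma L4_const [simp]: "L4 (\<lambda>_. c)"
  by (simp add: L4_def)

lemma L4_cmult [simp]: "L4 f \<Longrightarrow> L4 (\<lambda>\<omega>. c * f \<omega>)"
  by (auto simp: L4_def power_mult_distrib)

lemma L4_add [simp]:
  assumes "L4 f" "L4 g"
  shows "L4 (\<lambda>\<omega>. f \<omega> + g \<omega>)"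
proof -
  have *: "(a + b) ^ 4 = a ^ 4 + 4 * (a ^ 3 * b) + 6 * (a ^ 2 * b ^ 2) + 4 * (a * b ^ 3) + b ^ 4"
    for a b :: real
    by (simp add: power4_eq_xxxx power2_eq_square power3_eq_cube algebra_simps)
  show ?thesis
    using assms L4_integrable_mult[OF assms, of 3 1] L4_integrable_mult[OF assms, of 2 2]
      L4_integrable_mult[OF assms, of 1 3]
    unfolding L4_def * by auto
qed

lemma L4_sum [simp]: "(\<And>i. i \<in> I \<Longrightarrow> L4 (f i)) \<Longrightarrow> L4 (\<lambda>\<omega>. \<Sum>i\<in>I. f i \<omega>)"
  by (induction I rule: infinite_finite_induct) auto

end

text \<open>Every single index is treated as a block of its own, so independence of disjoint blocks
  gives the reindexed family. This later turns triples \<open>(l, i, j)\<close> into nested pairs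
  \<open>((l, i), j)\<close>.\<close>

lemma (in prob_space) indep_vars_reindex:
  assumes ind: "indep_vars M' X I" and f: "inj_on f L" "f ` L \<subseteq> I"
  shows "indep_vars (\<lambda>j. M' (f j)) (\<lambda>j. X (f j)) L"
proof -
  have "indep_vars (\<lambda>j. PiM {f j} M') (\<lambda>j \<omega>. restrict (\<lambda>i. X i \<omega>) {f j}) L"
    using f by (intro indep_vars_restrict[OF ind]) (auto simp: disjoint_family_on_def inj_on_def)
  hence "indep_vars (\<lambda>j. M' (f j)) (\<lambda>j \<omega>. (\<lambda>g. g (f j)) (restrict (\<lambda>i. X i \<omega>) {f j})) L"
    by (rule indep_vars_compose2) (auto intro: measurable_component_singleton)
  thus ?thesis by simp
qed

text \<open>One common bound \<open>K\<close> on the fourth moments controls every error term, also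
  through third absolute moments; no constant below depends on the index set.\<close>

locale unit_family = prob_space M for M :: "'a measure" +
  fixes J :: "'i set" and \<zeta> :: "'i \<Rightarrow> 'a \<Rightarrow> real" and K :: real
  assumes finite_J: "finite J"
    and indep_J: "indep_vars (\<lambda>_. borel) \<zeta> J"
    and first_moment: "\<And>i. i \<in> J \<Longrightarrow> expectation (\<zeta> i) = 0"
    and second_moment: "\<And>i. i \<in> J \<Longrightarrow> expectation (\<lambda>\<omega>. \<zeta> i \<omega> ^ 2) = 1"
    and integrable_fourth: "\<And>i. i \<in> J \<Longrightarrow> integrable M (\<lambda>\<omega>. \<zeta> i \<omega> ^ 4)"
    and fourth_moment_le: "\<And>i. i \<in> J \<Longrightarrow> expectation (\<lambda>\<omega>. \<zeta> i \<omega> ^ 4) \<le> K"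
    and K_ge_1: "1 \<le> K"
begin

text \<open>The sigma-algebra generated by the variables with index in \<open>A\<close>.
  Independence then reduces to measurability with respect to \<open>alg A\<close> and
  \<open>alg B\<close> for disjoint \<open>A\<close> and \<open>B\<close>, without writing anything
  as a function of tuples.\<close>

definition alg :: "'i set \<Rightarrow> 'a measure" where
  "alg A = vimage_algebra (space M) (\<lambda>\<omega>. \<lambda>i\<in>A. \<zeta> i \<omega>) (Pi\<^sub>M A (\<lambda>_. borel))"

lemma measurable_zeta: "i \<in> J \<Longrightarrow> \<zeta> i \<in> borel_measurable M"
  using indep_J by (auto simp: indep_vars_def)

lemma L4_zeta [simp]: "i \<in> J \<Longrightarrow> L4 (\<zeta> i)"
  using measurable_zeta integrable_fourth by (simp add: L4_def)

lemma L4_zeta_cmult [simp]: "i \<in> J \<Longrightarrow> L4 (\<lambda>\<omega>. c * \<zeta> i \<omega>)"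
  by simp

lemma alg_zeta:
  assumes "i \<in> A"
  shows "\<zeta> i \<in> borel_measurable (alg A)"
proof -
  have "(\<lambda>\<omega>. \<lambda>i\<in>A. \<zeta> i \<omega>) \<in> measurable (alg A) (Pi\<^sub>M A (\<lambda>_. borel))"
    unfolding alg_def by (rule measurable_vimage_algebra1) (auto simp: space_PiM)
  from measurable_compose[OF this measurable_component_singleton[OF assms]] assms
  show ?thesis by simp
qed

lemma alg_imp_measurable:
  assumes "A \<subseteq> J" "f \<in> measurable (alg A) N"
  shows "f \<in> measurable M N"
proof -
  have "(\<lambda>\<omega>. \<lambda>i\<in>A. \<zeta> i \<omega>) \<in> measurable M (Pi\<^sub>M A (\<lambda>_. borel))"
    using assms measurable_zeta by (intro measurable_restrict) auto
  hence "sets (alg A) \<subseteq> sets M"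
    unfolding alg_def by (subst sets_image_in_sets) auto
  moreover have "space (alg A) = space M" by (simp add: alg_def)
  ultimately show ?thesis using assms(2) by (auto simp: measurable_def)
qed

text \<open>Independence is a property of generated sigma-algebras and passes to smaller ones: those
  generated by \<open>f\<close> and \<open>g\<close> lie inside \<open>alg A\<close> and
  \<open>alg B\<close>.\<close>

lemma indep_var_alg:
  assumes "A \<subseteq> J" "B \<subseteq> J" "A \<inter> B = {}"
    and f: "f \<in> measurable (alg A) S" and g: "g \<in> measurable (alg B) T"
  shows "indep_var S f T g"
proof -
  let ?X = "\<lambda>A \<omega>. \<lambda>i\<in>A. \<zeta> i \<omega>" and ?P = "\<lambda>A. Pi\<^sub>M A (\<lambda>_. borel :: real measure)"
  have "indep_var (?P A) (?X A) (?P B) (?X B)"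
    using assms by (intro indep_var_restrict[OF indep_J])
  hence ind: "indep_set (sets (alg A)) (sets (alg B))"
    by (simp add: indep_var_eq alg_def sets_vimage_algebra)
  have *: "sigma_sets (space M) {h -` X \<inter> space M |X. X \<in> sets R} \<subseteq> sets (alg C)"
    if "h \<in> measurable (alg C) R" for h :: "'a \<Rightarrow> 'z" and C R
  proof -
    have "{h -` X \<inter> space M |X. X \<in> sets R} \<subseteq> sets (alg C)"
      using that by (auto simp: measurable_def alg_def)
    from sets.sigma_sets_subset[OF this] show ?thesis by (simp add: alg_def)
  qed
  have "A' \<in> events \<and> B' \<in> events \<and> prob (A' \<inter> B') = prob A' * prob B'"
    if "A' \<in> sets (alg A)" "B' \<in> sets (alg B)" for A' B'
    using ind that unfolding indep_sets2_eq by blast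
  hence "indep_set (sigma_sets (space M) {f -` X \<inter> space M |X. X \<in> sets S})
      (sigma_sets (space M) {g -` X \<inter> space M |X. X \<in> sets T})"
    using *[OF f] *[OF g] ind unfolding indep_sets2_eq by (meson subset_trans subsetD)
  thus ?thesis
    unfolding indep_var_eq
    using alg_imp_measurable[OF assms(1) f] alg_imp_measurable[OF assms(2) g] by simp
qed

text \<open>Stated over normed fields because it is applied to complex exponentials as well as to
  real moments.\<close>

lemma expectation_mult_alg:
  fixes f g :: "'a \<Rightarrow> 'c::{real_normed_field, banach, second_countable_topology}"
  assumes "A \<subseteq> J" "B \<subseteq> J" "A \<inter> B = {}"
    and "f \<in> borel_measurable (alg A)" "g \<in> borel_measurable (alg B)"
    and "integrable M f" "integrable M g"
  shows "expectation (\<lambda>\<omega>. f \<omega> * g \<omega>) = expectation f * expectation g"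
    and "integrable M (\<lambda>\<omega>. f \<omega> * g \<omega>)"
  using indep_var_lebesgue_integral[OF indep_var_alg[OF assms(1-5)] assms(6,7)]
    indep_var_integrable[OF indep_var_alg[OF assms(1-5)] assms(6,7)] by auto

definition lin :: "('i \<Rightarrow> real) \<Rightarrow> 'i set \<Rightarrow> 'a \<Rightarrow> real" where
  "lin a A \<omega> = (\<Sum>i\<in>A. a i * \<zeta> i \<omega>)"

definition quad :: "('i \<Rightarrow> 'i \<Rightarrow> real) \<Rightarrow> 'i set \<Rightarrow> 'a \<Rightarrow> real" where
  "quad b A \<omega> = (\<Sum>i\<in>A. \<Sum>j\<in>A. b i j * \<zeta> i \<omega> * \<zeta> j \<omega>)"

lemma lin_alg [measurable]: "lin a A \<in> borel_measurable (alg A)"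
  unfolding lin_def using alg_zeta by measurable

lemma quad_alg [measurable]: "quad b A \<in> borel_measurable (alg A)"
  unfolding quad_def using alg_zeta by measurable

lemma L4_lin [simp]: "A \<subseteq> J \<Longrightarrow> L4 (lin a A)"
  unfolding lin_def by (intro L4_sum L4_zeta_cmult) auto

lemma expectation_lin: "A \<subseteq> J \<Longrightarrow> expectation (lin a A) = 0"
  unfolding lin_def
  by (subst Bochner_Integration.integral_sum)
     (auto simp: subset_iff first_moment intro!: L4_integrable)

lemma lin_insert: "finite A \<Longrightarrow> i \<notin> A \<Longrightarrow> lin a (insert i A) \<omega> = lin a A \<omega> + a i * \<zeta> i \<omega>"
  by (simp add: lin_def)

lemma quad_insert:
  "finite A \<Longrightarrow> i \<notin> A \<Longrightarrow> quad b (insert i A) \<omega> =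
    quad b A \<omega> + \<zeta> i \<omega> * lin (\<lambda>j. b i j + b j i) A \<omega> + b i i * \<zeta> i \<omega> ^ 2"
  by (simp add: lin_def quad_def sum.distrib sum_distrib_left distrib_right distrib_left
      power2_eq_square mult_ac)

text \<open>All moments are computed by induction on the set of variables, splitting off one variable, which is
  independent of the remaining ones.\<close>

lemma expectation_split:
  assumes "insert i A \<subseteq> J" "i \<notin> A" "f \<in> borel_measurable (alg A)" "L4 f" "m \<le> 4"
    and "k \<le> 4"
  shows "expectation (\<lambda>\<omega>. \<zeta> i \<omega> ^ m * f \<omega> ^ k) = expectation (\<lambda>\<omega>. \<zeta> i \<omega> ^ m) * expectation (\<lambda>\<omega>. f \<omega> ^ k)"
    and "integrable M (\<lambda>\<omega>. \<zeta> i \<omega> ^ m * f \<omega> ^ k)"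
proof -
  have [measurable]: "\<zeta> i \<in> borel_measurable (alg {i})" by (simp add: alg_zeta)
  note [measurable] = assms(3)
  have *: "{i} \<subseteq> J" "A \<subseteq> J" "{i} \<inter> A = {}" using assms by auto
  have 1: "(\<lambda>\<omega>. \<zeta> i \<omega> ^ m) \<in> borel_measurable (alg {i})"
    by measurable
  have 2: "(\<lambda>\<omega>. f \<omega> ^ k) \<in> borel_measurable (alg A)"
    by measurable
  have 3: "integrable M (\<lambda>\<omega>. \<zeta> i \<omega> ^ m)"
    using assms by (auto intro!: L4_integrable_power)
  have 4: "integrable M (\<lambda>\<omega>. f \<omega> ^ k)"
    using assms by (auto intro!: L4_integrable_power)
  show "expectation (\<lambda>\<omega>. \<zeta> i \<omega> ^ m * f \<omega> ^ k) = expectation (\<lambda>\<omega>. \<zeta> i \<omega> ^ m) * expectation (\<lambda>\<omega>. f \<omega> ^ k)"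
    by (rule expectation_mult_alg(1)[OF * 1 2 3 4])
  show "integrable M (\<lambda>\<omega>. \<zeta> i \<omega> ^ m * f \<omega> ^ k)"
    by (rule expectation_mult_alg(2)[OF * 1 2 3 4])
qed

lemma lin_second_moment:
  assumes "A \<subseteq> J"
  shows "expectation (\<lambda>\<omega>. lin a A \<omega> ^ 2) = (\<Sum>i\<in>A. a i ^ 2)"
  using finite_subset[OF assms finite_J] assms
proof (induction A rule: finite_induct)
  case empty
  thus ?case by (simp add: lin_def)
next
  case (insert i A)
  note sp = expectation_split[OF insert.prems insert.hyps(2) lin_alg, of a]
  have L4: "L4 (lin a A)" using insert.prems by simp
  have [simp]: "i \<in> J" "A \<subseteq> J" using insert.prems by auto
  have i: "integrable M (\<lambda>\<omega>. (lin a A \<omega>)\<^sup>2)" "integrable M (\<lambda>\<omega>. \<zeta> i \<omega> * lin a A \<omega>)" "integrable M (\<lambda>\<omega>. (\<zeta> i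
      \<omega>)\<^sup>2)"
    using L4 L4_integrable_power[of "lin a A" 2] L4_integrable_power[of "\<zeta> i" 2] sp(2)[of 1 1] by auto
  have *: "lin a (insert i A) \<omega> ^ 2 = lin a A \<omega> ^ 2 + 2 * a i * (\<zeta> i \<omega> * lin a A \<omega>) + a i ^ 2 * \<zeta> i \<omega> ^ 2"
      for \<omega>
    unfolding lin_insert[OF insert.hyps] by (simp add: power2_eq_square algebra_simps)
  have "expectation (\<lambda>\<omega>. lin a (insert i A) \<omega> ^ 2) =
      expectation (\<lambda>\<omega>. lin a A \<omega> ^ 2) + 2 * a i * expectation (\<lambda>\<omega>. \<zeta> i \<omega> * lin a A \<omega>) + a i ^ 2"
    unfolding * using i by (simp add: second_moment)
  also have "expectation (\<lambda>\<omega>. \<zeta> i \<omega> * lin a A \<omega>) = 0"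
    using sp(1)[of 1 1] L4 by (simp add: first_moment)
  finally show ?case using insert by simp
qed

text \<open>In the expansion of the fourth power only the even mixed term survives, since the new
  variable and the old form both have mean zero. Its coefficient 6 is the cross term of 3 (s +
  a^2)^2, as for a Gaussian; the factor \<open>K\<close> covers the fourth power of the new
  variable.\<close>

lemma lin_fourth_moment:
  assumes "A \<subseteq> J"
  shows "expectation (\<lambda>\<omega>. lin a A \<omega> ^ 4) \<le> 3 * K * (\<Sum>i\<in>A. a i ^ 2)^2"
  using finite_subset[OF assms finite_J] assms
proof (induction A rule: finite_induct)
  case empty
  thus ?case by (simp add: lin_def)
next
  case (insert i A)
  note sp = expectation_split[OF insert.prems insert.hyps(2) lin_alg, of a]
  have L4: "L4 (lin a A)" using insert.prems by simp
  have [simp]: "i \<in> J" "A \<subseteq> J" using insert.prems by auto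
  have i: "integrable M (\<lambda>\<omega>. \<zeta> i \<omega> ^ m * lin a A \<omega> ^ k)" if "m \<le> 4" "k \<le> 4" for m k
    using sp(2) that L4 by auto
  note I = i[of 0 4, simplified] i[of 1 3, simplified] i[of 2 2, simplified] i[of 3 1, simplified] i[of 4 0,
      simplified]
  define s where "s = (\<Sum>i\<in>A. a i ^ 2)"
  have *: "lin a (insert i A) \<omega> ^ 4 = lin a A \<omega> ^ 4 + 4 * a i * (\<zeta> i \<omega> * lin a A \<omega> ^ 3)
      + 6 * a i ^ 2 * (\<zeta> i \<omega> ^ 2 * lin a A \<omega> ^ 2) + 4 * a i ^ 3 * (\<zeta> i \<omega> ^ 3 * lin a A \<omega>) + a i ^ 4 * \<zeta> i \<omega>
          ^ 4" for \<omega>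
    unfolding lin_insert[OF insert.hyps]
    by (simp add: power4_eq_xxxx power2_eq_square power3_eq_cube algebra_simps)
  have "expectation (\<lambda>\<omega>. lin a (insert i A) \<omega> ^ 4) =
      expectation (\<lambda>\<omega>. lin a A \<omega> ^ 4) + 4 * a i * expectation (\<lambda>\<omega>. \<zeta> i \<omega> * lin a A \<omega> ^ 3)
      + 6 * a i ^ 2 * expectation (\<lambda>\<omega>. \<zeta> i \<omega> ^ 2 * lin a A \<omega> ^ 2)
      + 4 * a i ^ 3 * expectation (\<lambda>\<omega>. \<zeta> i \<omega> ^ 3 * lin a A \<omega>) + a i ^ 4 * expectation (\<lambda>\<omega>. \<zeta> i \<omega> ^ 4)"
    unfolding * using I by simp
  also have "\<dots> = expectation (\<lambda>\<omega>. lin a A \<omega> ^ 4) + 6 * a i ^ 2 * s + a i ^ 4 * expectation (\<lambda>\<omega>. \<zeta> i \<omega> ^ 4)"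
    using sp(1)[OF L4, of 1 3] sp(1)[OF L4, of 2 2] sp(1)[OF L4, of 3 1]
    by (simp add: first_moment second_moment expectation_lin lin_second_moment s_def)
  also have "\<dots> \<le> 3 * K * s^2 + 6 * K * a i ^ 2 * s + 3 * K * a i ^ 4"
  proof (intro add_mono)
    show "expectation (\<lambda>\<omega>. lin a A \<omega> ^ 4) \<le> 3 * K * s^2"
      using insert unfolding s_def by simp
    have "0 \<le> a i ^ 2 * s" by (simp add: s_def sum_nonneg)
    from mult_right_mono[OF K_ge_1 this] show "6 * (a i)\<^sup>2 * s \<le> 6 * K * (a i)\<^sup>2 * s" by simp
    have "expectation (\<lambda>\<omega>. \<zeta> i \<omega> ^ 4) \<le> 3 * K" using fourth_moment_le[of i] K_ge_1 by simp
    thus "a i ^ 4 * expectation (\<lambda>\<omega>. \<zeta> i \<omega> ^ 4) \<le> 3 * K * a i ^ 4"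
      using mult_left_mono[of "expectation (\<lambda>\<omega>. \<zeta> i \<omega> ^ 4)" "3 * K" "a i ^ 4"] by (simp add: mult.commute)
  qed
  also have "\<dots> = 3 * K * (\<Sum>i\<in>insert i A. a i ^ 2)^2"
    using insert.hyps by (simp add: s_def power4_eq_xxxx power2_eq_square algebra_simps)
  finally show ?case .
qed

end

section \<open>The Cauchy-Schwarz inequality with prescribed bounds\<close>

context prob_space
begin

lemma integrable_mult_square:
  fixes f g :: "'a \<Rightarrow> real"
  assumes [measurable]: "f \<in> borel_measurable M" "g \<in> borel_measurable M"
    and "integrable M (\<lambda>\<omega>. f \<omega> ^ 2)" "integrable M (\<lambda>\<omega>. g \<omega> ^ 2)"
  shows "integrable M (\<lambda>\<omega>. f \<omega> * g \<omega>)"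
proof (rule Bochner_Integration.integrable_bound)
  show "integrable M (\<lambda>\<omega>. f \<omega> ^ 2 + g \<omega> ^ 2)" using assms by simp
  have "\<bar>x * y\<bar> \<le> x ^ 2 + y ^ 2" for x y :: real
  proof -
    have "0 \<le> \<bar>x\<bar> * \<bar>y\<bar>" by simp
    thus ?thesis
      using sum_squares_bound[of "\<bar>x\<bar>" "\<bar>y\<bar>"] unfolding abs_mult power2_abs by linarith
  qed
  thus "AE \<omega> in M. norm (f \<omega> * g \<omega>) \<le> norm (f \<omega> ^ 2 + g \<omega> ^ 2)"
    by auto
qed auto

text \<open>Upper bounds take the place of the norms, so that moment estimates can be inserted
  directly. For positive bounds this is the integrated inequality 2 x y f g \<le> y^2 f^2 + x^2
  g^2.\<close>

lemma expectation_Cauchy_Schwarz: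
  fixes f g :: "'a \<Rightarrow> real"
  assumes m [measurable]: "f \<in> borel_measurable M" "g \<in> borel_measurable M"
    and f: "integrable M (\<lambda>\<omega>. f \<omega> ^ 2)" and g: "integrable M (\<lambda>\<omega>. g \<omega> ^ 2)"
    and x: "expectation (\<lambda>\<omega>. f \<omega> ^ 2) \<le> x ^ 2" "0 \<le> x"
    and y: "expectation (\<lambda>\<omega>. g \<omega> ^ 2) \<le> y ^ 2" "0 \<le> y"
  shows "expectation (\<lambda>\<omega>. f \<omega> * g \<omega>) \<le> x * y"
proof -
  have zero: "expectation (\<lambda>\<omega>. u \<omega> * v \<omega>) = 0"
    if u: "integrable M (\<lambda>\<omega>. u \<omega> ^ 2)" "expectation (\<lambda>\<omega>. u \<omega> ^ 2) \<le> 0" for u v :: "'a \<Rightarrow> real"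
  proof -
    have "expectation (\<lambda>\<omega>. u \<omega> ^ 2) = 0" using u by (simp add: antisym integral_nonneg)
    hence "AE \<omega> in M. u \<omega> ^ 2 = 0" using u(1) by (subst (asm) integral_nonneg_eq_0_iff_AE) auto
    hence "AE \<omega> in M. u \<omega> * v \<omega> = 0" by auto
    thus ?thesis by (simp cong: integral_cong_AE add: integral_eq_zero_AE)
  qed
  \<comment> \<open>A zero bound cannot be divided out; in that case the corresponding function
    vanishes almost everywhere.\<close>
  consider "x = 0" | "y = 0" | "x > 0" "y > 0" using x y by linarith
  thus ?thesis
  proof cases
    case 1 thus ?thesis using zero[OF f, of g] x by simp
  next
    case 2 thus ?thesis using zero[OF g, of f] y by (simp add: mult.commute)
  next
    case 3
    have i: "integrable M (\<lambda>\<omega>. f \<omega> * g \<omega>)" by (rule integrable_mult_square) fact+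
    have "2 * (x * y) * expectation (\<lambda>\<omega>. f \<omega> * g \<omega>) = expectation (\<lambda>\<omega>. 2 * (x * y) * (f \<omega> * g \<omega>))"
      by simp
    also have "\<dots> \<le> expectation (\<lambda>\<omega>. y ^ 2 * f \<omega> ^ 2 + x ^ 2 * g \<omega> ^ 2)"
    proof (rule integral_mono)
      show "2 * (x * y) * (f \<omega> * g \<omega>) \<le> y ^ 2 * f \<omega> ^ 2 + x ^ 2 * g \<omega> ^ 2" for \<omega>
        using sum_squares_bound[of "y * f \<omega>" "x * g \<omega>"] by (simp add: power_mult_distrib mult_ac)
    qed (use f g i in auto)
    also have "\<dots> = y ^ 2 * expectation (\<lambda>\<omega>. f \<omega> ^ 2) + x ^ 2 * expectation (\<lambda>\<omega>. g \<omega> ^ 2)"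
      using f g by simp
    also have "\<dots> \<le> y ^ 2 * x ^ 2 + x ^ 2 * y ^ 2"
      using x y by (intro add_mono mult_left_mono) auto
    also have "\<dots> = 2 * (x * y) * (x * y)" by (simp add: power2_eq_square)
    finally show ?thesis using 3 by (simp add: mult_le_cancel_left_pos)
  qed
qed

lemma expectation_abs_le_sqrt:
  fixes f :: "'a \<Rightarrow> real"
  assumes [measurable]: "f \<in> borel_measurable M" and "integrable M (\<lambda>\<omega>. f \<omega> ^ 2)"
    and "expectation (\<lambda>\<omega>. f \<omega> ^ 2) \<le> c"
  shows "expectation (\<lambda>\<omega>. \<bar>f \<omega>\<bar>) \<le> sqrt c"
proof -
  have "0 \<le> expectation (\<lambda>\<omega>. f \<omega> ^ 2)" by (simp add: integral_nonneg)
  hence "0 \<le> c" using assms(3) by linarith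
  hence "expectation (\<lambda>\<omega>. \<bar>f \<omega>\<bar> * 1) \<le> sqrt c * 1"
    using assms by (intro expectation_Cauchy_Schwarz) (auto simp: prob_space)
  thus ?thesis by simp
qed

end

context unit_family
begin

text \<open>A new variable z adds z L + b_ii (z^2 - 1) to the centered form, with L linear in the
  old variables. This is uncorrelated with the old part, and its two summands are uncorrelated
  because L has mean zero. The constant \<open>2 + K\<close> covers both (x + y)^2 \<le> 2 (x^2 +
  y^2) and the variance of z^2.\<close>

lemma quad_second_moment:
  assumes "A \<subseteq> J"
  shows "integrable M (\<lambda>\<omega>. (quad b A \<omega> - (\<Sum>i\<in>A. b i i)) ^ 2) \<and>
    expectation (\<lambda>\<omega>. (quad b A \<omega> - (\<Sum>i\<in>A. b i i)) ^ 2) \<le> (2 + K) * (\<Sum>i\<in>A. \<Sum>j\<in>A. b i j ^ 2)"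
  using finite_subset[OF assms finite_J] assms
proof (induction A rule: finite_induct)
  case empty
  thus ?case by (simp add: quad_def)
next
  case (insert i A)
  have [simp]: "i \<in> J" "A \<subseteq> J" using insert.prems by auto
  define X where "X \<omega> = quad b A \<omega> - (\<Sum>i\<in>A. b i i)" for \<omega>
  define L where "L = lin (\<lambda>j. b i j + b j i) A"
  have Xm: "X \<in> borel_measurable (alg A)" unfolding X_def by measurable
  have Lm: "L \<in> borel_measurable (alg A)" unfolding L_def by measurable
  have XM [measurable]: "X \<in> borel_measurable M" and LM [measurable]: "L \<in> borel_measurable M"
    using alg_imp_measurable[OF _ Xm] alg_imp_measurable[OF _ Lm] by auto
  have XLm: "(\<lambda>\<omega>. X \<omega> * L \<omega>) \<in> borel_measurable (alg A)" using Xm Lm by measurable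
  have L4: "L4 L" by (simp add: L_def)
  have X2: "integrable M (\<lambda>\<omega>. X \<omega> ^ 2)"
    and EX2: "expectation (\<lambda>\<omega>. X \<omega> ^ 2) \<le> (2 + K) * (\<Sum>i\<in>A. \<Sum>j\<in>A. b i j ^ 2)"
    using insert.IH by (simp_all add: X_def)
  have X1: "integrable M X"
    by (rule square_integrable_imp_integrable[OF XM X2])
  have XL: "integrable M (\<lambda>\<omega>. X \<omega> * L \<omega>)"
    using L4_integrable_power[OF L4, of 2] X2 by (intro integrable_mult_square) auto
  have zm: "(\<lambda>\<omega>. \<zeta> i \<omega> ^ m) \<in> borel_measurable (alg {i})" for m
    using alg_zeta[of i "{i}"] by measurable
  have zi: "integrable M (\<lambda>\<omega>. \<zeta> i \<omega> ^ m)" if "m \<le> 4" for m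
    using that by (intro L4_integrable_power) auto
  have dj: "{i} \<subseteq> J" "A \<subseteq> J" "{i} \<inter> A = {}" using insert.hyps by auto
  note sp = expectation_split[OF insert.prems insert.hyps(2) Lm L4]
  note mz = expectation_mult_alg[OF dj zm]
  have E1: "expectation (\<lambda>\<omega>. \<zeta> i \<omega> * (X \<omega> * L \<omega>)) = 0"
    and I1: "integrable M (\<lambda>\<omega>. \<zeta> i \<omega> * (X \<omega> * L \<omega>))"
    using mz[OF XLm zi XL, of 1] by (simp_all add: first_moment)
  have E2: "expectation (\<lambda>\<omega>. \<zeta> i \<omega> ^ 2 * X \<omega>) = expectation X"
    and I2: "integrable M (\<lambda>\<omega>. \<zeta> i \<omega> ^ 2 * X \<omega>)"
    using mz[OF Xm zi X1, of 2] by (simp_all add: second_moment)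
  have E3: "expectation (\<lambda>\<omega>. \<zeta> i \<omega> ^ 3 * L \<omega>) = 0" "expectation (\<lambda>\<omega>. \<zeta> i \<omega> * L \<omega>) = 0"
    and I3: "integrable M (\<lambda>\<omega>. \<zeta> i \<omega> ^ 3 * L \<omega>)" "integrable M (\<lambda>\<omega>. \<zeta> i \<omega> * L \<omega>)"
    using sp[of 3 1] sp[of 1 1] by (simp_all add: L_def expectation_lin)
  have E4: "expectation (\<lambda>\<omega>. \<zeta> i \<omega> ^ 2 * L \<omega> ^ 2) = (\<Sum>j\<in>A. (b i j + b j i) ^ 2)"
    and I4: "integrable M (\<lambda>\<omega>. \<zeta> i \<omega> ^ 2 * L \<omega> ^ 2)"
    using sp[of 2 2] by (simp_all add: second_moment L_def lin_second_moment)
  have *: "(quad b (insert i A) \<omega> - (\<Sum>i\<in>insert i A. b i i)) ^ 2 =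
     X \<omega> ^ 2 + \<zeta> i \<omega> ^ 2 * L \<omega> ^ 2 + b i i ^ 2 * (\<zeta> i \<omega> ^ 4 - 2 * \<zeta> i \<omega> ^ 2 + 1)
     + 2 * (\<zeta> i \<omega> * (X \<omega> * L \<omega>)) + 2 * b i i * (\<zeta> i \<omega> ^ 2 * X \<omega> - X \<omega>)
     + 2 * b i i * (\<zeta> i \<omega> ^ 3 * L \<omega> - \<zeta> i \<omega> * L \<omega>)" for \<omega>
    unfolding quad_insert[OF insert.hyps] sum.insert[OF insert.hyps] X_def L_def
    by (simp add: power2_eq_square power3_eq_cube power4_eq_xxxx algebra_simps)
  note I = I1 I2 I3 I4 X1 X2 zi
  have "integrable M (\<lambda>\<omega>. (quad b (insert i A) \<omega> - (\<Sum>i\<in>insert i A. b i i)) ^ 2)"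
    unfolding * using I by simp
  moreover have "expectation (\<lambda>\<omega>. (quad b (insert i A) \<omega> - (\<Sum>i\<in>insert i A. b i i)) ^ 2) =
     expectation (\<lambda>\<omega>. X \<omega> ^ 2) + (\<Sum>j\<in>A. (b i j + b j i) ^ 2) + b i i ^ 2 * (expectation (\<lambda>\<omega>. \<zeta> i \<omega> ^ 4) -
         1)"
    unfolding * using I by (simp add: E1 E2 E3 E4 second_moment prob_space)
  moreover have "b i i ^ 2 * (expectation (\<lambda>\<omega>. \<zeta> i \<omega> ^ 4) - 1) \<le> b i i ^ 2 * (2 + K)"
    using fourth_moment_le[of i] by (intro mult_left_mono) auto
  moreover have "(\<Sum>j\<in>A. (b i j + b j i) ^ 2) \<le> (2 + K) * (\<Sum>j\<in>A. b i j ^ 2 + b j i ^ 2)"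
  proof -
    have "(b i j + b j i) ^ 2 \<le> (2 + K) * (b i j ^ 2 + b j i ^ 2)" for j
    proof -
      have "(b i j + b j i) ^ 2 \<le> 2 * (b i j ^ 2 + b j i ^ 2)"
        using sum_squares_bound[of "b i j" "b j i"] by (simp add: power2_sum)
      also have "\<dots> \<le> (2 + K) * (b i j ^ 2 + b j i ^ 2)"
        using K_ge_1 by (intro mult_right_mono) auto
      finally show ?thesis .
    qed
    thus ?thesis unfolding sum_distrib_left by (intro sum_mono)
  qed
  moreover have "(\<Sum>j\<in>insert i A. \<Sum>k\<in>insert i A. b j k ^ 2) =
    (\<Sum>i\<in>A. \<Sum>j\<in>A. b i j ^ 2) + (\<Sum>j\<in>A. b i j ^ 2 + b j i ^ 2) + b i i ^ 2"
    using insert.hyps by (simp add: sum.distrib)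
  ultimately show ?case using EX2 by (simp add: algebra_simps)
qed

text \<open>A zero diagonal keeps the form linear in each variable, so fourth moments suffice. The
  bound is a square because its root is what adds up: from \<open>x ^ 2\<close> for the old form and
  \<open>y ^ 2\<close> for the new linear form, the induction obtains (x + (3 + K) y)^2.\<close>

lemma quad_fourth_moment:
  assumes "A \<subseteq> J" and diag: "\<And>i. i \<in> A \<Longrightarrow> b i i = 0"
  shows "L4 (quad b A) \<and>
    expectation (\<lambda>\<omega>. quad b A \<omega> ^ 4) \<le> (6 * K * (3 + K) * (\<Sum>i\<in>A. \<Sum>j\<in>A. b i j ^ 2)) ^ 2"
  using finite_subset[OF assms(1) finite_J] assms
proof (induction A rule: finite_induct)
  case empty
  thus ?case by (simp add: quad_def)
next
  case (insert i A)
  have [simp]: "i \<in> J" "A \<subseteq> J" "b i i = 0" using insert.prems by auto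
  define X where "X = quad b A"
  define L where "L = lin (\<lambda>j. b i j + b j i) A"
  have Xm [measurable]: "X \<in> borel_measurable (alg A)" unfolding X_def by measurable
  have Lm [measurable]: "L \<in> borel_measurable (alg A)" unfolding L_def by measurable
  have L4: "L4 L" by (simp add: L_def)
  define t where "t = (\<Sum>j\<in>A. b i j ^ 2 + b j i ^ 2)"
  define x where "x = 6 * K * (3 + K) * (\<Sum>i\<in>A. \<Sum>j\<in>A. b i j ^ 2)"
  \<comment> \<open>The fourth moment of linear forms gives E L^4 \<le> 3 K (2 t)^2 = 12 K t^2,
    which is at most 36 K^2 t^2 = y^2 as K \<ge> 1.\<close>
  define y where "y = 6 * K * t"
  have t0: "0 \<le> t" by (simp add: t_def sum_nonneg)
  have x0: "0 \<le> x" and y0: "0 \<le> y" using K_ge_1 t0 by (auto simp: x_def y_def sum_nonneg)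
  have X4: "L4 X" and EX4: "expectation (\<lambda>\<omega>. X \<omega> ^ 4) \<le> x ^ 2"
    using insert by (simp_all add: X_def x_def)
  have EL4: "expectation (\<lambda>\<omega>. L \<omega> ^ 4) \<le> y ^ 2"
  proof -
    have "(b i j + b j i) ^ 2 \<le> 2 * (b i j ^ 2 + b j i ^ 2)" for j
      using sum_squares_bound[of "b i j" "b j i"] by (simp add: power2_sum)
    hence "(\<Sum>j\<in>A. (b i j + b j i) ^ 2) \<le> 2 * t"
      unfolding t_def sum_distrib_left by (intro sum_mono)
    hence "expectation (\<lambda>\<omega>. L \<omega> ^ 4) \<le> 3 * K * (2 * t) ^ 2"
      unfolding L_def
      by (intro order_trans[OF lin_fourth_moment] mult_left_mono power_mono)
         (use K_ge_1 in \<open>auto simp: sum_nonneg\<close>)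
    also have "\<dots> = K * (12 * t\<^sup>2)" by (simp add: power_mult_distrib)
    also have "\<dots> \<le> (3 * K * K) * (12 * t\<^sup>2)"
      using K_ge_1 t0 mult_mono[of 1 K 1 K] by (intro mult_right_mono) (auto simp: mult_le_cancel_right1)
    finally show ?thesis by (simp add: y_def power_mult_distrib power2_eq_square mult_ac)
  qed
  have ind: "expectation (\<lambda>\<omega>. \<zeta> i \<omega> ^ m * (X \<omega> ^ j * L \<omega> ^ k)) = expectation (\<lambda>\<omega>. \<zeta> i \<omega> ^ m) * expectation
      (\<lambda>\<omega>. X \<omega> ^ j * L \<omega> ^ k)"
    "integrable M (\<lambda>\<omega>. \<zeta> i \<omega> ^ m * (X \<omega> ^ j * L \<omega> ^ k))" if "m \<le> 4" "j + k \<le> 4" for m j k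
  proof -
    have dj: "{i} \<subseteq> J" "A \<subseteq> J" "{i} \<inter> A = {}" using insert.hyps by auto
    have zm: "(\<lambda>\<omega>. \<zeta> i \<omega> ^ m) \<in> borel_measurable (alg {i})"
      using alg_zeta[of i "{i}"] by measurable
    have g: "(\<lambda>\<omega>. X \<omega> ^ j * L \<omega> ^ k) \<in> borel_measurable (alg A)" by measurable
    have zi: "integrable M (\<lambda>\<omega>. \<zeta> i \<omega> ^ m)"
      using that by (intro L4_integrable_power) auto
    note mz = expectation_mult_alg[OF dj zm g zi L4_integrable_mult[OF X4 L4 that(2)]]
    show "expectation (\<lambda>\<omega>. \<zeta> i \<omega> ^ m * (X \<omega> ^ j * L \<omega> ^ k)) = expectation (\<lambda>\<omega>. \<zeta> i \<omega> ^ m) * expectation (\<lambda>\<omega>.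
        X \<omega> ^ j * L \<omega> ^ k)"
      by (rule mz(1))
    show "integrable M (\<lambda>\<omega>. \<zeta> i \<omega> ^ m * (X \<omega> ^ j * L \<omega> ^ k))" by (rule mz(2))
  qed
  note ind' = ind[of 1 3 1, simplified] ind[of 2 2 2, simplified] ind[of 3 1 3, simplified]
    ind[of 4 0 4, simplified]
  have Q: "quad b (insert i A) \<omega> = X \<omega> + \<zeta> i \<omega> * L \<omega>" for \<omega>
    unfolding quad_insert[OF insert.hyps] X_def L_def by simp
  have *: "quad b (insert i A) \<omega> ^ 4 = X \<omega> ^ 4 + 4 * (\<zeta> i \<omega> * (X \<omega> ^ 3 * L \<omega>))
     + 6 * (\<zeta> i \<omega> ^ 2 * (X \<omega> ^ 2 * L \<omega> ^ 2)) + 4 * (\<zeta> i \<omega> ^ 3 * (X \<omega> * L \<omega> ^ 3)) + \<zeta> i \<omega> ^ 4 * L \<omega> ^ 4" for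
         \<omega>
    unfolding Q by (simp add: power2_eq_square power3_eq_cube power4_eq_xxxx algebra_simps)
  have int4: "integrable M (\<lambda>\<omega>. quad b (insert i A) \<omega> ^ 4)"
    unfolding * using ind' X4 by (simp add: L4_def)
  have meas: "quad b (insert i A) \<in> borel_measurable M"
    by (rule alg_imp_measurable[OF _ quad_alg]) simp
  have eq: "expectation (\<lambda>\<omega>. quad b (insert i A) \<omega> ^ 4) = expectation (\<lambda>\<omega>. X \<omega> ^ 4)
     + 6 * expectation (\<lambda>\<omega>. X \<omega> ^ 2 * L \<omega> ^ 2) + 4 * (expectation (\<lambda>\<omega>. \<zeta> i \<omega> ^ 3) * expectation (\<lambda>\<omega>. X \<omega> * L
         \<omega> ^ 3))
     + expectation (\<lambda>\<omega>. \<zeta> i \<omega> ^ 4) * expectation (\<lambda>\<omega>. L \<omega> ^ 4)"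
    unfolding * using ind' X4 by (simp add: L4_def first_moment second_moment)
  have XL: "expectation (\<lambda>\<omega>. X \<omega> ^ 2 * L \<omega> ^ 2) \<le> x * y"
    using X4 L4 EX4 EL4 x0 y0 by (intro expectation_Cauchy_Schwarz) (auto simp: L4_def
        power_mult[symmetric])
  have z3: "\<bar>expectation (\<lambda>\<omega>. \<zeta> i \<omega> ^ 3)\<bar> \<le> K"
  proof -
    have "\<bar>z ^ 3\<bar> \<le> (z ^ 2 + z ^ 4) / 2" for z :: real
      using sum_squares_bound[of "\<bar>z\<bar>" "\<bar>z\<bar>^2"]
      by (simp add: power_abs[symmetric] power2_eq_square power3_eq_cube power4_eq_xxxx abs_mult mult_ac)
    hence "\<bar>expectation (\<lambda>\<omega>. \<zeta> i \<omega> ^ 3)\<bar> \<le> expectation (\<lambda>\<omega>. (\<zeta> i \<omega> ^ 2 + \<zeta> i \<omega> ^ 4) / 2)"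
      using L4_integrable_power[OF L4_zeta[of i]]
      by (intro integral_abs_bound[THEN order_trans] integral_mono) auto
    also have "\<dots> = (1 + expectation (\<lambda>\<omega>. \<zeta> i \<omega> ^ 4)) / 2"
      using L4_integrable_power[OF L4_zeta[of i]] by (simp add: second_moment)
    finally show ?thesis using fourth_moment_le[of i] K_ge_1 by simp
  qed
  have XL3: "\<bar>expectation (\<lambda>\<omega>. X \<omega> * L \<omega> ^ 3)\<bar> \<le> (x * y + y ^ 2) / 2"
  proof -
    have "\<bar>u * v ^ 3\<bar> \<le> (u ^ 2 * v ^ 2 + v ^ 4) / 2" for u v :: real
      using sum_squares_bound[of "\<bar>u * v\<bar>" "\<bar>v\<bar>^2"]
      by (simp add: power_abs[symmetric] power2_eq_square power3_eq_cube power4_eq_xxxx abs_mult mult_ac)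
    hence "\<bar>expectation (\<lambda>\<omega>. X \<omega> * L \<omega> ^ 3)\<bar> \<le> expectation (\<lambda>\<omega>. (X \<omega> ^ 2 * L \<omega> ^ 2 + L \<omega> ^ 4) / 2)"
      using L4_integrable_mult[OF X4 L4, of 1 3] L4_integrable_mult[OF X4 L4, of 2 2] L4_integrable_power[OF
          L4, of 4]
      by (intro integral_abs_bound[THEN order_trans] integral_mono) auto
    also have "\<dots> = (expectation (\<lambda>\<omega>. X \<omega> ^ 2 * L \<omega> ^ 2) + expectation (\<lambda>\<omega>. L \<omega> ^ 4)) / 2"
      using L4_integrable_mult[OF X4 L4, of 2 2] L4_integrable_power[OF L4, of 4] by simp
    finally show ?thesis using XL EL4 by simp
  qed
  have "expectation (\<lambda>\<omega>. \<zeta> i \<omega> ^ 3) * expectation (\<lambda>\<omega>. X \<omega> * L \<omega> ^ 3) \<le> K * ((x * y + y ^ 2) / 2)"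
  proof -
    have "\<bar>expectation (\<lambda>\<omega>. \<zeta> i \<omega> ^ 3)\<bar> * \<bar>expectation (\<lambda>\<omega>. X \<omega> * L \<omega> ^ 3)\<bar> \<le> K * ((x * y + y ^ 2) / 2)"
      by (rule mult_mono[OF z3 XL3]) (use K_ge_1 in auto)
    thus ?thesis unfolding abs_mult[symmetric] by linarith
  qed
  moreover have "expectation (\<lambda>\<omega>. \<zeta> i \<omega> ^ 4) * expectation (\<lambda>\<omega>. L \<omega> ^ 4) \<le> K * y ^ 2"
    using fourth_moment_le[of i] EL4 K_ge_1 by (intro mult_mono) auto
  ultimately have "expectation (\<lambda>\<omega>. quad b (insert i A) \<omega> ^ 4) \<le> x ^ 2 + 6 * (x * y) + 4 * (K * ((x * y + y
      ^ 2) / 2)) + K * y ^ 2"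
    unfolding eq using EX4 XL by linarith
  also have "\<dots> = x ^ 2 + 2 * (3 + K) * (x * y) + 3 * K * y ^ 2"
    by (simp add: algebra_simps)
  \<comment> \<open>Since 3 K \<le> (3 + K)^2, the bound becomes a perfect square.\<close>
  also have "\<dots> \<le> x ^ 2 + 2 * (3 + K) * (x * y) + (3 + K) ^ 2 * y ^ 2"
    using K_ge_1 by (intro add_left_mono mult_right_mono) (auto simp: power2_sum)
  also have "\<dots> = (x + (3 + K) * y) ^ 2"
    by (simp add: power2_sum power_mult_distrib)
  also have "x + (3 + K) * y = 6 * K * (3 + K) * ((\<Sum>i\<in>A. \<Sum>j\<in>A. b i j ^ 2) + t)"
    unfolding x_def y_def by (simp only: distrib_left mult.assoc mult.left_commute mult.commute)
  also have "(\<Sum>i\<in>A. \<Sum>j\<in>A. b i j ^ 2) + t = (\<Sum>j\<in>insert i A. \<Sum>k\<in>insert i A. b j k ^ 2)"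
    using insert.hyps by (simp add: t_def sum.distrib)
  finally show ?case using int4 meas by (simp add: L4_def)
qed

end

section \<open>A central limit theorem for quadratic forms\<close>

lemma norm_iexp_diff_le: "norm (iexp x - 1) \<le> \<bar>x\<bar>"
  using iexp_approx1[of x 0] by simp

lemma norm_iexp_diff2_le: "norm (iexp x - 1 - \<i> * x) \<le> x ^ 2 / 2"
  using iexp_approx1[of x 1] by (simp add: algebra_simps power2_eq_square)

section \<open>Characteristic functions close to the normal one\<close>

context prob_space
begin

lemma char_has_vector_derivative:
  assumes [measurable]: "X \<in> borel_measurable M" and X2: "integrable M (\<lambda>\<omega>. X \<omega> ^ 2)"
  shows "((\<lambda>t. CLINT \<omega>|M. iexp (t * X \<omega>)) has_vector_derivative
           \<i> * (CLINT \<omega>|M. X \<omega> * iexp (t * X \<omega>))) (at t within S)"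
  unfolding has_vector_derivative_def has_derivative_within'
proof (safe, rule bounded_linear_scaleR_left)
  \<comment> \<open>The summand 1 keeps \<open>c\<close> positive even if \<open>X\<close> vanishes
    almost everywhere, so that \<open>e / c\<close> is a valid radius.\<close>
  define c where "c = expectation (\<lambda>\<omega>. X \<omega> ^ 2) + 1"
  have c: "c > 0" by (simp add: c_def integral_nonneg add_nonneg_pos)
  have X1: "integrable M X"
    by (rule square_integrable_imp_integrable) (use X2 in auto)
  have Xc: "complex_integrable M (\<lambda>\<omega>. X \<omega> * iexp (s * X \<omega>))" for s
    by (rule Bochner_Integration.integrable_bound[OF X1]) (auto simp: norm_mult)
  have ie: "complex_integrable M (\<lambda>\<omega>. iexp (s * X \<omega>))" for s
    by (rule integrable_iexp) auto
  fix e :: real assume e: "0 < e"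
  have main: "norm ((CLINT \<omega>|M. iexp (s * X \<omega>)) - (CLINT \<omega>|M. iexp (t * X \<omega>))
       - (s - t) *\<^sub>R (\<i> * (CLINT \<omega>|M. X \<omega> * iexp (t * X \<omega>)))) \<le> (s - t) ^ 2 * c / 2" for s
  proof -
    have "(CLINT \<omega>|M. iexp (s * X \<omega>)) - (CLINT \<omega>|M. iexp (t * X \<omega>))
       - (s - t) *\<^sub>R (\<i> * (CLINT \<omega>|M. X \<omega> * iexp (t * X \<omega>))) =
       (CLINT \<omega>|M. iexp (s * X \<omega>) - iexp (t * X \<omega>) - (s - t) *\<^sub>R (\<i> * (X \<omega> * iexp (t * X \<omega>))))"
      using Xc[of t] ie by simp
    also have "norm \<dots> \<le> (LINT \<omega>|M. (s - t) ^ 2 * X \<omega> ^ 2 / 2)"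
    proof (rule order_trans[OF integral_norm_bound], rule integral_mono)
      fix \<omega>
      have "iexp (s * X \<omega>) - iexp (t * X \<omega>) - (s - t) *\<^sub>R (\<i> * (X \<omega> * iexp (t * X \<omega>))) =
        iexp (t * X \<omega>) * (iexp ((s - t) * X \<omega>) - 1 - \<i> * ((s - t) * X \<omega>))"
        by (simp add: algebra_simps scaleR_conv_of_real flip: exp_add)
      also have "norm \<dots> \<le> ((s - t) * X \<omega>) ^ 2 / 2"
        unfolding norm_mult using norm_iexp_diff2_le[of "(s - t) * X \<omega>"] by simp
      finally show "norm (iexp (s * X \<omega>) - iexp (t * X \<omega>) - (s - t) *\<^sub>R (\<i> * (X \<omega> * iexp (t * X \<omega>)))) \<le> (s -
          t) ^ 2 * X \<omega> ^ 2 / 2"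
        by (simp add: power_mult_distrib)
    qed (use Xc[of t] ie X2 in auto)
    also have "\<dots> = (s - t) ^ 2 * expectation (\<lambda>\<omega>. X \<omega> ^ 2) / 2" by simp
    also have "\<dots> \<le> (s - t) ^ 2 * c / 2"
      by (intro divide_right_mono mult_left_mono) (auto simp: c_def)
    finally show ?thesis .
  qed
  show "\<exists>d>0. \<forall>s\<in>S. 0 < norm (s - t) \<and> norm (s - t) < d \<longrightarrow>
      norm ((CLINT \<omega>|M. iexp (s * X \<omega>)) - (CLINT \<omega>|M. iexp (t * X \<omega>))
       - (s - t) *\<^sub>R (\<i> * (CLINT \<omega>|M. X \<omega> * iexp (t * X \<omega>)))) / norm (s - t) < e"
  proof (intro exI[of _ "e / c"] conjI ballI impI)
    fix s assume s: "0 < norm (s - t) \<and> norm (s - t) < e / c"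
    have "(s - t) ^ 2 * c / 2 = norm (s - t) * (norm (s - t) * c / 2)"
      by (simp add: power2_eq_square)
    also have "norm (s - t) * c / 2 < e" using s c e by (simp add: field_simps)
    finally have "(s - t) ^ 2 * c / 2 < norm (s - t) * e" using s by (simp add: mult_strict_left_mono)
    thus "norm ((CLINT \<omega>|M. iexp (s * X \<omega>)) - (CLINT \<omega>|M. iexp (t * X \<omega>))
       - (s - t) *\<^sub>R (\<i> * (CLINT \<omega>|M. X \<omega> * iexp (t * X \<omega>)))) / norm (s - t) < e"
      using main[of s] s by (simp add: divide_less_eq mult.commute)
  qed (use e c in auto)
qed

text \<open>A perturbation of the differential equation \<open>\<phi>' = - t \<phi>\<close> of the standard normal
  characteristic function is integrated with the factor \<open>exp (t\<^sup>2 / 2)\<close>.\<close>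

lemma char_normal_approx:
  assumes [measurable]: "X \<in> borel_measurable M" and X2: "integrable M (\<lambda>\<omega>. X \<omega> ^ 2)"
    and bound: "\<And>s. \<bar>s\<bar> \<le> \<bar>t\<bar> \<Longrightarrow>
      norm ((CLINT \<omega>|M. X \<omega> * iexp (s * X \<omega>)) - \<i> * s * (CLINT \<omega>|M. iexp (s * X \<omega>))) \<le> \<eta>"
  shows "norm ((CLINT \<omega>|M. iexp (t * X \<omega>)) - of_real (exp (- (t ^ 2) / 2))) \<le> \<bar>t\<bar> * \<eta>"
proof -
  define \<phi> where "\<phi> s = (CLINT \<omega>|M. iexp (s * X \<omega>))" for s
  define \<psi> where "\<psi> s = (CLINT \<omega>|M. X \<omega> * iexp (s * X \<omega>))" for s
  define g where "g s = exp (s ^ 2 / 2) *\<^sub>R \<phi> s" for s :: real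
  have d: "(g has_vector_derivative exp (s ^ 2 / 2) *\<^sub>R (\<i> * \<psi> s) + (s * exp (s ^ 2 / 2)) *\<^sub>R \<phi> s)
      (at s within {- \<bar>t\<bar>..\<bar>t\<bar>})" for s
  proof -
    have "((\<lambda>s. exp (s ^ 2 / 2)) has_field_derivative s * exp (s ^ 2 / 2)) (at s within {- \<bar>t\<bar>..\<bar>t\<bar>})"
      by (auto intro!: derivative_eq_intros)
    from has_vector_derivative_scaleR[OF this char_has_vector_derivative[OF assms(1) X2]]
    show ?thesis unfolding g_def \<phi>_def \<psi>_def .
  qed
  have b: "onorm (\<lambda>h. h *\<^sub>R (exp (s ^ 2 / 2) *\<^sub>R (\<i> * \<psi> s) + (s * exp (s ^ 2 / 2)) *\<^sub>R \<phi> s)) \<le> exp (t ^ 2 /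
      2) * \<eta>"
    if s: "s \<in> {- \<bar>t\<bar>..\<bar>t\<bar>}" for s
  proof (rule onorm_bound)
    have "\<bar>s\<bar> \<le> \<bar>t\<bar>" using s by auto
    \<comment> \<open>As \<phi>' = i \<psi>, the derivative of \<open>g\<close> is i exp (s^2 / 2)
      times the deviation \<psi> - i s \<phi> that the hypothesis bounds.\<close>
    have "exp (s ^ 2 / 2) *\<^sub>R (\<i> * \<psi> s) + (s * exp (s ^ 2 / 2)) *\<^sub>R \<phi> s
       = exp (s ^ 2 / 2) *\<^sub>R (\<i> * (\<psi> s - \<i> * s * \<phi> s))"
      by (simp add: scaleR_conv_of_real algebra_simps)
    also have "norm \<dots> = exp (s ^ 2 / 2) * norm (\<psi> s - \<i> * s * \<phi> s)"
      by (simp add: norm_mult)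
    also have "\<dots> \<le> exp (t ^ 2 / 2) * \<eta>"
      using bound[OF \<open>\<bar>s\<bar> \<le> \<bar>t\<bar>\<close>] \<open>\<bar>s\<bar> \<le> \<bar>t\<bar>\<close>
      by (intro mult_mono) (auto simp: \<phi>_def \<psi>_def abs_le_square_iff)
    finally have *: "norm (exp (s ^ 2 / 2) *\<^sub>R (\<i> * \<psi> s) + (s * exp (s ^ 2 / 2)) *\<^sub>R \<phi> s) \<le> exp (t ^ 2 / 2)
        * \<eta>" .
    show "norm (h *\<^sub>R (exp (s ^ 2 / 2) *\<^sub>R (\<i> * \<psi> s) + (s * exp (s ^ 2 / 2)) *\<^sub>R \<phi> s)) \<le> exp (t ^ 2 / 2) * \<eta>
        * norm h" for h
      unfolding norm_scaleR using mult_left_mono[OF *, of "\<bar>h\<bar>"] by (simp add: mult.commute)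
    show "0 \<le> exp (t ^ 2 / 2) * \<eta>" using * norm_ge_zero order_trans by blast
  qed
  have "norm (g t - g 0) \<le> exp (t ^ 2 / 2) * \<eta> * norm (t - 0)"
    using d b unfolding has_vector_derivative_def
    by (intro differentiable_bound[where S = "{- \<bar>t\<bar>..\<bar>t\<bar>}"]) auto
  also have "g 0 = 1" by (simp add: g_def \<phi>_def prob_space)
  finally have "exp (- (t ^ 2) / 2) * norm (g t - 1) \<le> exp (- (t ^ 2) / 2) * (exp (t ^ 2 / 2) * \<eta> * norm (t
      - 0))"
    by (intro mult_left_mono) auto
  also have "\<dots> = \<bar>t\<bar> * \<eta>" by (simp add: exp_minus field_simps)
  also have "exp (- (t ^ 2) / 2) * norm (g t - 1) = norm (exp (- (t ^ 2) / 2) *\<^sub>R (g t - 1))" by simp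
  also have "exp (- (t ^ 2) / 2) *\<^sub>R (g t - 1) = \<phi> t - of_real (exp (- (t ^ 2) / 2))"
    by (simp add: g_def algebra_simps scaleR_conv_of_real flip: exp_add)
       (simp flip: of_real_mult of_real_exp exp_add)
  finally show ?thesis unfolding \<phi>_def .
qed

end

context unit_family
begin

lemma L4_quad: "A \<subseteq> J \<Longrightarrow> (\<And>i. i \<in> A \<Longrightarrow> b i i = 0) \<Longrightarrow> L4 (quad b A)"
  using quad_fourth_moment by blast

lemma zeta_abs_moments:
  assumes "i \<in> J"
  shows "expectation (\<lambda>\<omega>. \<bar>\<zeta> i \<omega>\<bar>) \<le> K" "expectation (\<lambda>\<omega>. \<bar>\<zeta> i \<omega>\<bar> ^ 3) \<le> K"
    "integrable M (\<lambda>\<omega>. \<bar>\<zeta> i \<omega>\<bar>)" "integrable M (\<lambda>\<omega>. \<bar>\<zeta> i \<omega>\<bar> ^ 3)"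
proof -
  note I = L4_integrable_power[OF L4_zeta[OF assms]]
  note z = measurable_zeta[OF assms]
  have [measurable]: "\<zeta> i \<in> borel_measurable M" by fact
  show "integrable M (\<lambda>\<omega>. \<bar>\<zeta> i \<omega>\<bar>)" "integrable M (\<lambda>\<omega>. \<bar>\<zeta> i \<omega>\<bar> ^ 3)"
    using integrable_abs[OF I[of 1]] integrable_abs[OF I[of 3]] by (simp_all add: power_abs)
  have "expectation (\<lambda>\<omega>. \<bar>\<zeta> i \<omega>\<bar>) \<le> sqrt 1"
    using I[of 2] by (intro expectation_abs_le_sqrt) (auto simp: second_moment assms)
  thus "expectation (\<lambda>\<omega>. \<bar>\<zeta> i \<omega>\<bar>) \<le> K" using K_ge_1 by simp
  have sK: "0 \<le> sqrt K" "sqrt K ^ 2 = K" "sqrt K \<le> K"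
    using K_ge_1 by (auto intro!: real_le_lsqrt simp: power2_eq_square mult_le_cancel_right1)
  have "expectation (\<lambda>\<omega>. \<bar>\<zeta> i \<omega>\<bar> * \<bar>\<zeta> i \<omega>\<bar> ^ 2) \<le> 1 * sqrt K"
    using I[of 2] I[of 4] sK fourth_moment_le[OF assms]
    by (intro expectation_Cauchy_Schwarz) (auto simp: second_moment assms simp flip: power_mult)
  also have "\<dots> \<le> K" using sK by simp
  finally show "expectation (\<lambda>\<omega>. \<bar>\<zeta> i \<omega>\<bar> ^ 3) \<le> K"
    by (simp add: power3_eq_cube power2_eq_square mult_ac)
qed

text \<open>Split |L|^3 into |L| and L^2 and use the second and fourth moments; \<open>2 * K\<close>
  is a root-free substitute for the root of 3 K, since 3 K \<le> 4 K^2.\<close>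

lemma lin_abs_third_moment:
  assumes "A \<subseteq> J"
  shows "expectation (\<lambda>\<omega>. \<bar>lin a A \<omega>\<bar> ^ 3) \<le> 2 * K * sqrt (\<Sum>i\<in>A. a i ^ 2) ^ 3"
    and "integrable M (\<lambda>\<omega>. \<bar>lin a A \<omega>\<bar> ^ 3)"
proof -
  define s where "s = sqrt (\<Sum>i\<in>A. a i ^ 2)"
  have s: "0 \<le> s" "(\<Sum>i\<in>A. a i ^ 2) = s ^ 2" by (auto simp: s_def sum_nonneg)
  note I = L4_integrable_power[OF L4_lin[OF assms, of a]]
  have [measurable]: "lin a A \<in> borel_measurable M" by (rule alg_imp_measurable[OF assms lin_alg])
  show "integrable M (\<lambda>\<omega>. \<bar>lin a A \<omega>\<bar> ^ 3)"
    using integrable_abs[OF I[of 3]] by (simp add: power_abs)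
  have "3 * K * (s ^ 2) ^ 2 \<le> (4 * K * K) * (s ^ 2) ^ 2"
    using K_ge_1 by (intro mult_right_mono) (auto simp: mult_le_cancel_right)
  also have "\<dots> = (2 * K * s ^ 2) ^ 2" by (simp add: power2_eq_square)
  finally have "expectation (\<lambda>\<omega>. lin a A \<omega> ^ 4) \<le> (2 * K * s ^ 2) ^ 2"
    using lin_fourth_moment[OF assms, of a] s by simp
  hence "expectation (\<lambda>\<omega>. \<bar>lin a A \<omega>\<bar> * \<bar>lin a A \<omega>\<bar> ^ 2) \<le> s * (2 * K * s ^ 2)"
    using I[of 2] I[of 4] K_ge_1 s
    by (intro expectation_Cauchy_Schwarz) (auto simp: lin_second_moment[OF assms] simp flip: power_mult)
  thus "expectation (\<lambda>\<omega>. \<bar>lin a A \<omega>\<bar> ^ 3) \<le> 2 * K * s ^ 3"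
    by (simp add: power3_eq_cube power2_eq_square mult_ac)
qed

text \<open>Stein-type identity for one variable: the quadratic form is \<open>U + 2 \<zeta> v\<close> with \<open>U\<close> and \<open>v\<close>
  independent of \<open>\<zeta>\<close>, and the exponential is expanded in \<open>\<zeta>\<close>.\<close>

lemma stein_term:
  assumes i: "i \<in> J" and sym: "\<And>i j. i \<in> J \<Longrightarrow> j \<in> J \<Longrightarrow> W i j = W j i"
    and diag: "\<And>i. i \<in> J \<Longrightarrow> W i i = 0"
  defines "v \<equiv> lin (W i) J" and "T \<equiv> quad W J"
  shows "norm ((CLINT \<omega>|M. \<zeta> i \<omega> * v \<omega> * iexp (t * T \<omega>)) - 2 * \<i> * t * (CLINT \<omega>|M. v \<omega> ^ 2 * iexp (t * T
      \<omega>)))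
      \<le> 12 * K ^ 2 * t ^ 2 * sqrt (\<Sum>j\<in>J. W i j ^ 2) ^ 3"
proof -
  define A where "A = J - {i}"
  define U where "U = quad W A"
  have A: "A \<subseteq> J" "finite A" "i \<notin> A" "insert i A = J" "{i} \<subseteq> J" "{i} \<inter> A = {}"
    using i finite_J by (auto simp: A_def)
  \<comment> \<open>\<open>W i i = 0\<close> removes variable \<open>i\<close> from its own linear
    form, which is therefore independent of it.\<close>
  have v: "v = lin (W i) A"
    using lin_insert[OF A(2,3), of "W i"] diag[OF i] A(4) by (auto simp: v_def)
  have lin2: "lin (\<lambda>j. W i j + W j i) A \<omega> = 2 * v \<omega>" for \<omega>
    unfolding v lin_def sum_distrib_left using sym[OF i] A(1) by (intro sum.cong) auto
  have T: "T \<omega> = U \<omega> + 2 * \<zeta> i \<omega> * v \<omega>" for \<omega>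
    using quad_insert[OF A(2,3), of W \<omega>] lin2[of \<omega>] diag[OF i] A(4) by (simp add: U_def T_def)
  have vA [measurable]: "v \<in> borel_measurable (alg A)" and UA [measurable]: "U \<in> borel_measurable (alg A)"
    unfolding v U_def by measurable
  have vM [measurable]: "v \<in> borel_measurable M" and UM [measurable]: "U \<in> borel_measurable M"
    by (rule alg_imp_measurable[OF A(1) vA], rule alg_imp_measurable[OF A(1) UA])
  have zM [measurable]: "\<zeta> i \<in> borel_measurable M" by (rule measurable_zeta[OF i])
  have zA [measurable]: "\<zeta> i \<in> borel_measurable (alg {i})" by (rule alg_zeta) simp
  have v4: "L4 v" unfolding v by (rule L4_lin[OF A(1)])
  have z4: "L4 (\<zeta> i)" using i by simp
  define e where "e \<omega> = iexp (t * U \<omega>)" for \<omega>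
  have eA [measurable]: "e \<in> borel_measurable (alg A)" unfolding e_def by measurable
  have eM [measurable]: "e \<in> borel_measurable M" unfolding e_def by measurable
  have ne: "norm (e \<omega>) = 1" for \<omega> by (simp add: e_def)
  have int_v1: "complex_integrable M (\<lambda>\<omega>. v \<omega> * e \<omega>)"
    by (rule Bochner_Integration.integrable_bound[OF L4_integrable[OF v4]]) (auto simp: norm_mult ne)
  have int_v2: "complex_integrable M (\<lambda>\<omega>. v \<omega> ^ 2 * e \<omega>)"
    by (rule Bochner_Integration.integrable_bound[OF L4_integrable_power[OF v4, of 2]])
       (auto simp: norm_mult norm_power ne)
  have int_z: "complex_integrable M (\<lambda>\<omega>. complex_of_real (\<zeta> i \<omega> ^ m))" if "m \<le> 4" for m
    using L4_integrable_power[OF z4 that] by (rule integrable_of_real)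
  have mA: "(\<lambda>\<omega>. complex_of_real (\<zeta> i \<omega> ^ m)) \<in> borel_measurable (alg {i})" for m
    by measurable
  have mB: "(\<lambda>\<omega>. v \<omega> ^ m * e \<omega>) \<in> borel_measurable (alg A)" for m
    by measurable
  note em = expectation_mult_alg[OF A(5,1,6) mA mB int_z]
  have E1: "(CLINT \<omega>|M. complex_of_real (\<zeta> i \<omega>) * (v \<omega> * e \<omega>)) = 0"
    and I1: "complex_integrable M (\<lambda>\<omega>. complex_of_real (\<zeta> i \<omega>) * (v \<omega> * e \<omega>))"
    using em[of 1 1] int_v1 first_moment[OF i] by (simp_all add: integral_of_real)
  have E2: "(CLINT \<omega>|M. complex_of_real (\<zeta> i \<omega> ^ 2) * (v \<omega> ^ 2 * e \<omega>)) = (CLINT \<omega>|M. v \<omega> ^ 2 * e \<omega>)"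
    and I2: "complex_integrable M (\<lambda>\<omega>. complex_of_real (\<zeta> i \<omega> ^ 2) * (v \<omega> ^ 2 * e \<omega>))"
    using em[of 2 2] int_v2 second_moment[OF i] integral_of_real[of M "\<lambda>\<omega>. \<zeta> i \<omega> ^ 2"]
    by (simp_all del: of_real_power)
  have J1: "complex_integrable M (\<lambda>\<omega>. \<zeta> i \<omega> * v \<omega> * iexp (t * T \<omega>))"
    by (rule Bochner_Integration.integrable_bound[OF L4_integrable_prod[OF z4 v4]])
       (auto simp: norm_mult T abs_mult)
  have J2: "complex_integrable M (\<lambda>\<omega>. v \<omega> ^ 2 * iexp (t * T \<omega>))"
    by (rule Bochner_Integration.integrable_bound[OF L4_integrable_power[OF v4, of 2]])
       (auto simp: norm_mult norm_power T)
  \<comment> \<open>The subtracted terms containing \<open>e\<close> have mean zero in total,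
    because \<open>v\<close> and \<open>e\<close> do not involve variable \<open>i\<close>, whose
    mean is 0 and second moment 1. They turn \<open>H\<close> into a Taylor remainder that is cubic
    in \<open>v\<close>.\<close>
  define H where "H \<omega> = \<zeta> i \<omega> * v \<omega> * iexp (t * T \<omega>) - 2 * \<i> * t * (v \<omega> ^ 2 * iexp (t * T \<omega>))
     - complex_of_real (\<zeta> i \<omega>) * (v \<omega> * e \<omega>)
     - 2 * \<i> * t * (complex_of_real (\<zeta> i \<omega> ^ 2) * (v \<omega> ^ 2 * e \<omega>) - v \<omega> ^ 2 * e \<omega>)" for \<omega>
  have EH: "(CLINT \<omega>|M. \<zeta> i \<omega> * v \<omega> * iexp (t * T \<omega>)) - 2 * \<i> * t * (CLINT \<omega>|M. v \<omega> ^ 2 * iexp (t * T \<omega>))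
     = (CLINT \<omega>|M. H \<omega>)"
    unfolding H_def using J1 J2 I1 I2 int_v2 by (simp add: E1 E2 del: of_real_power)
  have nv3: "expectation (\<lambda>\<omega>. \<bar>v \<omega>\<bar> ^ 3) \<le> 2 * K * sqrt (\<Sum>j\<in>J. W i j ^ 2) ^ 3"
    and iv3: "integrable M (\<lambda>\<omega>. \<bar>v \<omega>\<bar> ^ 3)"
    using lin_abs_third_moment[of J "W i"] by (auto simp: v_def)
  have zz: "integrable M (\<lambda>\<omega>. 2 * t ^ 2 * \<bar>\<zeta> i \<omega>\<bar> ^ 3 + 4 * t ^ 2 * \<bar>\<zeta> i \<omega>\<bar>)"
    using zeta_abs_moments[OF i] by simp
  have zzm: "(\<lambda>\<omega>. 2 * t ^ 2 * \<bar>\<zeta> i \<omega>\<bar> ^ 3 + 4 * t ^ 2 * \<bar>\<zeta> i \<omega>\<bar>) \<in> borel_measurable (alg {i})"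
    by measurable
  have vvm: "(\<lambda>\<omega>. \<bar>v \<omega>\<bar> ^ 3) \<in> borel_measurable (alg A)" by measurable
  note fin = expectation_mult_alg[OF A(5,1,6) zzm vvm zz iv3]
  have "norm (CLINT \<omega>|M. H \<omega>) \<le> expectation (\<lambda>\<omega>. (2 * t ^ 2 * \<bar>\<zeta> i \<omega>\<bar> ^ 3 + 4 * t ^ 2 * \<bar>\<zeta> i \<omega>\<bar>) * \<bar>v \<omega>\<bar> ^
      3)"
  proof (rule order_trans[OF integral_norm_bound], rule integral_mono[OF _ fin(2)])
    show "integrable M (\<lambda>\<omega>. norm (H \<omega>))"
      unfolding H_def using J1 J2 I1 I2 int_v2
      by (intro integrable_norm Bochner_Integration.integrable_diff integrable_mult_right) auto
    fix \<omega>
    define \<theta> where "\<theta> = 2 * t * \<zeta> i \<omega> * v \<omega>"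
    have T': "iexp (t * T \<omega>) = e \<omega> * iexp \<theta>"
      by (simp add: e_def T \<theta>_def algebra_simps flip: exp_add)
    have "H \<omega> = v \<omega> * e \<omega> * (\<zeta> i \<omega> * (iexp \<theta> - 1 - \<i> * \<theta>) - 2 * \<i> * t * v \<omega> * (iexp \<theta> - 1))"
      unfolding H_def T' by (simp add: \<theta>_def algebra_simps power2_eq_square)
    also have "norm \<dots> \<le> \<bar>v \<omega>\<bar> * (\<bar>\<zeta> i \<omega>\<bar> * (\<theta> ^ 2 / 2) + 2 * \<bar>t\<bar> * \<bar>v \<omega>\<bar> * \<bar>\<theta>\<bar>)"
    proof -
      have "norm (\<zeta> i \<omega> * (iexp \<theta> - 1 - \<i> * \<theta>)) \<le> \<bar>\<zeta> i \<omega>\<bar> * (\<theta> ^ 2 / 2)"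
        unfolding norm_mult norm_of_real by (intro mult_left_mono norm_iexp_diff2_le) auto
      moreover have "norm (2 * \<i> * t * v \<omega> * (iexp \<theta> - 1)) \<le> 2 * \<bar>t\<bar> * \<bar>v \<omega>\<bar> * \<bar>\<theta>\<bar>"
        unfolding norm_mult norm_of_real using norm_iexp_diff_le[of \<theta>] by (auto intro!: mult_left_mono)
      ultimately have "norm (\<zeta> i \<omega> * (iexp \<theta> - 1 - \<i> * \<theta>) - 2 * \<i> * t * v \<omega> * (iexp \<theta> - 1)) \<le> \<bar>\<zeta> i \<omega>\<bar> * (\<theta> ^
          2 / 2) + 2 * \<bar>t\<bar> * \<bar>v \<omega>\<bar> * \<bar>\<theta>\<bar>"
        by (intro norm_triangle_ineq4[THEN order_trans] add_mono)
      thus ?thesis unfolding norm_mult[of "v \<omega> * e \<omega>"] by (simp add: norm_mult ne mult_left_mono)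
    qed
    also have "\<dots> = (2 * t ^ 2 * \<bar>\<zeta> i \<omega>\<bar> ^ 3 + 4 * t ^ 2 * \<bar>\<zeta> i \<omega>\<bar>) * \<bar>v \<omega>\<bar> ^ 3"
    proof -
      have "\<theta> ^ 2 = 4 * \<bar>t\<bar> ^ 2 * \<bar>\<zeta> i \<omega>\<bar> ^ 2 * \<bar>v \<omega>\<bar> ^ 2" "\<bar>\<theta>\<bar> = 2 * \<bar>t\<bar> * \<bar>\<zeta> i \<omega>\<bar> * \<bar>v \<omega>\<bar>" "t ^ 2 = \<bar>t\<bar> ^
          2"
        by (simp_all add: \<theta>_def power_mult_distrib abs_mult)
      thus ?thesis by (simp only:) (simp add: power2_eq_square power3_eq_cube algebra_simps)
    qed
    finally show "norm (H \<omega>) \<le> (2 * t ^ 2 * \<bar>\<zeta> i \<omega>\<bar> ^ 3 + 4 * t ^ 2 * \<bar>\<zeta> i \<omega>\<bar>) * \<bar>v \<omega>\<bar> ^ 3" .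
  qed
  also have "\<dots> = (2 * t ^ 2 * expectation (\<lambda>\<omega>. \<bar>\<zeta> i \<omega>\<bar> ^ 3) + 4 * t ^ 2 * expectation (\<lambda>\<omega>. \<bar>\<zeta> i \<omega>\<bar>)) *
      expectation (\<lambda>\<omega>. \<bar>v \<omega>\<bar> ^ 3)"
    unfolding fin(1) using zeta_abs_moments[OF i] by simp
  also have "\<dots> \<le> (2 * t ^ 2 * K + 4 * t ^ 2 * K) * (2 * K * sqrt (\<Sum>j\<in>J. W i j ^ 2) ^ 3)"
    using zeta_abs_moments(1,2)[OF i] K_ge_1 nv3
    by (intro mult_mono add_mono mult_left_mono) (auto simp: integral_nonneg)
  also have "\<dots> = 12 * K ^ 2 * t ^ 2 * sqrt (\<Sum>j\<in>J. W i j ^ 2) ^ 3"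
    by (simp add: power2_eq_square)
  finally show ?thesis unfolding EH[symmetric] by simp
qed

text \<open>\<open>unit\<close> says that the form has variance one, and \<open>D\<close> is tr
  (W^4). Summing the identity for single variables gives E T exp (i t T) close to 2 i t E Q exp (i t
  T), where Q is the sum of the squares v_i^2; replacing Q by its mean 1/2 yields the differential
  equation.\<close>

theorem quad_char_bound:
  assumes sym: "\<And>i j. i \<in> J \<Longrightarrow> j \<in> J \<Longrightarrow> W i j = W j i"
    and diag: "\<And>i. i \<in> J \<Longrightarrow> W i i = 0"
    and unit: "2 * (\<Sum>i\<in>J. \<Sum>j\<in>J. W i j ^ 2) = 1"
  defines "D \<equiv> (\<Sum>j\<in>J. \<Sum>k\<in>J. (\<Sum>i\<in>J. W j i * W i k) ^ 2)"
  shows "norm ((CLINT \<omega>|M. iexp (t * quad W J \<omega>)) - of_real (exp (- (t ^ 2) / 2)))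
    \<le> \<bar>t\<bar> * (6 * K ^ 2 * t ^ 2 * sqrt (sqrt D) + 2 * \<bar>t\<bar> * sqrt ((2 + K) * D))"
proof (rule char_normal_approx)
  let ?T = "quad W J" and ?v = "\<lambda>i. lin (W i) J"
  define s where "s i = sqrt (\<Sum>j\<in>J. W i j ^ 2)" for i
  define B where "B j k = (\<Sum>i\<in>J. W j i * W i k)" for j k
  have D0: "0 \<le> D" by (auto simp: D_def sum_nonneg)
  have T4: "L4 ?T" using diag by (intro L4_quad) auto
  show Tm [measurable]: "?T \<in> borel_measurable M" using T4 by (rule L4_measurable)
  show "integrable M (\<lambda>\<omega>. ?T \<omega> ^ 2)" using T4 by (intro L4_integrable_power) auto
  have v4: "L4 (?v i)" for i by simp
  have [measurable]: "?v i \<in> borel_measurable M" for i using v4 by (rule L4_measurable)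
  have Tsum: "?T \<omega> = (\<Sum>i\<in>J. \<zeta> i \<omega> * ?v i \<omega>)" for \<omega>
    unfolding quad_def lin_def by (simp add: sum_distrib_left mult_ac)
  define Q where "Q \<omega> = (\<Sum>i\<in>J. ?v i \<omega> ^ 2)" for \<omega>
  \<comment> \<open>\<open>Q\<close> is the quadratic form of W^2. Its trace is 1/2 and its squared
    Frobenius norm is \<open>D\<close>, so the second moment bound for forms with a diagonal
    applies.\<close>
  have Qq: "Q \<omega> = quad B J \<omega>" for \<omega>
  proof -
    have "Q \<omega> = (\<Sum>i\<in>J. \<Sum>j\<in>J. \<Sum>k\<in>J. W i j * \<zeta> j \<omega> * (W i k * \<zeta> k \<omega>))"
      unfolding Q_def lin_def power2_eq_square sum_product ..
    also have "\<dots> = (\<Sum>j\<in>J. \<Sum>i\<in>J. \<Sum>k\<in>J. W i j * \<zeta> j \<omega> * (W i k * \<zeta> k \<omega>))"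
      by (rule sum.swap)
    also have "\<dots> = (\<Sum>j\<in>J. \<Sum>k\<in>J. \<Sum>i\<in>J. W i j * \<zeta> j \<omega> * (W i k * \<zeta> k \<omega>))"
      by (intro sum.cong refl sum.swap)
    also have "\<dots> = quad B J \<omega>"
      unfolding quad_def B_def sum_distrib_right using sym by (intro sum.cong refl) (auto simp: mult_ac)
    finally show ?thesis .
  qed
  have Bd: "B i i = s i ^ 2" if "i \<in> J" for i
    using sym that by (auto simp: B_def s_def power2_eq_square sum_nonneg intro!: sum.cong)
  have ss: "(\<Sum>i\<in>J. s i ^ 2) = 1 / 2"
    using unit by (simp add: s_def sum_nonneg)
  have Qm: "integrable M (\<lambda>\<omega>. (Q \<omega> - 1 / 2) ^ 2) \<and> expectation (\<lambda>\<omega>. (Q \<omega> - 1 / 2) ^ 2) \<le> (2 + K) * D"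
    using quad_second_moment[of J B] by (simp add: Qq Bd ss) (simp add: B_def D_def)
  have Q1: "expectation (\<lambda>\<omega>. \<bar>Q \<omega> - 1 / 2\<bar>) \<le> sqrt ((2 + K) * D)"
    using Qm by (intro expectation_abs_le_sqrt) (auto simp: Q_def)
  have iQ: "integrable M Q" unfolding Q_def
    by (intro Bochner_Integration.integrable_sum L4_integrable_power v4) auto
  \<comment> \<open>The fourth power of the row norm \<open>s i\<close> is the square of a diagonal
    entry of W^2, hence at most \<open>D\<close>. So the largest row norm, and with it the sum of
    the cubes, is small.\<close>
  have s_le: "s i ^ 3 \<le> sqrt (sqrt D) * s i ^ 2" if "i \<in> J" for i
  proof -
    have "(s i ^ 2) ^ 2 = B i i ^ 2" using Bd[OF that] by simp
    also have "\<dots> \<le> (\<Sum>k\<in>J. B i k ^ 2)"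
      using that finite_J by (intro member_le_sum) auto
    also have "\<dots> \<le> D"
      unfolding D_def B_def[symmetric] using that finite_J
      by (intro member_le_sum[where f = "\<lambda>j. \<Sum>k\<in>J. B j k ^ 2"]) (auto simp: sum_nonneg)
    finally have "s i \<le> sqrt (sqrt D)"
      by (intro real_le_rsqrt)
    from mult_right_mono[OF this, of "s i ^ 2"] show ?thesis
      by (simp add: power3_eq_cube power2_eq_square)
  qed
  fix u :: real assume u: "\<bar>u\<bar> \<le> \<bar>t\<bar>"
  define e where "e \<omega> = iexp (u * ?T \<omega>)" for \<omega>
  have [measurable]: "e \<in> borel_measurable M" unfolding e_def by measurable
  have ne: "norm (e \<omega>) = 1" for \<omega> by (simp add: e_def)
  have J1: "complex_integrable M (\<lambda>\<omega>. \<zeta> i \<omega> * ?v i \<omega> * e \<omega>)" if "i \<in> J" for i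
    using measurable_zeta[OF that]
    by (intro Bochner_Integration.integrable_bound[OF L4_integrable_prod[OF L4_zeta[OF that] v4[of i]]])
       (auto simp: norm_mult ne abs_mult)
  have J2: "complex_integrable M (\<lambda>\<omega>. ?v i \<omega> ^ 2 * e \<omega>)" for i
    by (rule Bochner_Integration.integrable_bound[OF L4_integrable_power[OF v4, of 2]])
       (auto simp: norm_mult norm_power ne)
  have J3: "complex_integrable M (\<lambda>\<omega>. Q \<omega> * e \<omega>)" "complex_integrable M e"
  proof -
    have [measurable]: "Q \<in> borel_measurable M" unfolding Q_def by measurable
    show "complex_integrable M (\<lambda>\<omega>. Q \<omega> * e \<omega>)"
      by (rule Bochner_Integration.integrable_bound[OF iQ]) (auto simp: norm_mult ne)
    show "complex_integrable M e"
      by (rule Bochner_Integration.integrable_bound[of M "\<lambda>_. 1 :: real"]) (auto simp: ne)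
  qed
  have "(CLINT \<omega>|M. ?T \<omega> * e \<omega>) - 2 * \<i> * u * (CLINT \<omega>|M. Q \<omega> * e \<omega>) =
     (\<Sum>i\<in>J. (CLINT \<omega>|M. \<zeta> i \<omega> * ?v i \<omega> * e \<omega>) - 2 * \<i> * u * (CLINT \<omega>|M. ?v i \<omega> ^ 2 * e \<omega>))"
    unfolding Tsum Q_def of_real_sum sum_distrib_right sum_subtractf
    using J1 J2 by (simp add: Bochner_Integration.integral_sum sum_distrib_left)
  also have "norm \<dots> \<le> (\<Sum>i\<in>J. 12 * K ^ 2 * u ^ 2 * s i ^ 3)"
  proof (rule sum_norm_le)
    fix i assume "i \<in> J"
    from stein_term[where W = W and t = u, OF this sym diag]
    show "norm ((CLINT \<omega>|M. \<zeta> i \<omega> * ?v i \<omega> * e \<omega>) - 2 * \<i> * u * (CLINT \<omega>|M. ?v i \<omega> ^ 2 * e \<omega>))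
        \<le> 12 * K ^ 2 * u ^ 2 * s i ^ 3"
      unfolding e_def s_def by simp
  qed
  also have "\<dots> \<le> (\<Sum>i\<in>J. 12 * K ^ 2 * u ^ 2 * (sqrt (sqrt D) * s i ^ 2))"
    using s_le by (intro sum_mono mult_left_mono) auto
  also have "\<dots> = 12 * K ^ 2 * u ^ 2 * (sqrt (sqrt D) * (1 / 2))"
    unfolding ss[symmetric] sum_distrib_left ..
  also have "\<dots> \<le> 6 * K ^ 2 * t ^ 2 * sqrt (sqrt D)"
  proof -
    have "K ^ 2 * u ^ 2 * sqrt (sqrt D) \<le> K ^ 2 * t ^ 2 * sqrt (sqrt D)"
      using u D0 by (intro mult_right_mono mult_left_mono) (auto simp: abs_le_square_iff)
    thus ?thesis by (simp add: mult_ac)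
  qed
  finally have 1: "norm ((CLINT \<omega>|M. ?T \<omega> * e \<omega>) - 2 * \<i> * u * (CLINT \<omega>|M. Q \<omega> * e \<omega>)) \<le> 6 * K ^ 2 * t ^ 2 *
      sqrt (sqrt D)" .
  have "2 * \<i> * u * (CLINT \<omega>|M. Q \<omega> * e \<omega>) - \<i> * u * (CLINT \<omega>|M. e \<omega>)
     = 2 * \<i> * u * (CLINT \<omega>|M. complex_of_real (Q \<omega> - 1 / 2) * e \<omega>)"
    using J3 by (simp add: algebra_simps)
  also have "norm \<dots> \<le> 2 * \<bar>t\<bar> * sqrt ((2 + K) * D)"
    unfolding norm_mult
  proof (intro mult_mono)
    have "norm (CLINT \<omega>|M. complex_of_real (Q \<omega> - 1 / 2) * e \<omega>) \<le> expectation (\<lambda>\<omega>. \<bar>Q \<omega> - 1 / 2\<bar>)"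
      using integral_norm_bound[of M "\<lambda>\<omega>. complex_of_real (Q \<omega> - 1 / 2) * e \<omega>"]
      by (simp add: norm_mult ne del: of_real_diff)
    also note Q1
    finally show "norm (CLINT \<omega>|M. complex_of_real (Q \<omega> - 1 / 2) * e \<omega>) \<le> sqrt ((2 + K) * D)" .
  qed (use u in auto)
  finally have 2: "norm (2 * \<i> * u * (CLINT \<omega>|M. Q \<omega> * e \<omega>) - \<i> * u * (CLINT \<omega>|M. e \<omega>)) \<le> 2 * \<bar>t\<bar> * sqrt ((2
      + K) * D)" .
  show "norm ((CLINT \<omega>|M. ?T \<omega> * iexp (u * ?T \<omega>)) - \<i> * u * (CLINT \<omega>|M. iexp (u * ?T \<omega>)))
     \<le> 6 * K ^ 2 * t ^ 2 * sqrt (sqrt D) + 2 * \<bar>t\<bar> * sqrt ((2 + K) * D)"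
    using norm_triangle_le[OF add_mono[OF 1 2]] by (simp add: e_def)
qed

end

section \<open>Second moments and double centering\<close>

context unit_family
begin

text \<open>Products of two distinct variables are orthonormal, so without a diagonal the norm is
  exact. Both orders of a pair feed the same coefficient, hence the symmetrization and the factor
  1/2. The exact value is needed as the mean of a squared Gram entry.\<close>

lemma quad_second_moment_eq:
  assumes "A \<subseteq> J" and diag: "\<And>i. i \<in> A \<Longrightarrow> b i i = 0"
  shows "expectation (\<lambda>\<omega>. quad b A \<omega> ^ 2) = (\<Sum>i\<in>A. \<Sum>j\<in>A. (b i j + b j i) ^ 2) / 2"
  using finite_subset[OF assms(1) finite_J] assms
proof (induction A rule: finite_induct)
  case empty
  thus ?case by (simp add: quad_def)
next
  case (insert i A)
  have [simp]: "i \<in> J" "A \<subseteq> J" "b i i = 0" using insert.prems by auto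
  define X where "X = quad b A"
  define L where "L = lin (\<lambda>j. b i j + b j i) A"
  have Xm [measurable]: "X \<in> borel_measurable (alg A)" unfolding X_def by measurable
  have Lm [measurable]: "L \<in> borel_measurable (alg A)" unfolding L_def by measurable
  have L4: "L4 L" by (simp add: L_def)
  have X4: "L4 X" unfolding X_def using insert.prems by (intro L4_quad) auto
  have dj: "{i} \<subseteq> J" "A \<subseteq> J" "{i} \<inter> A = {}" using insert.hyps by auto
  have zm: "(\<lambda>\<omega>. \<zeta> i \<omega> ^ m) \<in> borel_measurable (alg {i})" for m
    using alg_zeta[of i "{i}"] by measurable
  have zi: "integrable M (\<lambda>\<omega>. \<zeta> i \<omega> ^ m)" if "m \<le> 4" for m
    using that by (intro L4_integrable_power) auto
  have m1: "(\<lambda>\<omega>. X \<omega> * L \<omega>) \<in> borel_measurable (alg A)" by measurable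
  have m2: "(\<lambda>\<omega>. L \<omega> ^ 2) \<in> borel_measurable (alg A)" by measurable
  note e1 = expectation_mult_alg[OF dj zm m1 zi L4_integrable_prod[OF X4 L4], of 1]
  note e2 = expectation_mult_alg[OF dj zm m2 zi L4_integrable_power[OF L4], of 2]
  have *: "quad b (insert i A) \<omega> ^ 2 = X \<omega> ^ 2 + 2 * (\<zeta> i \<omega> * (X \<omega> * L \<omega>)) + \<zeta> i \<omega> ^ 2 * L \<omega> ^ 2" for \<omega>
    unfolding quad_insert[OF insert.hyps] X_def L_def by (simp add: power2_eq_square algebra_simps)
  have "expectation (\<lambda>\<omega>. quad b (insert i A) \<omega> ^ 2) = expectation (\<lambda>\<omega>. X \<omega> ^ 2) + expectation (\<lambda>\<omega>. L \<omega> ^ 2)"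
    unfolding * using e1 e2 L4_integrable_power[OF X4, of 2] by (simp add: first_moment second_moment)
  also have "expectation (\<lambda>\<omega>. L \<omega> ^ 2) = (\<Sum>j\<in>A. (b i j + b j i) ^ 2)"
    by (simp add: L_def lin_second_moment)
  also have "expectation (\<lambda>\<omega>. X \<omega> ^ 2) = (\<Sum>i\<in>A. \<Sum>j\<in>A. (b i j + b j i) ^ 2) / 2"
    unfolding X_def using insert by auto
  also have "(\<Sum>i\<in>A. \<Sum>j\<in>A. (b i j + b j i) ^ 2) / 2 + (\<Sum>j\<in>A. (b i j + b j i) ^ 2) =
     ((\<Sum>i\<in>A. \<Sum>j\<in>A. (b i j + b j i) ^ 2) + (\<Sum>j\<in>A. (b j i + b i j) ^ 2) + (\<Sum>j\<in>A. (b i j + b j i) ^ 2)) / 2"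
    by (simp add: add.commute)
  also have "\<dots> = (\<Sum>j\<in>insert i A. \<Sum>k\<in>insert i A. (b j k + b k j) ^ 2) / 2"
    using insert.hyps by (simp add: sum.distrib)
  finally show ?case .
qed

end

text \<open>The matrix \<open>f\<close> multiplied from both sides by centering projections. For a
  Gram matrix the result is the Gram matrix of the centered observations.\<close>

definition dcen :: "'b set \<Rightarrow> 'c set \<Rightarrow> ('b \<Rightarrow> 'c \<Rightarrow> real) \<Rightarrow> 'b \<Rightarrow> 'c \<Rightarrow> real" where
  "dcen I I' f a b = f a b - (\<Sum>a\<in>I. f a b) / card I - (\<Sum>b\<in>I'. f a b) / card I'
     + (\<Sum>a\<in>I. \<Sum>b\<in>I'. f a b) / (card I * card I')"

lemma sum_centered_square:
  fixes u :: "'b \<Rightarrow> real"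
  assumes "finite I" "I \<noteq> {}"
  shows "(\<Sum>a\<in>I. (u a - (\<Sum>a\<in>I. u a) / card I) ^ 2) = (\<Sum>a\<in>I. u a ^ 2) - (\<Sum>a\<in>I. u a) ^ 2 / card I"
proof -
  define s where "s = (\<Sum>a\<in>I. u a)"
  define m where "m = real (card I)"
  have m: "m > 0" using assms by (simp add: m_def card_gt_0_iff)
  have "(\<Sum>a\<in>I. (u a - s / m) ^ 2) = (\<Sum>a\<in>I. u a ^ 2 - 2 * (s / m) * u a + (s / m) ^ 2)"
    by (simp add: power2_diff algebra_simps)
  also have "\<dots> = (\<Sum>a\<in>I. u a ^ 2) - 2 * (s / m) * s + m * (s / m) ^ 2"
    unfolding sum.distrib sum_subtractf sum_distrib_left[symmetric] by (simp add: s_def m_def)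
  also have "\<dots> = (\<Sum>a\<in>I. u a ^ 2) - s ^ 2 / m"
    using m by (simp add: field_simps power2_eq_square)
  finally show ?thesis by (simp add: s_def m_def)
qed

text \<open>The identity for one index is used twice: \<open>f'\<close> is centered within each row,
  and double centering then centers \<open>f'\<close> within each column.\<close>

lemma sum_dcen_square:
  assumes I: "finite I" "I \<noteq> {}" "finite I'" "I' \<noteq> {}"
  shows "(\<Sum>a\<in>I. \<Sum>b\<in>I'. dcen I I' f a b ^ 2) = (\<Sum>a\<in>I. \<Sum>b\<in>I'. f a b ^ 2)
    - (\<Sum>b\<in>I'. (\<Sum>a\<in>I. f a b) ^ 2) / card I - (\<Sum>a\<in>I. (\<Sum>b\<in>I'. f a b) ^ 2) / card I'
    + (\<Sum>a\<in>I. \<Sum>b\<in>I'. f a b) ^ 2 / (card I * card I')"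
proof -
  define R where "R a = (\<Sum>b\<in>I'. f a b)" for a
  define C where "C b = (\<Sum>a\<in>I. f a b)" for b
  define f' where "f' a b = f a b - R a / card I'" for a b
  have SC: "(\<Sum>b\<in>I'. C b) = (\<Sum>a\<in>I. R a)" unfolding C_def R_def by (rule sum.swap)
  have C': "(\<Sum>a\<in>I. f' a b) = C b - (\<Sum>b\<in>I'. C b) / card I'" for b
    by (simp add: f'_def sum_subtractf C_def[symmetric] SC sum_divide_distrib)
  have d: "dcen I I' f a b = f' a b - (\<Sum>a\<in>I. f' a b) / card I" for a b
    unfolding dcen_def f'_def sum_subtractf R_def[symmetric] 
    by (simp add: sum_divide_distrib[symmetric] diff_divide_distrib mult.commute)
  have "(\<Sum>a\<in>I. \<Sum>b\<in>I'. dcen I I' f a b ^ 2) = (\<Sum>b\<in>I'. \<Sum>a\<in>I. (f' a b - (\<Sum>a\<in>I. f' a b) / card I) ^ 2)"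
    unfolding d by (rule sum.swap)
  also have "\<dots> = (\<Sum>b\<in>I'. (\<Sum>a\<in>I. f' a b ^ 2) - (\<Sum>a\<in>I. f' a b) ^ 2 / card I)"
    using I by (simp add: sum_centered_square)
  also have "\<dots> = (\<Sum>a\<in>I. \<Sum>b\<in>I'. f' a b ^ 2) - (\<Sum>b\<in>I'. (C b - (\<Sum>b\<in>I'. C b) / card I') ^ 2) / card I"
    unfolding sum_subtractf C' sum_divide_distrib[symmetric] by (simp add: sum.swap[of _ I])
  also have "(\<Sum>b\<in>I'. (C b - (\<Sum>b\<in>I'. C b) / card I') ^ 2) = (\<Sum>b\<in>I'. C b ^ 2) - (\<Sum>b\<in>I'. C b) ^ 2 / card I'"
    by (rule sum_centered_square[OF I(3,4)])
  also have "(\<Sum>a\<in>I. \<Sum>b\<in>I'. f' a b ^ 2) = (\<Sum>a\<in>I. (\<Sum>b\<in>I'. f a b ^ 2) - R a ^ 2 / card I')"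
    unfolding f'_def R_def by (intro sum.cong refl sum_centered_square[OF I(3,4)])
  also have "\<dots> = (\<Sum>a\<in>I. \<Sum>b\<in>I'. f a b ^ 2) - (\<Sum>a\<in>I. R a ^ 2) / card I'"
    by (simp add: sum_subtractf sum_divide_distrib)
  finally show ?thesis
    unfolding SC by (simp add: C_def R_def diff_divide_distrib mult.commute)
qed

lemma sum_square_le:
  fixes u :: "'b \<Rightarrow> real"
  assumes "finite I" "I \<noteq> {}"
  shows "(\<Sum>a\<in>I. u a) ^ 2 / card I \<le> (\<Sum>a\<in>I. u a ^ 2)"
proof -
  have "0 \<le> (\<Sum>a\<in>I. (u a - (\<Sum>a\<in>I. u a) / card I) ^ 2)" by (simp add: sum_nonneg)
  thus ?thesis unfolding sum_centered_square[OF assms] by simp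
qed

text \<open>The term of the grand total lies between 0 and the term of the row sums, so it only
  offsets part of the correction.\<close>

lemma sum_dcen_square_approx:
  assumes I: "finite I" "I \<noteq> {}" "finite I'" "I' \<noteq> {}"
  shows "\<bar>(\<Sum>a\<in>I. \<Sum>b\<in>I'. dcen I I' f a b ^ 2) - (\<Sum>a\<in>I. \<Sum>b\<in>I'. f a b ^ 2)\<bar>
    \<le> (\<Sum>b\<in>I'. (\<Sum>a\<in>I. f a b) ^ 2) / card I + (\<Sum>a\<in>I. (\<Sum>b\<in>I'. f a b) ^ 2) / card I'"
proof -
  have "(\<Sum>a\<in>I. \<Sum>b\<in>I'. f a b) ^ 2 / card I \<le> (\<Sum>a\<in>I. (\<Sum>b\<in>I'. f a b) ^ 2)"
    by (rule sum_square_le[OF I(1,2)])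
  hence "(\<Sum>a\<in>I. \<Sum>b\<in>I'. f a b) ^ 2 / card I / card I' \<le> (\<Sum>a\<in>I. (\<Sum>b\<in>I'. f a b) ^ 2) / card I'"
    by (rule divide_right_mono) simp
  moreover have "0 \<le> (\<Sum>b\<in>I'. (\<Sum>a\<in>I. f a b) ^ 2) / card I" "0 \<le> (\<Sum>a\<in>I. \<Sum>b\<in>I'. f a b) ^ 2 / (card I * card
      I')"
    by (auto intro!: divide_nonneg_nonneg sum_nonneg)
  ultimately show ?thesis unfolding sum_dcen_square[OF I] by simp
qed

text \<open>The Gram matrix of one group has a large diagonal, close to \<open>\<tau> = tr \<Sigma>\<close>. The correction by
  the square of the trace makes it drop out.\<close>

lemma dcen_shift_diagonal:
  assumes I: "finite I" "card I \<ge> 2"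
  defines "\<Phi> \<equiv> \<lambda>f. (\<Sum>a\<in>I. \<Sum>b\<in>I. dcen I I f a b ^ 2) - (\<Sum>a\<in>I. dcen I I f a a) ^ 2 / (real (card I) - 1)"
  shows "\<Phi> (\<lambda>a b. f a b + (if a = b then \<tau> else 0)) = \<Phi> f"
proof -
  define m where "m = real (card I)"
  have m: "m \<ge> 2" using I by (simp add: m_def)
  \<comment> \<open>The centering projection, into which double centering turns the identity
    matrix.\<close>
  define d where "d a b = (if a = b then 1 else 0) - 1 / m" for a b :: 'a
  define h where "h = dcen I I f"
  have ne: "I \<noteq> {}" using I by auto
  have dc: "dcen I I (\<lambda>a b. f a b + (if a = b then \<tau> else 0)) a b = h a b + \<tau> * d a b" if "a \<in> I" "b \<in> I"
      for a b
  proof -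
    have "(\<Sum>a\<in>I. \<Sum>b\<in>I. (if a = b then \<tau> else 0)) = m * \<tau>"
      using I by (simp add: m_def)
    thus ?thesis
      using that I m unfolding h_def dcen_def d_def sum.distrib of_nat_mult m_def[symmetric]
      by (simp add: sum.delta sum.delta' field_simps)
  qed
  have row: "(\<Sum>b\<in>I. h a b) = 0" for a
  proof -
    have "(\<Sum>b\<in>I. h a b) = (\<Sum>b\<in>I. f a b) - (\<Sum>b\<in>I. \<Sum>a\<in>I. f a b) / m - m * ((\<Sum>b\<in>I. f a b) / m)
        + m * ((\<Sum>a\<in>I. \<Sum>b\<in>I. f a b) / (m * m))"
      unfolding h_def dcen_def sum.distrib sum_subtractf sum_divide_distrib[symmetric] by (simp add: m_def)
    also have "(\<Sum>b\<in>I. \<Sum>a\<in>I. f a b) = (\<Sum>a\<in>I. \<Sum>b\<in>I. f a b)" by (rule sum.swap)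
    finally show ?thesis using m by simp
  qed
  \<comment> \<open>The rows of \<open>h\<close> sum to zero, so its inner product with the
    projection \<open>d\<close> is its trace. As \<open>d\<close> has trace and squared norm
    \<open>m - 1\<close>, the terms in \<tau> agree in the sum of squares and in the normalized
    squared trace.\<close>
  have hd: "(\<Sum>a\<in>I. \<Sum>b\<in>I. h a b * d a b) = (\<Sum>a\<in>I. h a a)"
  proof (rule sum.cong[OF refl])
    fix a assume "a \<in> I"
    have "(\<Sum>b\<in>I. h a b * d a b) = (\<Sum>b\<in>I. (if a = b then h a b else 0)) - (\<Sum>b\<in>I. h a b) / m"
      unfolding sum_divide_distrib sum_subtractf[symmetric] by (intro sum.cong) (auto simp: d_def
          algebra_simps)
    thus "(\<Sum>b\<in>I. h a b * d a b) = h a a" using \<open>a \<in> I\<close> I row by simp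
  qed
  have dd: "(\<Sum>a\<in>I. \<Sum>b\<in>I. d a b ^ 2) = m - 1"
  proof -
    have "d a b ^ 2 = (if a = b then 1 - 2 / m else 0) + 1 / m ^ 2" for a b
      by (simp add: d_def power2_diff power_divide)
    hence "(\<Sum>a\<in>I. \<Sum>b\<in>I. d a b ^ 2) = m * (1 - 2 / m + m * (1 / m ^ 2))"
      using I by (simp add: sum.distrib m_def)
    also have "\<dots> = m - 1" using m by (simp add: field_simps power2_eq_square)
    finally show ?thesis .
  qed
  have da: "(\<Sum>a\<in>I. d a a) = m - 1"
  proof -
    have "(\<Sum>a\<in>I. d a a) = m * (1 - 1 / m)" by (simp add: d_def m_def)
    also have "\<dots> = m - 1" using m by (simp add: field_simps)
    finally show ?thesis .
  qed
  define P where "P = (\<Sum>a\<in>I. \<Sum>b\<in>I. h a b ^ 2)"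
  define Q where "Q = (\<Sum>a\<in>I. h a a)"
  have "(\<Sum>a\<in>I. \<Sum>b\<in>I. dcen I I (\<lambda>a b. f a b + (if a = b then \<tau> else 0)) a b ^ 2) =
     (\<Sum>a\<in>I. \<Sum>b\<in>I. h a b ^ 2 + 2 * \<tau> * (h a b * d a b) + \<tau> ^ 2 * d a b ^ 2)"
    using dc by (intro sum.cong refl) (simp add: power2_sum power_mult_distrib algebra_simps)
  also have "\<dots> = P + 2 * \<tau> * Q + \<tau> ^ 2 * (m - 1)"
    by (simp add: sum.distrib P_def Q_def hd dd flip: sum_distrib_left)
  finally have 1: "(\<Sum>a\<in>I. \<Sum>b\<in>I. dcen I I (\<lambda>a b. f a b + (if a = b then \<tau> else 0)) a b ^ 2) = P + 2 * \<tau> * Q +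
      \<tau> ^ 2 * (m - 1)" .
  have 2: "(\<Sum>a\<in>I. dcen I I (\<lambda>a b. f a b + (if a = b then \<tau> else 0)) a a) = Q + \<tau> * (m - 1)"
    using dc by (simp add: sum.distrib Q_def da flip: sum_distrib_left)
  have "(Q + \<tau> * (m - 1)) ^ 2 / (m - 1) = Q ^ 2 / (m - 1) + 2 * \<tau> * Q + \<tau> ^ 2 * (m - 1)"
    using m by (simp add: field_simps power2_eq_square)
  thus ?thesis unfolding \<Phi>_def 1 2 m_def[symmetric] by (simp add: P_def Q_def h_def)
qed

section \<open>Gram matrices and trace estimators\<close>

text \<open>An index in \<open>Obs\<close> stands for one observation with its mean removed, and
  \<open>g a\<close> for its loading matrix. Positivity of \<open>r\<close> lets finiteness of
  \<open>Obs\<close> be recovered from that of the product index set.\<close>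

locale obs_family = unit_family M "Obs \<times> {..<r}" \<zeta> K
  for M :: "'a measure" and Obs :: "'o set" and r :: nat and \<zeta> :: "'o \<times> nat \<Rightarrow> 'a \<Rightarrow> real" and K :: real +
  fixes p :: nat and g :: "'o \<Rightarrow> nat \<Rightarrow> nat \<Rightarrow> real"
  assumes r_pos: "0 < r"
begin

definition obs :: "'o \<Rightarrow> nat \<Rightarrow> 'a \<Rightarrow> real" where
  "obs a x \<omega> = (\<Sum>j<r. g a x j * \<zeta> (a, j) \<omega>)"

definition gram :: "'o \<Rightarrow> 'o \<Rightarrow> 'a \<Rightarrow> real" where
  "gram a b \<omega> = (\<Sum>x<p. obs a x \<omega> * obs b x \<omega>)"

definition ker :: "'o \<Rightarrow> 'o \<Rightarrow> nat \<Rightarrow> nat \<Rightarrow> real" where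
  "ker a b j k = (\<Sum>x<p. g a x j * g b x k)"

text \<open>\<open>tr_prod a b = tr (\<Sigma>\<^sub>a \<Sigma>\<^sub>b)\<close> and \<open>tr_one a = tr \<Sigma>\<^sub>a\<close>, written in the entries of \<open>\<Gamma>\<^sub>a\<^sup>T \<Gamma>\<^sub>b\<close>.\<close>

definition tr_prod :: "'o \<Rightarrow> 'o \<Rightarrow> real" where
  "tr_prod a b = (\<Sum>j<r. \<Sum>k<r. ker a b j k ^ 2)"

definition tr_one :: "'o \<Rightarrow> real" where
  "tr_one a = (\<Sum>j<r. ker a a j j)"

text \<open>The Gram entry minus its mean: the product of two distinct observations is already
  centered, a squared length has mean tr \<Sigma>.\<close>

definition gram_c :: "'o \<Rightarrow> 'o \<Rightarrow> 'a \<Rightarrow> real" where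
  "gram_c a b \<omega> = gram a b \<omega> - (if a = b then tr_one a else 0)"

lemma finite_Obs: "finite Obs"
  using finite_J r_pos by (auto dest: finite_cartesian_productD1)

lemma tr_prod_nonneg: "0 \<le> tr_prod a b"
  by (simp add: tr_prod_def sum_nonneg)

lemma gram_eq: "gram a b \<omega> = (\<Sum>j<r. \<Sum>k<r. ker a b j k * \<zeta> (a, j) \<omega> * \<zeta> (b, k) \<omega>)"
proof -
  have "gram a b \<omega> = (\<Sum>x<p. \<Sum>j<r. \<Sum>k<r. g a x j * g b x k * \<zeta> (a, j) \<omega> * \<zeta> (b, k) \<omega>)"
    unfolding gram_def obs_def sum_product by (simp add: mult_ac)
  also have "\<dots> = (\<Sum>j<r. \<Sum>x<p. \<Sum>k<r. g a x j * g b x k * \<zeta> (a, j) \<omega> * \<zeta> (b, k) \<omega>)"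
    by (rule sum.swap)
  also have "\<dots> = (\<Sum>j<r. \<Sum>k<r. \<Sum>x<p. g a x j * g b x k * \<zeta> (a, j) \<omega> * \<zeta> (b, k) \<omega>)"
    by (intro sum.cong refl sum.swap)
  finally show ?thesis by (simp add: ker_def sum_distrib_right)
qed

lemma gram_sum_eq:
  "(\<Sum>a\<in>S. \<Sum>b\<in>S. w a b * gram a b \<omega>) =
    quad (\<lambda>i k. w (fst i) (fst k) * ker (fst i) (fst k) (snd i) (snd k)) (S \<times> {..<r}) \<omega>"
proof -
  have "(\<Sum>a\<in>S. \<Sum>b\<in>S. w a b * gram a b \<omega>) =
     (\<Sum>a\<in>S. \<Sum>b\<in>S. \<Sum>j<r. \<Sum>k<r. w a b * ker a b j k * \<zeta> (a, j) \<omega> * \<zeta> (b, k) \<omega>)"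
    by (simp add: gram_eq sum_distrib_left mult.assoc)
  also have "\<dots> = (\<Sum>a\<in>S. \<Sum>j<r. \<Sum>b\<in>S. \<Sum>k<r. w a b * ker a b j k * \<zeta> (a, j) \<omega> * \<zeta> (b, k) \<omega>)"
    by (intro sum.cong refl sum.swap)
  finally show ?thesis by (simp add: quad_def sum.cartesian_product' split_def)
qed

lemma sum_tr_prod:
  "(\<Sum>i\<in>S \<times> {..<r}. \<Sum>k\<in>S' \<times> {..<r}. (w (fst i) (fst k) * ker (fst i) (fst k) (snd i) (snd k)) ^ 2) =
    (\<Sum>a\<in>S. \<Sum>b\<in>S'. w a b ^ 2 * tr_prod a b)"
proof -
  have "(\<Sum>i\<in>S \<times> {..<r}. \<Sum>k\<in>S' \<times> {..<r}. (w (fst i) (fst k) * ker (fst i) (fst k) (snd i) (snd k)) ^ 2) =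
     (\<Sum>a\<in>S. \<Sum>j<r. \<Sum>b\<in>S'. \<Sum>k<r. (w a b * ker a b j k) ^ 2)"
    by (simp add: sum.cartesian_product' split_def)
  also have "\<dots> = (\<Sum>a\<in>S. \<Sum>b\<in>S'. \<Sum>j<r. \<Sum>k<r. (w a b * ker a b j k) ^ 2)"
    by (intro sum.cong refl sum.swap)
  finally show ?thesis by (simp add: tr_prod_def sum_distrib_left power_mult_distrib)
qed

lemma gram_alg: "a \<in> A \<Longrightarrow> b \<in> A \<Longrightarrow> gram a b \<in> borel_measurable (alg (A \<times> {..<r}))"
  unfolding gram_eq[abs_def]
  by (intro borel_measurable_sum borel_measurable_times borel_measurable_const alg_zeta) auto

lemma gram_measurable: "a \<in> Obs \<Longrightarrow> b \<in> Obs \<Longrightarrow> gram a b \<in> borel_measurable M"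
  by (rule alg_imp_measurable[OF subset_refl gram_alg])

text \<open>A rectangular sum is a square one over the union of the index sets, with weights
  extended by zero. The trace of the resulting matrix is exactly what \<open>gram_c\<close>
  subtracts.\<close>

lemma gram_c_weighted_second_moment:
  assumes S: "I \<subseteq> Obs" "I' \<subseteq> Obs"
  shows "integrable M (\<lambda>\<omega>. (\<Sum>a\<in>I. \<Sum>b\<in>I'. u a b * gram_c a b \<omega>) ^ 2)"
    and "expectation (\<lambda>\<omega>. (\<Sum>a\<in>I. \<Sum>b\<in>I'. u a b * gram_c a b \<omega>) ^ 2) \<le> (2 + K) * (\<Sum>a\<in>I. \<Sum>b\<in>I'. u a b ^ 2 *
        tr_prod a b)"
proof -
  define S where "S = I \<union> I'"
  have SO: "S \<subseteq> Obs" "finite S" and IS: "I \<subseteq> S" "I' \<subseteq> S"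
    using assms finite_Obs by (auto simp: S_def intro: finite_subset)
  define w where "w a b = (if a \<in> I \<and> b \<in> I' then u a b else 0)" for a b
  let ?B = "\<lambda>i k. w (fst i) (fst k) * ker (fst i) (fst k) (snd i) (snd k)"
  have ext: "(\<Sum>a\<in>S. \<Sum>b\<in>S. f a b) = (\<Sum>a\<in>I. \<Sum>b\<in>I'. f a b)"
    if "\<And>a b. \<not> (a \<in> I \<and> b \<in> I') \<Longrightarrow> f a b = 0" for f :: "'o \<Rightarrow> 'o \<Rightarrow> real"
  proof -
    have "(\<Sum>a\<in>S. \<Sum>b\<in>S. f a b) = (\<Sum>a\<in>I. \<Sum>b\<in>S. f a b)"
      using SO IS that by (intro sum.mono_neutral_right) auto
    also have "\<dots> = (\<Sum>a\<in>I. \<Sum>b\<in>I'. f a b)"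
      using SO IS that by (intro sum.cong refl sum.mono_neutral_right) auto
    finally show ?thesis .
  qed
  have "(\<Sum>i\<in>S \<times> {..<r}. ?B i i) = (\<Sum>a\<in>S. w a a * tr_one a)"
    by (simp add: sum.cartesian_product' split_def tr_one_def sum_distrib_left)
  also have "\<dots> = (\<Sum>a\<in>S. \<Sum>b\<in>S. (if a = b then w a b * tr_one a else 0))"
    using SO by simp
  finally have tr1: "(\<Sum>i\<in>S \<times> {..<r}. ?B i i) = (\<Sum>a\<in>S. \<Sum>b\<in>S. (if a = b then w a b * tr_one a else 0))" .
  have "w a b * gram_c a b \<omega> = w a b * gram a b \<omega> - (if a = b then w a b * tr_one a else 0)" for a b \<omega>
    by (simp add: gram_c_def algebra_simps)
  hence tr: "quad ?B (S \<times> {..<r}) \<omega> - (\<Sum>i\<in>S \<times> {..<r}. ?B i i) = (\<Sum>a\<in>S. \<Sum>b\<in>S. w a b * gram_c a b \<omega>)" for \<omega>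
    unfolding gram_sum_eq[symmetric] tr1 by (simp only: sum_subtractf)
  have eq: "(\<Sum>a\<in>S. \<Sum>b\<in>S. w a b * gram_c a b \<omega>) = (\<Sum>a\<in>I. \<Sum>b\<in>I'. u a b * gram_c a b \<omega>)" for \<omega>
    by (subst ext) (auto simp: w_def)
  have nrm: "(\<Sum>i\<in>S \<times> {..<r}. \<Sum>k\<in>S \<times> {..<r}. ?B i k ^ 2) = (\<Sum>a\<in>I. \<Sum>b\<in>I'. u a b ^ 2 * tr_prod a b)"
    unfolding sum_tr_prod by (subst ext) (auto simp: w_def)
  have "S \<times> {..<r} \<subseteq> Obs \<times> {..<r}" using SO by auto
  from quad_second_moment[OF this, of ?B]
  show "integrable M (\<lambda>\<omega>. (\<Sum>a\<in>I. \<Sum>b\<in>I'. u a b * gram_c a b \<omega>) ^ 2)"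
    and "expectation (\<lambda>\<omega>. (\<Sum>a\<in>I. \<Sum>b\<in>I'. u a b * gram_c a b \<omega>) ^ 2) \<le> (2 + K) * (\<Sum>a\<in>I. \<Sum>b\<in>I'. u a b ^ 2 *
        tr_prod a b)"
    unfolding tr eq nrm by auto
qed

text \<open>The square of \<open>C4\<close> bounds the fourth moment of an off-diagonal Gram entry
  relative to its squared second moment, uniformly in the dimensions.\<close>

definition C4 :: real where "C4 = 6 * K * (3 + K)"

lemma gram_fourth_moment:
  assumes "a \<in> Obs" "b \<in> Obs" "a \<noteq> b"
  shows "L4 (gram a b)" "expectation (\<lambda>\<omega>. gram a b \<omega> ^ 4) \<le> (C4 * tr_prod a b) ^ 2"
    "expectation (\<lambda>\<omega>. gram a b \<omega> ^ 2) = tr_prod a b"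
proof -
  \<comment> \<open>Weight 1 on the ordered pair \<open>(a, b)\<close> alone makes a single Gram
    entry a quadratic form, with zero diagonal because \<open>a\<close> and \<open>b\<close>
    differ.\<close>
  define w where "w a' b' = (if a' = a \<and> b' = b then 1 else 0 :: real)" for a' b'
  let ?S = "{a, b}" and ?B = "\<lambda>i k. w (fst i) (fst k) * ker (fst i) (fst k) (snd i) (snd k)"
  have S: "?S \<times> {..<r} \<subseteq> Obs \<times> {..<r}" using assms by auto
  have q: "gram a b = quad ?B (?S \<times> {..<r})"
    using assms(3) unfolding gram_sum_eq[symmetric, abs_def] by (auto simp: w_def fun_eq_iff)
  have n: "(\<Sum>i\<in>?S \<times> {..<r}. \<Sum>k\<in>?S \<times> {..<r}. ?B i k ^ 2) = tr_prod a b"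
    unfolding sum_tr_prod using assms(3) by (simp add: w_def)
  have d: "?B i i = 0" for i using assms(3) by (auto simp: w_def)
  show "L4 (gram a b)" "expectation (\<lambda>\<omega>. gram a b \<omega> ^ 4) \<le> (C4 * tr_prod a b) ^ 2"
    using quad_fourth_moment[of "?S \<times> {..<r}" ?B, OF S d] unfolding q n C4_def by auto
  have "(?B i k + ?B k i) ^ 2 = ?B i k ^ 2 + ?B k i ^ 2" for i k
    using assms(3) by (auto simp: w_def)
  hence "(\<Sum>i\<in>?S \<times> {..<r}. \<Sum>k\<in>?S \<times> {..<r}. (?B i k + ?B k i) ^ 2) =
     (\<Sum>i\<in>?S \<times> {..<r}. \<Sum>k\<in>?S \<times> {..<r}. ?B i k ^ 2) + (\<Sum>i\<in>?S \<times> {..<r}. \<Sum>k\<in>?S \<times> {..<r}. ?B k i ^ 2)"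
    by (simp only: sum.distrib)
  also have "(\<Sum>i\<in>?S \<times> {..<r}. \<Sum>k\<in>?S \<times> {..<r}. ?B k i ^ 2) = (\<Sum>i\<in>?S \<times> {..<r}. \<Sum>k\<in>?S \<times> {..<r}. ?B i k ^ 2)"
    by (rule sum.swap)
  finally show "expectation (\<lambda>\<omega>. gram a b \<omega> ^ 2) = tr_prod a b"
    unfolding q using quad_second_moment_eq[of "?S \<times> {..<r}" ?B, OF S d] n by simp
qed

lemma C4_ge_1: "1 \<le> C4"
proof -
  have "1 * 1 \<le> (6 * K) * (3 + K)" using K_ge_1 by (intro mult_mono) auto
  thus ?thesis by (simp add: C4_def mult_ac)
qed

text \<open>Pairs of observations without a common member contribute uncorrelated terms.\<close>

lemma gram_square_sum_deviation:
  assumes S: "I \<subseteq> Obs" "I' \<subseteq> Obs" and c: "\<And>a b. a \<in> I \<Longrightarrow> b \<in> I' \<Longrightarrow> tr_prod a b = c"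
  defines "P \<equiv> {(a, b). a \<in> I \<and> b \<in> I' \<and> a \<noteq> b}"
  shows "integrable M (\<lambda>\<omega>. \<bar>(\<Sum>(a, b)\<in>P. gram a b \<omega> ^ 2) - c * card P\<bar>)"
    and "expectation (\<lambda>\<omega>. \<bar>(\<Sum>(a, b)\<in>P. gram a b \<omega> ^ 2) - c * card P\<bar>)
    \<le> 2 * C4 * \<bar>c\<bar> * sqrt (real (card I) * card I' * (card I + card I'))"
proof -
  have fin: "finite I" "finite I'" using S finite_Obs by (auto intro: finite_subset)
  define m m' where "m = real (card I)" and "m' = real (card I')"
  have PI: "P \<subseteq> I \<times> I'" by (auto simp: P_def)
  have fP: "finite P" using PI fin by (meson finite_SigmaI finite_subset)
  define h where "h q \<omega> = gram (fst q) (snd q) \<omega> ^ 2 - c" for q \<omega>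
  have inP: "fst q \<in> Obs" "snd q \<in> Obs" "fst q \<noteq> snd q" "tr_prod (fst q) (snd q) = c" if "q \<in> P" for q
    using that S c by (auto simp: P_def)
  have halg: "h q \<in> borel_measurable (alg ({fst q, snd q} \<times> {..<r}))" for q
    unfolding h_def using gram_alg[of "fst q" "{fst q, snd q}" "snd q"] by auto
  have hM: "h q \<in> borel_measurable M" if "q \<in> P" for q
    by (rule alg_imp_measurable[OF _ halg]) (use inP[OF that] in auto)
  have hint: "integrable M (h q)" if "q \<in> P" for q
    unfolding h_def using L4_integrable_power[OF gram_fourth_moment(1)[OF inP(1-3)[OF that]], of 2] by simp
  have hE: "expectation (h q) = 0" if "q \<in> P" for q
    unfolding h_def using L4_integrable_power[OF gram_fourth_moment(1)[OF inP(1-3)[OF that]], of 2]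
      gram_fourth_moment(3)[OF inP(1-3)[OF that]] inP(4)[OF that] by (simp add: prob_space)
  have h2: "integrable M (\<lambda>\<omega>. h q \<omega> ^ 2) \<and> expectation (\<lambda>\<omega>. h q \<omega> ^ 2) \<le> (C4 * c) ^ 2" if "q \<in> P" for q
  proof -
    note G = gram_fourth_moment[OF inP(1-3)[OF that], unfolded inP(4)[OF that]]
    note I = L4_integrable_power[OF G(1), of 2] L4_integrable_power[OF G(1), of 4]
    have *: "h q \<omega> ^ 2 = gram (fst q) (snd q) \<omega> ^ 4 - 2 * c * gram (fst q) (snd q) \<omega> ^ 2 + c ^ 2" for \<omega>
      unfolding h_def by (simp add: power2_eq_square power4_eq_xxxx algebra_simps)
    have "expectation (\<lambda>\<omega>. h q \<omega> ^ 2) = expectation (\<lambda>\<omega>. gram (fst q) (snd q) \<omega> ^ 4) - c ^ 2"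
      unfolding * using I G(3) by (simp add: prob_space power2_eq_square)
    moreover have "integrable M (\<lambda>\<omega>. h q \<omega> ^ 2)" unfolding * using I by simp
    ultimately show ?thesis using G(2) by (auto intro: order_trans[rotated])
  qed
  have hh: "integrable M (\<lambda>\<omega>. h q \<omega> * h q' \<omega>)" if "q \<in> P" "q' \<in> P" for q q'
    using that hM h2 by (intro integrable_mult_square) auto
  have cov: "expectation (\<lambda>\<omega>. h q \<omega> * h q' \<omega>) \<le> (if {fst q, snd q} \<inter> {fst q', snd q'} = {} then 0 else (C4 *
      c) ^ 2)"
    if "q \<in> P" "q' \<in> P" for q q'
  proof (cases "{fst q, snd q} \<inter> {fst q', snd q'} = {}")
    case True
    have "expectation (\<lambda>\<omega>. h q \<omega> * h q' \<omega>) = expectation (h q) * expectation (h q')"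
      by (rule expectation_mult_alg(1)[OF _ _ _ halg halg hint hint])
         (use True inP[OF that(1)] inP[OF that(2)] that in auto)
    thus ?thesis using hE that True by simp
  next
    case False
    have "expectation (\<lambda>\<omega>. h q \<omega> * h q' \<omega>) \<le> \<bar>C4 * c\<bar> * \<bar>C4 * c\<bar>"
      using that hM h2 by (intro expectation_Cauchy_Schwarz) auto
    also have "\<bar>C4 * c\<bar> * \<bar>C4 * c\<bar> = (C4 * c) ^ 2"
      by (simp only: abs_mult_self_eq power2_eq_square)
    finally show ?thesis using False by (simp only: if_False)
  qed
  define V where "V \<omega> = (\<Sum>q\<in>P. h q \<omega>)" for \<omega>
  have V: "(\<Sum>(a, b)\<in>P. gram a b \<omega> ^ 2) - c * card P = V \<omega>" for \<omega>
    by (simp add: V_def h_def split_def sum_subtractf mult.commute)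
  have VM: "V \<in> borel_measurable M" unfolding V_def using hM by (intro borel_measurable_sum)
  have V2: "V \<omega> ^ 2 = (\<Sum>q\<in>P. \<Sum>q'\<in>P. h q \<omega> * h q' \<omega>)" for \<omega>
    by (simp add: V_def power2_eq_square sum_product)
  have Vi: "integrable M (\<lambda>\<omega>. V \<omega> ^ 2)" unfolding V2 using hh by auto
  have "expectation (\<lambda>\<omega>. V \<omega> ^ 2) = (\<Sum>q\<in>P. \<Sum>q'\<in>P. expectation (\<lambda>\<omega>. h q \<omega> * h q' \<omega>))"
    unfolding V2 using hh by (simp add: Bochner_Integration.integral_sum)
  also have "\<dots> \<le> (\<Sum>q\<in>P. (C4 * c) ^ 2 * (2 * (m + m')))"
  proof (rule sum_mono)
    fix q assume q: "q \<in> P"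
    \<comment> \<open>The pairs sharing a member with \<open>q\<close>: one coordinate is a member
      of \<open>q\<close>, the other is free. There are at most 2 (m + m') of them instead of m m',
      and this is the gain in the variance.\<close>
    let ?N = "{q'\<in>P. {fst q, snd q} \<inter> {fst q', snd q'} \<noteq> {}}"
    have "?N \<subseteq> {fst q, snd q} \<times> I' \<union> I \<times> {fst q, snd q}"
      using PI by auto
    hence "card ?N \<le> card ({fst q, snd q} \<times> I' \<union> I \<times> {fst q, snd q})"
      using fin by (intro card_mono) auto
    also have "\<dots> \<le> card ({fst q, snd q} \<times> I') + card (I \<times> {fst q, snd q})"
      by (rule card_Un_le)
    also have "\<dots> = 2 * (card I + card I')"
      using inP(3)[OF q] by (simp add: card_cartesian_product)
    finally have "card ?N \<le> 2 * (card I + card I')" .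
    from of_nat_mono[OF this, where 'a = real] have N: "real (card ?N) \<le> 2 * (m + m')"
      by (simp add: m_def m'_def)
    have "(\<Sum>q'\<in>P. expectation (\<lambda>\<omega>. h q \<omega> * h q' \<omega>)) \<le>
       (\<Sum>q'\<in>P. if {fst q, snd q} \<inter> {fst q', snd q'} = {} then 0 else (C4 * c) ^ 2)"
      using cov q by (intro sum_mono)
    also have "\<dots> = (\<Sum>q'\<in>?N. (C4 * c) ^ 2)"
      using fP by (intro sum.mono_neutral_cong_right) auto
    also have "\<dots> = (C4 * c) ^ 2 * card ?N" by simp
    also have "\<dots> \<le> (C4 * c) ^ 2 * (2 * (m + m'))" using N by (intro mult_left_mono) auto
    finally show "(\<Sum>q'\<in>P. expectation (\<lambda>\<omega>. h q \<omega> * h q' \<omega>)) \<le> (C4 * c) ^ 2 * (2 * (m + m'))" .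
  qed
  also have "\<dots> = card P * ((C4 * c) ^ 2 * (2 * (m + m')))" by simp
  also have "\<dots> \<le> (m * m') * ((C4 * c) ^ 2 * (2 * (m + m')))"
  proof (rule mult_right_mono)
    have "card P \<le> card I * card I'" using card_mono[OF _ PI] fin by (simp add: card_cartesian_product)
    thus "real (card P) \<le> m * m'" unfolding m_def m'_def by (metis of_nat_le_iff of_nat_mult)
  qed (simp add: m_def m'_def)
  \<comment> \<open>The factor 2 is enlarged to 4 so that the square root leaves no irrational
    constant.\<close>
  also have "\<dots> \<le> (2 * C4 * c) ^ 2 * (m * m' * (m + m'))"
  proof -
    have "0 \<le> (C4 * c) ^ 2 * (m * m' * (m + m'))" by (simp add: m_def m'_def)
    moreover have "(m * m') * ((C4 * c) ^ 2 * (2 * (m + m'))) = 2 * ((C4 * c) ^ 2 * (m * m' * (m + m')))"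
      by (simp only: mult_ac)
    moreover have "(2 * C4 * c) ^ 2 * (m * m' * (m + m')) = 4 * ((C4 * c) ^ 2 * (m * m' * (m + m')))"
      by (simp add: power_mult_distrib)
    ultimately show ?thesis by linarith
  qed
  finally have "expectation (\<lambda>\<omega>. \<bar>V \<omega>\<bar>) \<le> sqrt ((2 * C4 * c) ^ 2 * (m * m' * (m + m')))"
    by (rule expectation_abs_le_sqrt[OF VM Vi])
  also have "\<dots> = 2 * C4 * \<bar>c\<bar> * sqrt (m * m' * (m + m'))"
    using C4_ge_1 by (simp add: real_sqrt_mult abs_mult)
  finally show "expectation (\<lambda>\<omega>. \<bar>(\<Sum>(a, b)\<in>P. gram a b \<omega> ^ 2) - c * card P\<bar>)
    \<le> 2 * C4 * \<bar>c\<bar> * sqrt (real (card I) * card I' * (card I + card I'))"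
    unfolding V m_def m'_def by simp
  show "integrable M (\<lambda>\<omega>. \<bar>(\<Sum>(a, b)\<in>P. gram a b \<omega> ^ 2) - c * card P\<bar>)"
    unfolding V by (intro integrable_abs square_integrable_imp_integrable[OF VM Vi])
qed

end

context obs_family
begin

text \<open>A single constant that absorbs the second moment factors of the centering corrections
  and the factor 2 C4 of the fluctuations.\<close>

definition C5 :: real where "C5 = 7 * (2 + K) + 2 * C4"

lemma C5_pos: "0 < C5"
  using C4_ge_1 K_ge_1 by (simp add: C5_def)

text \<open>These margins are what double centering removes. Row and column corrections are of order
  (m + m') c, while the sum of the squared entries is of order m m' c.\<close>

lemma gram_c_block_moments:
  assumes S: "I \<subseteq> Obs" "I' \<subseteq> Obs" and c: "\<And>a b. a \<in> I \<Longrightarrow> b \<in> I' \<Longrightarrow> tr_prod a b = c"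
    and ne: "I \<noteq> {}" "I' \<noteq> {}"
  defines "m \<equiv> real (card I)" and "m' \<equiv> real (card I')"
  shows "integrable M (\<lambda>\<omega>. (\<Sum>b\<in>I'. (\<Sum>a\<in>I. gram_c a b \<omega>) ^ 2) / m)"
    and "expectation (\<lambda>\<omega>. (\<Sum>b\<in>I'. (\<Sum>a\<in>I. gram_c a b \<omega>) ^ 2) / m) \<le> (2 + K) * (m' * c)"
    and "integrable M (\<lambda>\<omega>. (\<Sum>a\<in>I. (\<Sum>b\<in>I'. gram_c a b \<omega>) ^ 2) / m')"
    and "expectation (\<lambda>\<omega>. (\<Sum>a\<in>I. (\<Sum>b\<in>I'. gram_c a b \<omega>) ^ 2) / m') \<le> (2 + K) * (m * c)"
    and "integrable M (\<lambda>\<omega>. (\<Sum>a\<in>I. \<Sum>b\<in>I'. gram_c a b \<omega>) ^ 2)"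
    and "expectation (\<lambda>\<omega>. (\<Sum>a\<in>I. \<Sum>b\<in>I'. gram_c a b \<omega>) ^ 2) \<le> (2 + K) * (m * m' * c)"
proof -
  have fin: "finite I" "finite I'" using S finite_Obs by (auto intro: finite_subset)
  have m: "m > 0" "m' > 0" using fin ne by (auto simp: m_def m'_def card_gt_0_iff)
  have col: "integrable M (\<lambda>\<omega>. (\<Sum>a\<in>I. gram_c a b \<omega>) ^ 2) \<and> expectation (\<lambda>\<omega>. (\<Sum>a\<in>I. gram_c a b \<omega>) ^ 2) \<le> (2 +
      K) * (m * c)"
    if "b \<in> I'" for b
    using gram_c_weighted_second_moment[of I "{b}" "\<lambda>_ _. 1"] S that c by (auto simp: m_def)
  have row: "integrable M (\<lambda>\<omega>. (\<Sum>b\<in>I'. gram_c a b \<omega>) ^ 2) \<and> expectation (\<lambda>\<omega>. (\<Sum>b\<in>I'. gram_c a b \<omega>) ^ 2) \<le> (2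
      + K) * (m' * c)"
    if "a \<in> I" for a
    using gram_c_weighted_second_moment[of "{a}" I' "\<lambda>_ _. 1"] S that c by (auto simp: m'_def)
  show "integrable M (\<lambda>\<omega>. (\<Sum>b\<in>I'. (\<Sum>a\<in>I. gram_c a b \<omega>) ^ 2) / m)"
    using col by (intro integrable_divide Bochner_Integration.integrable_sum) auto
  show "integrable M (\<lambda>\<omega>. (\<Sum>a\<in>I. (\<Sum>b\<in>I'. gram_c a b \<omega>) ^ 2) / m')"
    using row by (intro integrable_divide Bochner_Integration.integrable_sum) auto
  have "expectation (\<lambda>\<omega>. (\<Sum>b\<in>I'. (\<Sum>a\<in>I. gram_c a b \<omega>) ^ 2) / m) = (\<Sum>b\<in>I'. expectation (\<lambda>\<omega>. (\<Sum>a\<in>I. gram_c a b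
      \<omega>) ^ 2)) / m"
    using col by (simp add: Bochner_Integration.integral_sum)
  also have "\<dots> \<le> (\<Sum>b\<in>I'. (2 + K) * (m * c)) / m"
    using col m by (intro divide_right_mono sum_mono) auto
  also have "\<dots> = (2 + K) * (m' * c)" using m by (simp add: m'_def)
  finally show "expectation (\<lambda>\<omega>. (\<Sum>b\<in>I'. (\<Sum>a\<in>I. gram_c a b \<omega>) ^ 2) / m) \<le> (2 + K) * (m' * c)" .
  have "expectation (\<lambda>\<omega>. (\<Sum>a\<in>I. (\<Sum>b\<in>I'. gram_c a b \<omega>) ^ 2) / m') = (\<Sum>a\<in>I. expectation (\<lambda>\<omega>. (\<Sum>b\<in>I'. gram_c a
      b \<omega>) ^ 2)) / m'"
    using row by (simp add: Bochner_Integration.integral_sum)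
  also have "\<dots> \<le> (\<Sum>a\<in>I. (2 + K) * (m' * c)) / m'"
    using row m by (intro divide_right_mono sum_mono) auto
  also have "\<dots> = (2 + K) * (m * c)" using m by (simp add: m_def)
  finally show "expectation (\<lambda>\<omega>. (\<Sum>a\<in>I. (\<Sum>b\<in>I'. gram_c a b \<omega>) ^ 2) / m') \<le> (2 + K) * (m * c)" .
  have "(\<Sum>a\<in>I. \<Sum>b\<in>I'. 1 ^ 2 * tr_prod a b) = m * m' * c"
    using c by (simp add: m_def m'_def)
  thus "integrable M (\<lambda>\<omega>. (\<Sum>a\<in>I. \<Sum>b\<in>I'. gram_c a b \<omega>) ^ 2)"
    and "expectation (\<lambda>\<omega>. (\<Sum>a\<in>I. \<Sum>b\<in>I'. gram_c a b \<omega>) ^ 2) \<le> (2 + K) * (m * m' * c)"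
    using gram_c_weighted_second_moment[OF S, of "\<lambda>_ _. 1"] by simp_all
qed

text \<open>Error in units of \<open>c\<close>: m + m' is the price of centering, the square root
  that of the fluctuation of squared Gram entries. Both are small against m m' when the two sizes
  grow.\<close>

definition rate :: "real \<Rightarrow> real \<Rightarrow> real" where
  "rate m m' = C5 * (m + m' + sqrt (m * m' * (m + m')))"

lemma integrable_expectation_bound:
  fixes X B :: "'a \<Rightarrow> real"
  assumes "X \<in> borel_measurable M" "integrable M B" "\<And>\<omega>. \<bar>X \<omega> - d\<bar> \<le> B \<omega>" "expectation B \<le> c"
  shows "integrable M X \<and> expectation (\<lambda>\<omega>. \<bar>X \<omega> - d\<bar>) \<le> c"
proof -
  have "integrable M (\<lambda>\<omega>. X \<omega> - d)"
    using assms by (intro Bochner_Integration.integrable_bound[OF assms(2)]) (auto intro: order_trans[OF _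
        abs_ge_self])
  hence "integrable M (\<lambda>\<omega>. (X \<omega> - d) + d)" by (intro Bochner_Integration.integrable_add) auto
  hence X: "integrable M X" by simp
  hence "expectation (\<lambda>\<omega>. \<bar>X \<omega> - d\<bar>) \<le> expectation B"
    using assms by (intro integral_mono) auto
  with X assms show ?thesis by linarith
qed

text \<open>Disjoint blocks contain no diagonal entry, so all Gram entries are centered. This serves
  both two different groups and the two parts of one group.\<close>

lemma cross_trace_deviation:
  assumes S: "I \<subseteq> Obs" "I' \<subseteq> Obs" "I \<inter> I' = {}"
    and c: "\<And>a b. a \<in> I \<Longrightarrow> b \<in> I' \<Longrightarrow> tr_prod a b = c" and ne: "I \<noteq> {}" "I' \<noteq> {}"
  defines "m \<equiv> real (card I)" and "m' \<equiv> real (card I')"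
    and "X \<equiv> \<lambda>\<omega>. \<Sum>a\<in>I. \<Sum>b\<in>I'. dcen I I' (\<lambda>a b. gram a b \<omega>) a b ^ 2"
  shows "integrable M X \<and> expectation (\<lambda>\<omega>. \<bar>X \<omega> - c * (m * m')\<bar>) \<le> c * rate m m'"
proof -
  have fin: "finite I" "finite I'" using S finite_Obs by (auto intro: finite_subset)
  have c0: "0 \<le> c" using c ne tr_prod_nonneg by (metis ex_in_conv)
  have gc: "gram_c a b = gram a b" if "a \<in> I" "b \<in> I'" for a b
    using that S by (auto simp: gram_c_def fun_eq_iff)
  note bm = gram_c_block_moments[OF S(1,2) c ne, folded m_def m'_def]
  define P where "P = {(a, b). a \<in> I \<and> b \<in> I' \<and> a \<noteq> b}"
  have P: "P = I \<times> I'" using S by (auto simp: P_def)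
  have gd: "integrable M (\<lambda>\<omega>. \<bar>(\<Sum>(a, b)\<in>P. gram a b \<omega> ^ 2) - c * card P\<bar>)"
    "expectation (\<lambda>\<omega>. \<bar>(\<Sum>(a, b)\<in>P. gram a b \<omega> ^ 2) - c * card P\<bar>)
      \<le> 2 * C4 * \<bar>c\<bar> * sqrt (m * m' * (m + m'))"
    using gram_square_sum_deviation[OF S(1,2) c] by (simp_all add: P_def m_def m'_def)
  have sq: "(\<Sum>(a, b)\<in>P. gram a b \<omega> ^ 2) = (\<Sum>a\<in>I. \<Sum>b\<in>I'. gram a b \<omega> ^ 2)" for \<omega>
    unfolding P by (simp add: sum.cartesian_product)
  have cP: "real (card P) = m * m'" unfolding P by (simp add: card_cartesian_product m_def m'_def)
  define B where "B \<omega> = (\<Sum>b\<in>I'. (\<Sum>a\<in>I. gram_c a b \<omega>) ^ 2) / m + (\<Sum>a\<in>I. (\<Sum>b\<in>I'. gram_c a b \<omega>) ^ 2) / m'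
     + \<bar>(\<Sum>(a, b)\<in>P. gram a b \<omega> ^ 2) - c * card P\<bar>" for \<omega>
  have XM: "X \<in> borel_measurable M"
    unfolding X_def dcen_def using S
    by (intro borel_measurable_sum borel_measurable_power borel_measurable_add borel_measurable_diff
        borel_measurable_divide borel_measurable_const gram_measurable) auto
  show ?thesis
  proof (rule integrable_expectation_bound[OF XM])
    show "integrable M B" unfolding B_def using bm(1,3) gd(1) by auto
    show "\<bar>X \<omega> - c * (m * m')\<bar> \<le> B \<omega>" for \<omega>
    proof -
      have "(\<Sum>b\<in>I'. (\<Sum>a\<in>I. gram a b \<omega>) ^ 2) = (\<Sum>b\<in>I'. (\<Sum>a\<in>I. gram_c a b \<omega>) ^ 2)"
        "(\<Sum>a\<in>I. (\<Sum>b\<in>I'. gram a b \<omega>) ^ 2) = (\<Sum>a\<in>I. (\<Sum>b\<in>I'. gram_c a b \<omega>) ^ 2)"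
        using gc by (auto intro!: sum.cong arg_cong[where f = "\<lambda>x. x ^ 2"])
      note e = this
      show ?thesis
        using sum_dcen_square_approx[OF fin(1) ne(1) fin(2) ne(2), of "\<lambda>a b. gram a b \<omega>"]
        unfolding B_def X_def sq cP m_def[symmetric] m'_def[symmetric] e by linarith
    qed
    have "expectation B = expectation (\<lambda>\<omega>. (\<Sum>b\<in>I'. (\<Sum>a\<in>I. gram_c a b \<omega>) ^ 2) / m)
        + expectation (\<lambda>\<omega>. (\<Sum>a\<in>I. (\<Sum>b\<in>I'. gram_c a b \<omega>) ^ 2) / m')
        + expectation (\<lambda>\<omega>. \<bar>(\<Sum>(a, b)\<in>P. gram a b \<omega> ^ 2) - c * card P\<bar>)"
      unfolding B_def using bm(1,3) gd(1) by simp
    also have "\<dots> \<le> (2 + K) * (m' * c) + (2 + K) * (m * c) + 2 * C4 * \<bar>c\<bar> * sqrt (m * m' * (m + m'))"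
      by (intro add_mono bm(2,4) gd(2))
    also have "\<dots> = c * ((2 + K) * (m + m') + 2 * C4 * sqrt (m * m' * (m + m')))"
      using c0 by (simp add: algebra_simps)
    also have "\<dots> \<le> c * (C5 * (m + m') + C5 * sqrt (m * m' * (m + m')))"
      using K_ge_1 C4_ge_1 c0
      by (intro mult_left_mono add_mono mult_right_mono) (auto simp: C5_def m_def m'_def)
    also have "\<dots> = c * rate m m'" by (simp add: rate_def distrib_left)
    finally show "expectation B \<le> c * rate m m'" .
  qed
qed

text \<open>\<open>X\<close> does not see a multiple of the identity, so the Gram entries may be
  replaced by their centered versions, however large tr \<Sigma> is. The remaining diagonal is
  controlled by second moments, and m (m - 1) counts the off-diagonal pairs.\<close>

lemma self_trace_deviation:
  assumes S: "I \<subseteq> Obs"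
    and c: "\<And>a b. a \<in> I \<Longrightarrow> b \<in> I \<Longrightarrow> tr_prod a b = c" and \<tau>: "\<And>a. a \<in> I \<Longrightarrow> tr_one a = \<tau>"
    and I2: "card I \<ge> 2"
  defines "m \<equiv> real (card I)"
    and "X \<equiv> \<lambda>\<omega>. (\<Sum>a\<in>I. \<Sum>b\<in>I. dcen I I (\<lambda>a b. gram a b \<omega>) a b ^ 2)
        - (\<Sum>a\<in>I. dcen I I (\<lambda>a b. gram a b \<omega>) a a) ^ 2 / (real (card I) - 1)"
  shows "integrable M X \<and> expectation (\<lambda>\<omega>. \<bar>X \<omega> - c * (m * (m - 1))\<bar>) \<le> c * (2 * rate m m)"
proof -
  have fin: "finite I" using S finite_Obs by (auto intro: finite_subset)
  have ne: "I \<noteq> {}" using I2 by auto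
  have m: "m \<ge> 2" using I2 by (simp add: m_def)
  have c0: "0 \<le> c" using c ne tr_prod_nonneg by (metis ex_in_conv)
  note bm = gram_c_block_moments[OF S S c ne ne, folded m_def]
  define P where "P = {(a, b). a \<in> I \<and> b \<in> I \<and> a \<noteq> b}"
  have gd: "integrable M (\<lambda>\<omega>. \<bar>(\<Sum>(a, b)\<in>P. gram a b \<omega> ^ 2) - c * card P\<bar>)"
    "expectation (\<lambda>\<omega>. \<bar>(\<Sum>(a, b)\<in>P. gram a b \<omega> ^ 2) - c * card P\<bar>)
      \<le> 2 * C4 * \<bar>c\<bar> * sqrt (m * m * (m + m))"
    using gram_square_sum_deviation[OF S S c] by (simp_all add: P_def m_def)
  have P: "P = I \<times> I - (\<lambda>a. (a, a)) ` I" by (auto simp: P_def)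
  have cP: "real (card P) = m * (m - 1)"
  proof -
    have "card P = card (I \<times> I) - card ((\<lambda>a. (a, a)) ` I)"
      unfolding P using fin by (intro card_Diff_subset) auto
    also have "\<dots> = card I * card I - card I"
      by (subst card_image) (auto simp: card_cartesian_product inj_on_def)
    finally show ?thesis using I2 by (simp add: m_def of_nat_diff algebra_simps)
  qed
  have sq: "(\<Sum>a\<in>I. \<Sum>b\<in>I. gram_c a b \<omega> ^ 2) = (\<Sum>(a, b)\<in>P. gram a b \<omega> ^ 2) + (\<Sum>a\<in>I. gram_c a a \<omega> ^ 2)" for \<omega>
  proof -
    have "(\<Sum>a\<in>I. \<Sum>b\<in>I. gram_c a b \<omega> ^ 2) = (\<Sum>(a, b)\<in>I \<times> I. gram_c a b \<omega> ^ 2)"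
      by (simp add: sum.cartesian_product)
    also have "\<dots> = (\<Sum>(a, b)\<in>P. gram_c a b \<omega> ^ 2) + (\<Sum>(a, b)\<in>(\<lambda>a. (a, a)) ` I. gram_c a b \<omega> ^ 2)"
      unfolding P using fin by (intro sum.subset_diff) auto
    also have "(\<Sum>(a, b)\<in>(\<lambda>a. (a, a)) ` I. gram_c a b \<omega> ^ 2) = (\<Sum>a\<in>I. gram_c a a \<omega> ^ 2)"
      by (subst sum.reindex) (auto simp: inj_on_def)
    also have "(\<Sum>(a, b)\<in>P. gram_c a b \<omega> ^ 2) = (\<Sum>(a, b)\<in>P. gram a b \<omega> ^ 2)"
      by (intro sum.cong) (auto simp: P_def gram_c_def)
    finally show ?thesis .
  qed
  define f where "f \<omega> = (\<lambda>a b. gram_c a b \<omega>)" for \<omega>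
  define t where "t \<omega> = (\<Sum>a\<in>I. gram_c a a \<omega>)" for \<omega>
  define s where "s \<omega> = (\<Sum>a\<in>I. \<Sum>b\<in>I. gram_c a b \<omega>)" for \<omega>
  have Xf: "X \<omega> = (\<Sum>a\<in>I. \<Sum>b\<in>I. dcen I I (f \<omega>) a b ^ 2) - (\<Sum>a\<in>I. dcen I I (f \<omega>) a a) ^ 2 / (m - 1)" for \<omega>
  proof -
    have dc: "dcen I I (\<lambda>a b. gram a b \<omega>) a b = dcen I I (\<lambda>a b. f \<omega> a b + (if a = b then \<tau> else 0)) a b"
      if "a \<in> I" "b \<in> I" for a b
      using that \<tau> unfolding dcen_def f_def gram_c_def
      by (intro arg_cong2[where f = "(+)"] arg_cong2[where f = "(-)"] arg_cong2[where f = "(/)"] sum.cong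
          refl) auto
    have "X \<omega> = (\<Sum>a\<in>I. \<Sum>b\<in>I. dcen I I (\<lambda>a b. f \<omega> a b + (if a = b then \<tau> else 0)) a b ^ 2)
        - (\<Sum>a\<in>I. dcen I I (\<lambda>a b. f \<omega> a b + (if a = b then \<tau> else 0)) a a) ^ 2 / (m - 1)"
      unfolding X_def m_def using dc by simp
    thus ?thesis unfolding dcen_shift_diagonal[OF fin I2, of "f \<omega>" \<tau>, folded m_def] .
  qed
  have diag: "(\<Sum>a\<in>I. dcen I I (f \<omega>) a a) = t \<omega> - s \<omega> / m" for \<omega>
  proof -
    have "(\<Sum>a\<in>I. dcen I I (f \<omega>) a a) = t \<omega> - (\<Sum>b\<in>I. \<Sum>a\<in>I. gram_c a b \<omega>) / m - s \<omega> / m + m * (s \<omega> / (m * m))"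
      unfolding dcen_def f_def sum.distrib sum_subtractf sum_divide_distrib[symmetric]
      by (simp add: t_def s_def m_def)
    also have "(\<Sum>b\<in>I. \<Sum>a\<in>I. gram_c a b \<omega>) = s \<omega>" unfolding s_def by (rule sum.swap)
    finally show ?thesis using m by simp
  qed
  have t2: "integrable M (\<lambda>\<omega>. t \<omega> ^ 2) \<and> expectation (\<lambda>\<omega>. t \<omega> ^ 2) \<le> (2 + K) * (m * c)"
  proof -
    let ?u = "\<lambda>a b. if a = b then 1 else 0 :: real"
    have "(\<Sum>a\<in>I. \<Sum>b\<in>I. ?u a b * gram_c a b \<omega>) = t \<omega>" for \<omega>
    proof -
      have "(\<Sum>a\<in>I. \<Sum>b\<in>I. ?u a b * gram_c a b \<omega>) = (\<Sum>a\<in>I. \<Sum>b\<in>I. if a = b then gram_c a b \<omega> else 0)"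
        by (intro sum.cong) auto
      thus ?thesis using fin by (simp add: t_def)
    qed
    moreover have "(\<Sum>a\<in>I. \<Sum>b\<in>I. ?u a b ^ 2 * tr_prod a b) = m * c"
    proof -
      have "(\<Sum>a\<in>I. \<Sum>b\<in>I. ?u a b ^ 2 * tr_prod a b) = (\<Sum>a\<in>I. \<Sum>b\<in>I. if a = b then c else 0)"
        using c by (intro sum.cong) auto
      thus ?thesis using fin by (simp add: m_def)
    qed
    ultimately show ?thesis using gram_c_weighted_second_moment[OF S S, of ?u] by simp
  qed
  have d2: "integrable M (\<lambda>\<omega>. gram_c a a \<omega> ^ 2) \<and> expectation (\<lambda>\<omega>. gram_c a a \<omega> ^ 2) \<le> (2 + K) * c" if "a \<in>
      I" for a
    using gram_c_weighted_second_moment[of "{a}" "{a}" "\<lambda>_ _. 1"] S that c by auto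
  define B where "B \<omega> = ((\<Sum>b\<in>I. (\<Sum>a\<in>I. gram_c a b \<omega>) ^ 2) / m + (\<Sum>a\<in>I. (\<Sum>b\<in>I. gram_c a b \<omega>) ^ 2) / m)
     + \<bar>(\<Sum>(a, b)\<in>P. gram a b \<omega> ^ 2) - c * card P\<bar> + (\<Sum>a\<in>I. gram_c a a \<omega> ^ 2)
     + (2 * t \<omega> ^ 2 + 2 * s \<omega> ^ 2 / m ^ 2)" for \<omega>
  have s2: "integrable M (\<lambda>\<omega>. s \<omega> ^ 2)" "expectation (\<lambda>\<omega>. s \<omega> ^ 2) \<le> (2 + K) * (m * m * c)"
    using bm(5,6) by (simp_all add: s_def)
  have iB: "integrable M (\<lambda>\<omega>. \<Sum>a\<in>I. gram_c a a \<omega> ^ 2)" using d2 by auto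
  have XM: "X \<in> borel_measurable M"
    unfolding X_def dcen_def using S
    by (intro borel_measurable_sum borel_measurable_power borel_measurable_add borel_measurable_diff
        borel_measurable_divide borel_measurable_const gram_measurable) auto
  show ?thesis
  proof (rule integrable_expectation_bound[OF XM])
    show "integrable M B" unfolding B_def using bm(1,3) gd(1) t2 s2 iB by auto
    show "\<bar>X \<omega> - c * (m * (m - 1))\<bar> \<le> B \<omega>" for \<omega>
    proof -
      have 1: "\<bar>(\<Sum>a\<in>I. \<Sum>b\<in>I. dcen I I (f \<omega>) a b ^ 2) - (\<Sum>a\<in>I. \<Sum>b\<in>I. gram_c a b \<omega> ^ 2)\<bar>
        \<le> (\<Sum>b\<in>I. (\<Sum>a\<in>I. gram_c a b \<omega>) ^ 2) / m + (\<Sum>a\<in>I. (\<Sum>b\<in>I. gram_c a b \<omega>) ^ 2) / m"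
        using sum_dcen_square_approx[OF fin ne fin ne, of "f \<omega>", folded m_def] by (simp add: f_def)
      have "(t \<omega> - s \<omega> / m) ^ 2 / (m - 1) \<le> (t \<omega> - s \<omega> / m) ^ 2"
        using m by (simp add: divide_le_eq mult_le_cancel_left1)
      also have "\<dots> \<le> 2 * t \<omega> ^ 2 + 2 * (s \<omega> / m) ^ 2"
        using zero_le_power2[of "t \<omega> + s \<omega> / m"] unfolding power2_sum power2_diff by linarith
      finally have 2: "(t \<omega> - s \<omega> / m) ^ 2 / (m - 1) \<le> 2 * t \<omega> ^ 2 + 2 * s \<omega> ^ 2 / m ^ 2"
        by (simp add: power_divide)
      have 3: "0 \<le> (t \<omega> - s \<omega> / m) ^ 2 / (m - 1)" "0 \<le> (\<Sum>a\<in>I. gram_c a a \<omega> ^ 2)"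
        using m by (auto intro: sum_nonneg)
      show ?thesis using 1 2 3 unfolding B_def Xf diag sq cP by linarith
    qed
    have "expectation B = expectation (\<lambda>\<omega>. (\<Sum>b\<in>I. (\<Sum>a\<in>I. gram_c a b \<omega>) ^ 2) / m)
        + expectation (\<lambda>\<omega>. (\<Sum>a\<in>I. (\<Sum>b\<in>I. gram_c a b \<omega>) ^ 2) / m)
        + expectation (\<lambda>\<omega>. \<bar>(\<Sum>(a, b)\<in>P. gram a b \<omega> ^ 2) - c * card P\<bar>)
        + (\<Sum>a\<in>I. expectation (\<lambda>\<omega>. gram_c a a \<omega> ^ 2))
        + (2 * expectation (\<lambda>\<omega>. t \<omega> ^ 2) + 2 * expectation (\<lambda>\<omega>. s \<omega> ^ 2) / m ^ 2)"
      unfolding B_def using bm(1,3) gd(1) t2 s2 iB d2 by (simp add: Bochner_Integration.integral_sum)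
    also have "\<dots> \<le> (2 + K) * (m * c) + (2 + K) * (m * c) + 2 * C4 * \<bar>c\<bar> * sqrt (m * m * (m + m))
        + (\<Sum>a\<in>I. (2 + K) * c) + (2 * ((2 + K) * (m * c)) + 2 * ((2 + K) * (m * m * c)) / m ^ 2)"
      using d2 t2 s2 by (intro add_mono bm(2,4) gd(2) sum_mono mult_left_mono divide_right_mono) auto
    also have "\<dots> = c * ((2 + K) * (5 * m + 2) + 2 * C4 * sqrt (m * m * (m + m)))"
    proof -
      have "2 * ((2 + K) * (m * m * c)) / m ^ 2 = 2 * ((2 + K) * c)"
        using m by (simp add: power2_eq_square)
      thus ?thesis using c0 by (simp add: algebra_simps m_def[symmetric])
    qed
    also have "\<dots> \<le> c * (2 * C5 * (m + m) + 2 * C5 * sqrt (m * m * (m + m)))"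
    proof (intro mult_left_mono[OF _ c0] add_mono mult_right_mono)
      have "(2 + K) * (5 * m + 2) \<le> (2 + K) * (28 * m)" using m K_ge_1 by (intro mult_left_mono) auto
      also have "\<dots> = 2 * (7 * (2 + K)) * (m + m)" by (simp add: algebra_simps)
      also have "\<dots> \<le> 2 * C5 * (m + m)" using m C4_ge_1 by (intro mult_right_mono) (auto simp: C5_def)
      finally show "(2 + K) * (5 * m + 2) \<le> 2 * C5 * (m + m)" .
      show "2 * C4 \<le> 2 * C5" using C4_ge_1 K_ge_1 by (simp add: C5_def)
    qed (use m in auto)
    also have "\<dots> = c * (2 * rate m m)" by (simp add: rate_def distrib_left)
    finally show "expectation B \<le> c * (2 * rate m m)" .
  qed
qed

end

section \<open>The statistics as functions of the Gram matrix\<close>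

text \<open>In each coordinate the product of two centered entries expands into the four terms of
  \<open>dcen\<close>.\<close>

lemma dcen_gram:
  fixes u v :: "'b \<Rightarrow> nat \<Rightarrow> real"
  shows "dcen I I' (\<lambda>a b. \<Sum>x<p. u a x * v b x) a b =
    (\<Sum>x<p. (u a x - (\<Sum>a\<in>I. u a x) / card I) * (v b x - (\<Sum>b\<in>I'. v b x) / card I'))"
proof -
  define U where "U x = (\<Sum>a\<in>I. u a x)" for x
  define V where "V x = (\<Sum>b\<in>I'. v b x)" for x
  have 1: "(\<Sum>a\<in>I. \<Sum>x<p. u a x * v b x) = (\<Sum>x<p. U x * v b x)" for b
    unfolding U_def sum_distrib_right by (rule sum.swap)
  have 2: "(\<Sum>b\<in>I'. \<Sum>x<p. u a x * v b x) = (\<Sum>x<p. u a x * V x)" for a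
    unfolding V_def sum_distrib_left by (rule sum.swap)
  have 3: "(\<Sum>a\<in>I. \<Sum>x<p. u a x * V x) = (\<Sum>x<p. U x * V x)"
    unfolding U_def sum_distrib_right by (rule sum.swap)
  show ?thesis
    unfolding dcen_def 1 2 3 U_def[symmetric] V_def[symmetric]
    unfolding sum_divide_distrib sum_subtractf[symmetric] sum.distrib[symmetric]
    by (intro sum.cong refl) (simp add: algebra_simps)
qed

lemma sum_swap_blocks:
  "(\<Sum>x\<in>A. \<Sum>y\<in>B. \<Sum>a\<in>C. \<Sum>b\<in>D. f x y a b) = (\<Sum>a\<in>C. \<Sum>b\<in>D. \<Sum>x\<in>A. \<Sum>y\<in>B. f x y a b)"
proof -
  have "(\<Sum>x\<in>A. \<Sum>y\<in>B. \<Sum>a\<in>C. \<Sum>b\<in>D. f x y a b) = (\<Sum>a\<in>C. \<Sum>x\<in>A. \<Sum>y\<in>B. \<Sum>b\<in>D. f x y a b)"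
    by (subst sum.swap[of _ C]) (intro sum.cong refl sum.swap)
  also have "\<dots> = (\<Sum>a\<in>C. \<Sum>b\<in>D. \<Sum>x\<in>A. \<Sum>y\<in>B. f x y a b)"
    by (intro sum.cong refl, subst sum.swap[of _ D]) (intro sum.cong refl sum.swap)
  finally show ?thesis .
qed

lemma mat_trace_mult:
  assumes "A \<in> carrier_mat n q" "B \<in> carrier_mat q n"
  shows "mat_trace (A * B) = (\<Sum>i<n. \<Sum>j<q. A $$ (i, j) * B $$ (j, i))"
  using assms unfolding mat_trace_def by (auto simp: scalar_prod_def atLeast0LessThan intro!: sum.cong)

lemma sample_cov_shift:
  assumes "finite I" "I \<noteq> {}" and X: "\<And>i x. i \<in> I \<Longrightarrow> x < p \<Longrightarrow> X i $ x = u i x + m x"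
    and xy: "x < p" "y < p"
  shows "sample_cov p I X $$ (x, y) = (\<Sum>i\<in>I. (u i x - (\<Sum>i\<in>I. u i x) / card I) * (u i y - (\<Sum>i\<in>I. u i y) /
      card I)) / (real (card I) - 1)"
proof -
  have mean: "sample_mean p I X $ x = (\<Sum>i\<in>I. u i x) / card I + m x" if "x < p" for x
    using that X assms(1,2) by (simp add: sample_mean_def sum.distrib add_divide_distrib)
  show ?thesis using xy X unfolding sample_cov_def by (simp add: mean)
qed

text \<open>For centered observations v and v' the trace of v v^T v' v'^T is the square of their
  inner product. Sample covariances thus enter only through the doubly centered Gram matrix, from
  which the means have gone.\<close>

lemma mat_trace_sample_cov_mult:
  assumes I: "finite I" "I \<noteq> {}" "finite I'" "I' \<noteq> {}"
    and X: "\<And>i x. i \<in> I \<Longrightarrow> x < p \<Longrightarrow> X i $ x = u i x + m x"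
    and X': "\<And>i x. i \<in> I' \<Longrightarrow> x < p \<Longrightarrow> X' i $ x = u' i x + m' x"
  shows "mat_trace (sample_cov p I X * sample_cov p I' X') =
    (\<Sum>a\<in>I. \<Sum>b\<in>I'. dcen I I' (\<lambda>a b. \<Sum>x<p. u a x * u' b x) a b ^ 2) / ((real (card I) - 1) * (real (card I') -
        1))"
proof -
  define v v' where "v a x = u a x - (\<Sum>a\<in>I. u a x) / card I" and "v' b x = u' b x - (\<Sum>b\<in>I'. u' b x) / card
      I'" for a b x
  have "mat_trace (sample_cov p I X * sample_cov p I' X') =
     (\<Sum>x<p. \<Sum>y<p. (\<Sum>a\<in>I. v a x * v a y) / (real (card I) - 1) * ((\<Sum>b\<in>I'. v' b y * v' b x) / (real (card I')
         - 1)))"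
    unfolding v_def v'_def using I X X'
    by (subst mat_trace_mult[where n = p and q = p])
       (auto simp: sample_cov_shift[where u = u and m = m] sample_cov_shift[where u = u' and m = m'] intro!:
           sum.cong, auto simp: sample_cov_def)
  also have "\<dots> = (\<Sum>x<p. \<Sum>y<p. \<Sum>a\<in>I. \<Sum>b\<in>I'. (v a x * v' b x) * (v a y * v' b y)) / ((real (card I) - 1) *
      (real (card I') - 1))"
  proof -
    have "(\<Sum>a\<in>I. v a x * v a y) / c * ((\<Sum>b\<in>I'. v' b y * v' b x) / d) =
       (\<Sum>a\<in>I. \<Sum>b\<in>I'. (v a x * v' b x) * (v a y * v' b y)) / (c * d)" for x y c d
      unfolding times_divide_times_eq sum_product by (simp add: mult_ac)
    thus ?thesis by (simp only: sum_divide_distrib[symmetric])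
  qed
  also have "(\<Sum>x<p. \<Sum>y<p. \<Sum>a\<in>I. \<Sum>b\<in>I'. (v a x * v' b x) * (v a y * v' b y)) =
     (\<Sum>a\<in>I. \<Sum>b\<in>I'. \<Sum>x<p. \<Sum>y<p. (v a x * v' b x) * (v a y * v' b y))"
    by (rule sum_swap_blocks)
  also have "\<dots> = (\<Sum>a\<in>I. \<Sum>b\<in>I'. dcen I I' (\<lambda>a b. \<Sum>x<p. u a x * u' b x) a b ^ 2)"
    unfolding dcen_gram by (simp add: v_def v'_def power2_eq_square sum_product)
  finally show ?thesis .
qed

lemma mat_trace_sample_cov:
  assumes I: "finite I" "I \<noteq> {}"
    and X: "\<And>i x. i \<in> I \<Longrightarrow> x < p \<Longrightarrow> X i $ x = u i x + m x"
  shows "mat_trace (sample_cov p I X) =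
    (\<Sum>a\<in>I. dcen I I (\<lambda>a b. \<Sum>x<p. u a x * u b x) a a) / (real (card I) - 1)"
proof -
  have "mat_trace (sample_cov p I X) = (\<Sum>x<p. sample_cov p I X $$ (x, x))"
    by (simp add: mat_trace_def sample_cov_def)
  also have "\<dots> = (\<Sum>x<p. \<Sum>a\<in>I. (u a x - (\<Sum>i\<in>I. u i x) / card I) * (u a x - (\<Sum>i\<in>I. u i x) / card I)) / (real
      (card I) - 1)"
    using I X by (simp add: sample_cov_shift[where u = u and m = m] sum_divide_distrib)
  also have "(\<Sum>x<p. \<Sum>a\<in>I. (u a x - (\<Sum>i\<in>I. u i x) / card I) * (u a x - (\<Sum>i\<in>I. u i x) / card I)) =
     (\<Sum>a\<in>I. dcen I I (\<lambda>a b. \<Sum>x<p. u a x * u b x) a a)"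
    unfolding dcen_gram by (rule sum.swap)
  finally show ?thesis .
qed

text \<open>The coefficient of the inner product of observations \<open>a\<close> and
  \<open>b\<close> in \<open>T_stat\<close>. Between groups the sizes n_l n_s cancel against those
  in the two sample means, which leaves -1/n.\<close>

definition pair_weight :: "nat \<Rightarrow> (nat \<Rightarrow> nat) \<Rightarrow> nat \<times> nat \<Rightarrow> nat \<times> nat \<Rightarrow> real" where
  "pair_weight k N a b = (let n = real (total_size k N) in
     if fst a = fst b then
       (if a = b then 0 else (n - real (N (fst a))) / (n * (real (N (fst a)) - 1)))
     else - (1 / n))"

definition obs_set :: "nat \<Rightarrow> (nat \<Rightarrow> nat) \<Rightarrow> (nat \<times> nat) set" where
  "obs_set k N = Sigma {1..k} (\<lambda>l. {1..N l})"

lemma sum_obs_set: "(\<Sum>a\<in>obs_set k N. f a) = (\<Sum>l=1..k. \<Sum>i=1..N l. f (l, i))"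
  unfolding obs_set_def using sum.Sigma[of "{1..k}" "\<lambda>l. {1..N l}" "\<lambda>l i. f (l, i)"] by simp

text \<open>The double sum is split according to whether the groups agree. The weights are general
  because both \<open>pair_weight\<close> and its square are inserted.\<close>

lemma sum_pair_weight:
  fixes W :: "nat \<Rightarrow> real" and f :: "nat \<times> nat \<Rightarrow> nat \<times> nat \<Rightarrow> real"
  assumes "\<And>a b. w a b = (if fst a = fst b then (if a = b then 0 else W (fst a)) else W')"
  shows "(\<Sum>a\<in>obs_set k N. \<Sum>b\<in>obs_set k N. w a b * f a b) =
    (\<Sum>l=1..k. W l * (\<Sum>i=1..N l. \<Sum>j\<in>{1..N l} - {i}. f (l, i) (l, j)))
    + (\<Sum>l=1..k. \<Sum>s\<in>{1..k} - {l}. W' * (\<Sum>i=1..N l. \<Sum>j=1..N s. f (l, i) (s, j)))"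
proof -
  have "(\<Sum>a\<in>obs_set k N. \<Sum>b\<in>obs_set k N. w a b * f a b) =
     (\<Sum>l=1..k. \<Sum>s=1..k. \<Sum>i=1..N l. \<Sum>j=1..N s. w (l, i) (s, j) * f (l, i) (s, j))"
    unfolding sum_obs_set by (intro sum.cong refl sum.swap)
  also have "\<dots> = (\<Sum>l=1..k. W l * (\<Sum>i=1..N l. \<Sum>j\<in>{1..N l} - {i}. f (l, i) (l, j))
    + (\<Sum>s\<in>{1..k} - {l}. W' * (\<Sum>i=1..N l. \<Sum>j=1..N s. f (l, i) (s, j))))"
  proof (rule sum.cong[OF refl])
    fix l assume l: "l \<in> {1..k}"
    have "(\<Sum>s=1..k. \<Sum>i=1..N l. \<Sum>j=1..N s. w (l, i) (s, j) * f (l, i) (s, j)) =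
       (\<Sum>i=1..N l. \<Sum>j=1..N l. w (l, i) (l, j) * f (l, i) (l, j))
       + (\<Sum>s\<in>{1..k} - {l}. \<Sum>i=1..N l. \<Sum>j=1..N s. w (l, i) (s, j) * f (l, i) (s, j))"
      using l by (intro sum.remove) auto
    also have "(\<Sum>i=1..N l. \<Sum>j=1..N l. w (l, i) (l, j) * f (l, i) (l, j)) = W l * (\<Sum>i=1..N l. \<Sum>j\<in>{1..N l} -
        {i}. f (l, i) (l, j))"
      unfolding sum_distrib_left
    proof (rule sum.cong[OF refl])
      fix i assume i: "i \<in> {1..N l}"
      have "(\<Sum>j=1..N l. w (l, i) (l, j) * f (l, i) (l, j)) = (\<Sum>j\<in>{1..N l} - {i}. w (l, i) (l, j) * f (l, i)
          (l, j))"
        using i by (subst sum.remove[of _ i]) (auto simp: assms)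
      also have "\<dots> = (\<Sum>j\<in>{1..N l} - {i}. W l * f (l, i) (l, j))"
        by (intro sum.cong) (auto simp: assms)
      finally show "(\<Sum>j=1..N l. w (l, i) (l, j) * f (l, i) (l, j)) = (\<Sum>j\<in>{1..N l} - {i}. W l * f (l, i) (l,
          j))" .
    qed
    also have "(\<Sum>s\<in>{1..k} - {l}. \<Sum>i=1..N l. \<Sum>j=1..N s. w (l, i) (s, j) * f (l, i) (s, j)) =
      (\<Sum>s\<in>{1..k} - {l}. W' * (\<Sum>i=1..N l. \<Sum>j=1..N s. f (l, i) (s, j)))"
      unfolding sum_distrib_left by (intro sum.cong) (auto simp: assms)
    finally show "(\<Sum>s=1..k. \<Sum>i=1..N l. \<Sum>j=1..N s. w (l, i) (s, j) * f (l, i) (s, j)) =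
      W l * (\<Sum>i=1..N l. \<Sum>j\<in>{1..N l} - {i}. f (l, i) (l, j))
      + (\<Sum>s\<in>{1..k} - {l}. W' * (\<Sum>i=1..N l. \<Sum>j=1..N s. f (l, i) (s, j)))" .
  qed
  finally show ?thesis by (simp add: sum.distrib)
qed

text \<open>The weights are chosen so that a common mean cancels.\<close>

lemma scalar_shift_invariance:
  fixes v :: "nat \<Rightarrow> nat \<Rightarrow> real" and m :: real
  assumes n: "n = (\<Sum>l=1..k. real (N l))" "n > 0" and N2: "\<And>l. l \<in> {1..k} \<Longrightarrow> N l \<ge> 2"
  defines "t \<equiv> \<lambda>y. (\<Sum>l=1..k. (n - real (N l)) / (n * (real (N l) - 1)) * (\<Sum>i=1..N l. \<Sum>j\<in>{1..N l} - {i}. y l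
      i * y l j))
    - (\<Sum>l=1..k. \<Sum>s\<in>{1..k} - {l}. 1 / n * ((\<Sum>i=1..N l. y l i) * (\<Sum>j=1..N s. y s j)))"
  shows "t (\<lambda>l i. v l i + m) = t v"
proof -
  define S where "S y l = (\<Sum>i=1..N l. y l i)" for y :: "nat \<Rightarrow> nat \<Rightarrow> real" and l
  define Q where "Q y l = (\<Sum>i=1..N l. y l i ^ 2)" for y :: "nat \<Rightarrow> nat \<Rightarrow> real" and l
  define A where "A l = (n - real (N l)) / (n * (real (N l) - 1))" for l
  have t: "t y = (\<Sum>l=1..k. A l * (S y l ^ 2 - Q y l)) - ((\<Sum>l=1..k. S y l) ^ 2 - (\<Sum>l=1..k. S y l ^ 2)) / n"
      for y
  proof -
    have 1: "(\<Sum>i=1..N l. \<Sum>j\<in>{1..N l} - {i}. y l i * y l j) = S y l ^ 2 - Q y l" for l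
    proof -
      have "(\<Sum>j\<in>{1..N l} - {i}. y l i * y l j) = y l i * S y l - y l i ^ 2" if "i \<in> {1..N l}" for i
      proof -
        have "(\<Sum>j\<in>{1..N l} - {i}. y l j) = S y l - y l i"
          using that by (simp add: S_def sum_diff1)
        thus ?thesis by (simp add: power2_eq_square right_diff_distrib flip: sum_distrib_left)
      qed
      thus ?thesis by (simp add: sum_subtractf Q_def power2_eq_square S_def flip: sum_distrib_right)
    qed
    have *: "(\<Sum>s\<in>{1..k} - {l}. 1 / n * (S y l * S y s)) = (S y l * (\<Sum>s=1..k. S y s) - S y l ^ 2) / n" if "l
        \<in> {1..k}" for l
      using that by (simp add: sum_diff1 power2_eq_square diff_divide_distrib right_diff_distrib flip:
          sum_divide_distrib sum_distrib_left)
    have 2: "(\<Sum>l=1..k. \<Sum>s\<in>{1..k} - {l}. 1 / n * (S y l * S y s)) = ((\<Sum>l=1..k. S y l) ^ 2 - (\<Sum>l=1..k. S y l ^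
        2)) / n"
    proof -
      have "(\<Sum>l=1..k. \<Sum>s\<in>{1..k} - {l}. 1 / n * (S y l * S y s)) =
          (\<Sum>l=1..k. (S y l * (\<Sum>s=1..k. S y s) - S y l ^ 2) / n)"
        by (intro sum.cong refl *)
      also have "\<dots> = ((\<Sum>l=1..k. S y l) * (\<Sum>s=1..k. S y s) - (\<Sum>l=1..k. S y l ^ 2)) / n"
        unfolding sum_divide_distrib[symmetric] sum_subtractf sum_distrib_right[symmetric] ..
      finally show ?thesis by (simp add: power2_eq_square)
    qed
    show ?thesis unfolding t_def 1 S_def[symmetric] 2 A_def ..
  qed
  define v' where "v' l i = v l i + m" for l i
  have S': "S v' l = S v l + N l * m" for l by (simp add: S_def v'_def sum.distrib)
  have Q': "Q v' l = Q v l + 2 * m * S v l + N l * m ^ 2" for l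
    by (simp add: Q_def S_def v'_def power2_sum sum.distrib sum_distrib_left mult_ac)
  \<comment> \<open>\<open>Z l\<close> is the increase of \<open>Q\<close> under the shift. S^2
    increases by N_l Z_l, so S^2 - Q increases by (N_l - 1) Z_l, and the denominator N_l - 1 of the
    weight cancels.\<close>
  define Z where "Z l = 2 * m * S v l + N l * m ^ 2" for l
  have A': "A l * (S v' l ^ 2 - Q v' l) = A l * (S v l ^ 2 - Q v l) + (n - N l) / n * Z l"
    if "l \<in> {1..k}" for l
  proof -
    have "S v' l ^ 2 - Q v' l = (S v l ^ 2 - Q v l) + (real (N l) - 1) * Z l"
      unfolding S' Q' Z_def by (simp add: power2_eq_square algebra_simps)
    hence "A l * (S v' l ^ 2 - Q v' l) = A l * (S v l ^ 2 - Q v l) + A l * (real (N l) - 1) * Z l"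
      by (simp only: distrib_left mult.assoc)
    moreover have "A l * (real (N l) - 1) = (n - N l) / n" using N2[OF that] n(2) by (simp add: A_def)
    ultimately show ?thesis by simp
  qed
  define T0 where "T0 = (\<Sum>l=1..k. S v l)"
  define P0 where "P0 = (\<Sum>l=1..k. A l * (S v l ^ 2 - Q v l))"
  define Q0 where "Q0 = (\<Sum>l=1..k. S v l ^ 2)"
  define NZ where "NZ = (\<Sum>l=1..k. real (N l) * Z l)"
  have nm: "(\<Sum>l=1..k. real (N l) * c) = n * c" for c
    unfolding n(1) by (simp only: sum_distrib_right)
  have T': "(\<Sum>l=1..k. S v' l) = T0 + n * m"
    unfolding S' sum.distrib nm T0_def ..
  have Q0': "(\<Sum>l=1..k. S v' l ^ 2) = Q0 + NZ"
    unfolding S' Q0_def NZ_def Z_def sum.distrib[symmetric]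
    by (intro sum.cong refl) (simp add: power2_eq_square algebra_simps)
  have "(\<Sum>l=1..k. (n - N l) / n * Z l) = (\<Sum>l=1..k. Z l - real (N l) * Z l / n)"
    using n(2) by (intro sum.cong refl) (simp add: field_simps)
  also have "\<dots> = (\<Sum>l=1..k. Z l) - NZ / n"
    unfolding NZ_def sum_divide_distrib sum_subtractf ..
  also have "(\<Sum>l=1..k. Z l) = 2 * m * T0 + n * m ^ 2"
    unfolding Z_def T0_def sum.distrib nm sum_distrib_left ..
  finally have Zs: "(\<Sum>l=1..k. (n - N l) / n * Z l) = 2 * m * T0 + n * m ^ 2 - NZ / n" .
  have "(\<Sum>l=1..k. A l * (S v' l ^ 2 - Q v' l)) = P0 + (2 * m * T0 + n * m ^ 2 - NZ / n)"
    unfolding P0_def Zs[symmetric] sum.distrib[symmetric] by (intro sum.cong refl A')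
  hence "t v' = P0 + (2 * m * T0 + n * m ^ 2 - NZ / n) - ((T0 + n * m) ^ 2 - (Q0 + NZ)) / n"
    unfolding t T' Q0' by simp
  also have "\<dots> = P0 - (T0 ^ 2 - Q0) / n"
    using n(2) by (simp add: field_simps power2_eq_square)
  also have "\<dots> = t v" unfolding t P0_def Q0_def T0_def ..
  finally have "t v' = t v" .
  thus ?thesis by (simp add: v'_def[abs_def])
qed

text \<open>Inner products split into coordinates, and in each coordinate the common shift
  \<open>m x\<close> drops out by \<open>scalar_shift_invariance\<close>.\<close>

lemma T_stat_eq:
  assumes N2: "\<And>l. l \<in> {1..k} \<Longrightarrow> N l \<ge> 2" and k: "k \<ge> 1"
    and dim: "\<And>l i. l \<in> {1..k} \<Longrightarrow> i \<in> {1..N l} \<Longrightarrow> dim_vec (X l i) = p"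
    and X: "\<And>l i x. l \<in> {1..k} \<Longrightarrow> i \<in> {1..N l} \<Longrightarrow> x < p \<Longrightarrow> X l i $ x = u (l, i) x + m x"
  shows "T_stat k N p X = (\<Sum>a\<in>obs_set k N. \<Sum>b\<in>obs_set k N. pair_weight k N a b * (\<Sum>x<p. u a x * u b x))"
proof -
  define n where "n = real (total_size k N)"
  have n: "n = (\<Sum>l=1..k. real (N l))" by (simp add: n_def total_size_def)
  have n0: "n > 0"
  proof -
    have "real (N 1) \<le> n" unfolding n using k by (intro member_le_sum) auto
    thus ?thesis using N2[of 1] k by simp
  qed
  define A where "A l = (n - real (N l)) / (n * (real (N l) - 1))" for l
  define t where "t y = (\<Sum>l=1..k. A l * (\<Sum>i=1..N l. \<Sum>j\<in>{1..N l} - {i}. y l i * y l j))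
    - (\<Sum>l=1..k. \<Sum>s\<in>{1..k} - {l}. 1 / n * ((\<Sum>i=1..N l. y l i) * (\<Sum>j=1..N s. y s j)))"
    for y :: "nat \<Rightarrow> nat \<Rightarrow> real"
  have cross: "real (N l) * real (N s) / n * (sample_mean p {1..N l} (X l) \<bullet> sample_mean p {1..N s} (X s)) =
     (\<Sum>x<p. 1 / n * ((\<Sum>i=1..N l. X l i $ x) * (\<Sum>j=1..N s. X s j $ x)))"
    if "l \<in> {1..k}" "s \<in> {1..k}" for l s
  proof -
    define a where "a x = (\<Sum>i=1..N l. X l i $ x)" for x
    define b where "b x = (\<Sum>j=1..N s. X s j $ x)" for x
    have "sample_mean p {1..N l} (X l) \<bullet> sample_mean p {1..N s} (X s) = (\<Sum>x<p. a x / N l * (b x / N s))"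
      by (simp add: scalar_prod_def sample_mean_def atLeast0LessThan a_def b_def)
    thus ?thesis
      using N2[OF that(1)] N2[OF that(2)] n0
      unfolding a_def[symmetric] b_def[symmetric] by (simp add: sum_distrib_left)
  qed
  have dot: "X l i \<bullet> X l j = (\<Sum>x<p. X l i $ x * X l j $ x)"
    if "l \<in> {1..k}" "i \<in> {1..N l}" "j \<in> {1..N l}" for l i j
    using that by (simp add: scalar_prod_def atLeast0LessThan dim)
  have "T_stat k N p X = (\<Sum>l=1..k. A l * (\<Sum>i=1..N l. \<Sum>j\<in>{1..N l} - {i}. \<Sum>x<p. X l i $ x * X l j $ x))
    - (\<Sum>l=1..k. \<Sum>s\<in>{1..k} - {l}. \<Sum>x<p. 1 / n * ((\<Sum>i=1..N l. X l i $ x) * (\<Sum>j=1..N s. X s j $ x)))"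
    unfolding T_stat_def Let_def n_def[symmetric] A_def
    by (intro arg_cong2[where f = "(-)"] sum.cong refl arg_cong2[where f = "(*)"])
       (rule dot cross; simp)+
  also have "\<dots> = (\<Sum>x<p. t (\<lambda>l i. X l i $ x))"
  proof -
    have "(\<Sum>i=1..N l. \<Sum>j\<in>{1..N l} - {i}. \<Sum>x<p. X l i $ x * X l j $ x) = (\<Sum>x<p. \<Sum>i=1..N l. \<Sum>j\<in>{1..N l} - {i}.
        X l i $ x * X l j $ x)" for l
      by (subst sum.swap, intro sum.cong refl sum.swap)
    hence "(\<Sum>l=1..k. A l * (\<Sum>i=1..N l. \<Sum>j\<in>{1..N l} - {i}. \<Sum>x<p. X l i $ x * X l j $ x)) =
      (\<Sum>x<p. \<Sum>l=1..k. A l * (\<Sum>i=1..N l. \<Sum>j\<in>{1..N l} - {i}. X l i $ x * X l j $ x))"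
      by (simp add: sum_distrib_left) (rule sum.swap)
    moreover have "(\<Sum>l=1..k. \<Sum>s\<in>{1..k} - {l}. \<Sum>x<p. 1 / n * ((\<Sum>i=1..N l. X l i $ x) * (\<Sum>j=1..N s. X s j $
        x))) =
      (\<Sum>x<p. \<Sum>l=1..k. \<Sum>s\<in>{1..k} - {l}. 1 / n * ((\<Sum>i=1..N l. X l i $ x) * (\<Sum>j=1..N s. X s j $ x)))"
      by (subst sum.swap[of _ "{..<p}"], intro sum.cong refl sum.swap)
    ultimately show ?thesis by (simp only: t_def sum_subtractf)
  qed
  also have "\<dots> = (\<Sum>x<p. t (\<lambda>l i. u (l, i) x))"
  proof (rule sum.cong[OF refl])
    fix x assume x: "x \<in> {..<p}"
    have "t (\<lambda>l i. X l i $ x) = t (\<lambda>l i. u (l, i) x + m x)"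
      unfolding t_def using X x
      by (intro arg_cong2[where f = "(-)"] arg_cong2[where f = "(*)"] sum.cong refl) auto
    also have "\<dots> = t (\<lambda>l i. u (l, i) x)"
      unfolding t_def A_def by (rule scalar_shift_invariance[OF n n0 N2])
    finally show "t (\<lambda>l i. X l i $ x) = t (\<lambda>l i. u (l, i) x)" .
  qed
  also have "\<dots> = (\<Sum>x<p. \<Sum>a\<in>obs_set k N. \<Sum>b\<in>obs_set k N. pair_weight k N a b * (u a x * u b x))"
  proof (rule sum.cong[OF refl])
    fix x
    have "(\<Sum>a\<in>obs_set k N. \<Sum>b\<in>obs_set k N. pair_weight k N a b * (u a x * u b x)) =
      (\<Sum>l=1..k. A l * (\<Sum>i=1..N l. \<Sum>j\<in>{1..N l} - {i}. u (l, i) x * u (l, j) x))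
      + (\<Sum>l=1..k. \<Sum>s\<in>{1..k} - {l}. - (1 / n) * (\<Sum>i=1..N l. \<Sum>j=1..N s. u (l, i) x * u (s, j) x))"
      by (rule sum_pair_weight) (simp add: pair_weight_def Let_def A_def n_def)
    thus "t (\<lambda>l i. u (l, i) x) = (\<Sum>a\<in>obs_set k N. \<Sum>b\<in>obs_set k N. pair_weight k N a b * (u a x * u b x))"
      unfolding t_def sum_product by (simp add: sum_negf)
  qed
  also have "\<dots> = (\<Sum>a\<in>obs_set k N. \<Sum>x<p. \<Sum>b\<in>obs_set k N. pair_weight k N a b * (u a x * u b x))"
    by (rule sum.swap)
  also have "\<dots> = (\<Sum>a\<in>obs_set k N. \<Sum>b\<in>obs_set k N. \<Sum>x<p. pair_weight k N a b * (u a x * u b x))"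
    by (intro sum.cong refl sum.swap)
  finally show ?thesis by (simp add: sum_distrib_left)
qed

section \<open>Traces of products of covariance matrices\<close>

lemma mat_trace_comm:
  assumes "A \<in> carrier_mat n q" "B \<in> carrier_mat q n"
  shows "mat_trace (A * B) = mat_trace (B * A)"
  unfolding mat_trace_mult[OF assms] mat_trace_mult[OF assms(2,1)]
  by (subst sum.swap) (simp add: mult.commute)

lemma sum_entrywise_mult:
  assumes "P \<in> carrier_mat q q'" "Q \<in> carrier_mat q q'"
  shows "(\<Sum>j<q. \<Sum>k<q'. P $$ (j, k) * Q $$ (j, k)) = mat_trace (P * transpose_mat Q)"
  using assms by (subst mat_trace_mult[where n = q and q = q']) (auto intro!: sum.cong)

context
  fixes p r :: nat and \<Gamma> :: "nat \<Rightarrow> real Matrix.mat"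
begin

lemma pop_cov_carrier: "\<Gamma> l \<in> carrier_mat p r \<Longrightarrow> pop_cov \<Gamma> l \<in> carrier_mat p p"
  by (auto simp: pop_cov_def)

lemma pop_cov_sym: "\<Gamma> l \<in> carrier_mat p r \<Longrightarrow> transpose_mat (pop_cov \<Gamma> l) = pop_cov \<Gamma> l"
  unfolding pop_cov_def by (subst transpose_mult) (auto simp: transpose_carrier_mat)

text \<open>The r x r side is used because the quadratic form lives in the coordinates of the Z
  vectors; traces of p x p covariances are recovered by cyclicity.\<close>

definition load_prod :: "nat \<Rightarrow> nat \<Rightarrow> real Matrix.mat" where
  "load_prod l s = transpose_mat (\<Gamma> l) * \<Gamma> s"

lemma load_prod_index:
  assumes "\<Gamma> l \<in> carrier_mat p r" "\<Gamma> s \<in> carrier_mat p r" "j < r" "k < r"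
  shows "load_prod l s $$ (j, k) = (\<Sum>x<p. \<Gamma> l $$ (x, j) * \<Gamma> s $$ (x, k))"
  using assms by (auto simp: load_prod_def scalar_prod_def atLeast0LessThan intro!: sum.cong)

lemma load_prod_mult:
  assumes G: "\<Gamma> a \<in> carrier_mat p r" "\<Gamma> b \<in> carrier_mat p r" "\<Gamma> c \<in> carrier_mat p r"
  shows "load_prod a b * load_prod b c = transpose_mat (\<Gamma> a) * (pop_cov \<Gamma> b * \<Gamma> c)"
proof -
  have At: "transpose_mat (\<Gamma> a) \<in> carrier_mat r p" and Bt: "transpose_mat (\<Gamma> b) \<in> carrier_mat r p"
    using G by auto
  have "load_prod a b * load_prod b c = transpose_mat (\<Gamma> a) * (\<Gamma> b * (transpose_mat (\<Gamma> b) * \<Gamma> c))"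
    unfolding load_prod_def by (rule assoc_mult_mat[OF At G(2) mult_carrier_mat[OF Bt G(3)]])
  also have "\<Gamma> b * (transpose_mat (\<Gamma> b) * \<Gamma> c) = pop_cov \<Gamma> b * \<Gamma> c"
    unfolding pop_cov_def by (rule assoc_mult_mat[OF G(2) Bt G(3), symmetric])
  finally show ?thesis .
qed

lemma sum_load_prod_sq:
  assumes G: "\<Gamma> l \<in> carrier_mat p r" "\<Gamma> s \<in> carrier_mat p r"
  shows "(\<Sum>j<r. \<Sum>k<r. load_prod l s $$ (j, k) ^ 2) = mat_trace (pop_cov \<Gamma> l * pop_cov \<Gamma> s)"
proof -
  let ?L = "\<Gamma> l" and ?S = "\<Gamma> s"
  have c: "transpose_mat ?L \<in> carrier_mat r p" "transpose_mat ?S \<in> carrier_mat r p"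
    using G by auto
  have "(\<Sum>j<r. \<Sum>k<r. load_prod l s $$ (j, k) ^ 2) = mat_trace (load_prod l s * transpose_mat (load_prod l
      s))"
    unfolding power2_eq_square by (rule sum_entrywise_mult) (use G in \<open>auto simp: load_prod_def\<close>)
  also have "transpose_mat (load_prod l s) = transpose_mat ?S * ?L"
    unfolding load_prod_def using G by (subst transpose_mult) auto
  also have "load_prod l s * (transpose_mat ?S * ?L) = transpose_mat ?L * (pop_cov \<Gamma> s * ?L)"
    using load_prod_mult[of l s l] G by (simp add: load_prod_def)
  also have "mat_trace \<dots> = mat_trace (pop_cov \<Gamma> s * ?L * transpose_mat ?L)"
    by (rule mat_trace_comm[of _ r p]) (use G in \<open>auto simp: pop_cov_def\<close>)
  also have "pop_cov \<Gamma> s * ?L * transpose_mat ?L = pop_cov \<Gamma> s * pop_cov \<Gamma> l"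
    unfolding pop_cov_def[of \<Gamma> l] by (rule assoc_mult_mat[of _ p p _ r _ p]) (use G in \<open>auto simp:
        pop_cov_def\<close>)
  also have "mat_trace \<dots> = mat_trace (pop_cov \<Gamma> l * pop_cov \<Gamma> s)"
    by (rule mat_trace_comm[of _ p p]) (use G in \<open>auto simp: pop_cov_def\<close>)
  finally show ?thesis .
qed

text \<open>The block of the squared kernel leading from \<open>a\<close> to \<open>c\<close>
  through \<open>b\<close>; it equals \<open>load_prod a b * load_prod b c\<close>.\<close>

definition load_cycle :: "nat \<Rightarrow> nat \<Rightarrow> nat \<Rightarrow> real Matrix.mat" where
  "load_cycle a b c = transpose_mat (\<Gamma> a) * (pop_cov \<Gamma> b * \<Gamma> c)"

lemma load_cycle_index:
  assumes G: "\<Gamma> a \<in> carrier_mat p r" "\<Gamma> b \<in> carrier_mat p r" "\<Gamma> c \<in> carrier_mat p r" and jk: "j < r" "k < r"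
  shows "load_cycle a b c $$ (j, k) = (\<Sum>i<r. load_prod a b $$ (j, i) * load_prod b c $$ (i, k))"
proof -
  have "load_cycle a b c = load_prod a b * load_prod b c"
    using load_prod_mult[OF G] by (simp add: load_cycle_def)
  thus ?thesis using jk G by (auto simp: scalar_prod_def atLeast0LessThan load_prod_def intro!: sum.cong)
qed

text \<open>Two paths from \<open>a\<close> to \<open>c\<close>, through \<open>b\<close> and
  through \<open>d\<close>, close up to a cycle of length four. Cyclicity of the trace turns their
  Frobenius inner product into a trace of four covariances, the quantity in (A3).\<close>

lemma sum_load_cycle:
  assumes G: "\<Gamma> a \<in> carrier_mat p r" "\<Gamma> b \<in> carrier_mat p r" "\<Gamma> c \<in> carrier_mat p r" "\<Gamma> d \<in> carrier_mat p r"
  shows "(\<Sum>j<r. \<Sum>k<r. load_cycle a b c $$ (j, k) * load_cycle a d c $$ (j, k)) =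
    mat_trace (pop_cov \<Gamma> b * pop_cov \<Gamma> c * pop_cov \<Gamma> d * pop_cov \<Gamma> a)"
proof -
  let ?A = "\<Gamma> a" and ?C = "\<Gamma> c" and ?P = "pop_cov \<Gamma>"
  have P: "?P a \<in> carrier_mat p p" "?P b \<in> carrier_mat p p" "?P c \<in> carrier_mat p p" "?P d \<in> carrier_mat p
      p"
    using G by (auto intro: pop_cov_carrier)
  have At: "transpose_mat ?A \<in> carrier_mat r p" and Ct: "transpose_mat ?C \<in> carrier_mat r p" using G by auto
  have bc: "?P b * ?C \<in> carrier_mat p r" and dc: "?P d * ?C \<in> carrier_mat p r" using P G by auto
  have dA: "?P d * ?A \<in> carrier_mat p r" using P G by auto
  have CdA: "transpose_mat ?C * (?P d * ?A) \<in> carrier_mat r r" using Ct dA by auto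
  have "(\<Sum>j<r. \<Sum>k<r. load_cycle a b c $$ (j, k) * load_cycle a d c $$ (j, k)) =
     mat_trace (load_cycle a b c * transpose_mat (load_cycle a d c))"
    by (rule sum_entrywise_mult) (use At bc dc in \<open>auto simp: load_cycle_def\<close>)
  also have "transpose_mat (load_cycle a d c) = transpose_mat ?C * ?P d * ?A"
    unfolding load_cycle_def using P G At dc
    by (subst transpose_mult[of _ r p _ r]) (auto simp: transpose_mult[of _ p p _ r] pop_cov_sym[OF G(4)])
  also have "\<dots> = transpose_mat ?C * (?P d * ?A)"
    by (rule assoc_mult_mat[OF Ct P(4) G(1)])
  also have "load_cycle a b c * (transpose_mat ?C * (?P d * ?A)) = transpose_mat ?A * (?P b * ?C *
      (transpose_mat ?C * (?P d * ?A)))"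
    unfolding load_cycle_def by (rule assoc_mult_mat[OF At bc CdA])
  also have "mat_trace \<dots> = mat_trace (?P b * ?C * (transpose_mat ?C * (?P d * ?A)) * transpose_mat ?A)"
    by (rule mat_trace_comm[OF At]) (use bc CdA in auto)
  also have "?P b * ?C * (transpose_mat ?C * (?P d * ?A)) = ?P b * ?C * transpose_mat ?C * (?P d * ?A)"
    by (rule assoc_mult_mat[OF bc Ct dA, symmetric])
  also have "?P b * ?C * transpose_mat ?C = ?P b * ?P c"
    unfolding pop_cov_def[of \<Gamma> c] by (rule assoc_mult_mat[OF P(2) G(3) Ct])
  also have "?P b * ?P c * (?P d * ?A) * transpose_mat ?A = ?P b * ?P c * (?P d * ?A * transpose_mat ?A)"
    by (rule assoc_mult_mat[OF mult_carrier_mat[OF P(2,3)] dA At])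
  also have "?P d * ?A * transpose_mat ?A = ?P d * ?P a"
    unfolding pop_cov_def[of \<Gamma> a] by (rule assoc_mult_mat[OF P(4) G(1) At])
  also have "?P b * ?P c * (?P d * ?P a) = ?P b * ?P c * ?P d * ?P a"
    by (rule assoc_mult_mat[OF mult_carrier_mat[OF P(2,3)] P(4) P(1), symmetric])
  finally show ?thesis .
qed

lemma mat_trace_pop_cov_sum:
  assumes G: "\<And>l. l \<in> {1..k} \<Longrightarrow> \<Gamma> l \<in> carrier_mat p r"
  shows "mat_trace (pop_cov_sum k p \<Gamma> * pop_cov_sum k p \<Gamma>) = (\<Sum>l=1..k. \<Sum>s=1..k. mat_trace (pop_cov \<Gamma> l *
      pop_cov \<Gamma> s))"
proof -
  let ?P = "pop_cov \<Gamma>"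
  have "mat_trace (pop_cov_sum k p \<Gamma> * pop_cov_sum k p \<Gamma>) =
      (\<Sum>x<p. \<Sum>y<p. \<Sum>l=1..k. \<Sum>s=1..k. ?P l $$ (x, y) * ?P s $$ (y, x))"
    by (subst mat_trace_mult[where n = p and q = p]) (auto simp: pop_cov_sum_def sum_product)
  also have "\<dots> = (\<Sum>l=1..k. \<Sum>s=1..k. \<Sum>x<p. \<Sum>y<p. ?P l $$ (x, y) * ?P s $$ (y, x))"
    by (rule sum_swap_blocks)
  also have "\<dots> = (\<Sum>l=1..k. \<Sum>s=1..k. mat_trace (?P l * ?P s))"
    by (intro sum.cong refl mat_trace_mult[where n = p and q = p, symmetric] pop_cov_carrier G)
  finally show ?thesis .
qed

text \<open>The first diagonal entry is positive, as the value of the quadratic form at a unit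
  vector, and its square is one summand of the squared Frobenius norm.\<close>

lemma mat_trace_pop_cov_sq_pos:
  assumes G: "\<Gamma> l \<in> carrier_mat p r" and pd: "pos_def_mat (pop_cov \<Gamma> l)" and p: "0 < p"
  shows "0 < mat_trace (pop_cov \<Gamma> l * pop_cov \<Gamma> l)"
proof -
  let ?P = "pop_cov \<Gamma> l"
  have P: "?P \<in> carrier_mat p p" by (rule pop_cov_carrier[OF G])
  have sym: "?P $$ (y, x) = ?P $$ (x, y)" if "x < p" "y < p" for x y
    using pop_cov_sym[OF G] P that by (metis carrier_matD index_transpose_mat(1))
  have "unit_vec p 0 \<noteq> (0\<^sub>v p :: real Matrix.vec)"
    using p by (metis index_unit_vec(1) index_zero_vec(1) zero_neq_one)
  hence "0 < unit_vec p 0 \<bullet> (?P *\<^sub>v unit_vec p 0)"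
    using pd P unfolding pos_def_mat_def by auto
  also have "\<dots> = ?P $$ (0, 0)"
    using P p by (simp add: scalar_prod_left_unit scalar_prod_right_unit)
  finally have d: "0 < ?P $$ (0, 0)" .
  have "0 < ?P $$ (0, 0) ^ 2" using d by simp
  also have "\<dots> \<le> (\<Sum>y<p. ?P $$ (0, y) ^ 2)"
    using p by (intro member_le_sum[where f = "\<lambda>y. ?P $$ (0, y) ^ 2"]) auto
  also have "\<dots> \<le> (\<Sum>x<p. \<Sum>y<p. ?P $$ (x, y) ^ 2)"
    using p by (intro member_le_sum[where f = "\<lambda>x. \<Sum>y<p. ?P $$ (x, y) ^ 2"]) (auto simp: sum_nonneg)
  also have "\<dots> = mat_trace (?P * ?P)"
    unfolding mat_trace_mult[OF P P] using sym by (intro sum.cong refl) (simp add: power2_eq_square)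
  finally show ?thesis .
qed

end

section \<open>Studentization\<close>

lemma measure_std_normal_singleton: "measure std_normal_distribution {x} = 0"
proof -
  have "emeasure std_normal_distribution {x} = (\<integral>\<^sup>+y. ennreal (std_normal_density y) * indicator {x} y
      \<partial>lborel)"
    by (subst emeasure_density) auto
  also have "\<dots> = 0"
    by (rule nn_integral_null_set) auto
  finally show ?thesis by (simp add: measure_def)
qed

lemma isCont_cdf_std_normal: "isCont (cdf std_normal_distribution) x"
proof -
  interpret S: real_distribution std_normal_distribution by (rule real_dist_normal_dist)
  show ?thesis using S.isCont_cdf measure_std_normal_singleton by blast
qed

text \<open>\<open>V\<close> may be zero or negative, where the quotient is a junk value, but only with vanishing probability.\<close>

lemma slutsky_tail:
  fixes X V :: "nat \<Rightarrow> 'a \<Rightarrow> real"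
  assumes M: "\<And>m. prob_space (M m)"
    and X: "\<And>m. X m \<in> borel_measurable (M m)" and V: "\<And>m. V m \<in> borel_measurable (M m)"
    and conv: "weak_conv_m (\<lambda>m. distr (M m) borel (X m)) std_normal_distribution"
    and ratio: "\<And>\<eta>. 0 < \<eta> \<Longrightarrow> (\<lambda>m. measure (M m) {\<omega> \<in> space (M m). \<eta> \<le> \<bar>V m \<omega> - 1\<bar>}) \<longlonglongrightarrow> 0"
  shows "(\<lambda>m. measure (M m) {\<omega> \<in> space (M m). \<xi> \<le> X m \<omega> / sqrt (V m \<omega>)}) \<longlonglongrightarrow> measure std_normal_distribution
      {\<xi>..}"
proof -
  interpret S: real_distribution std_normal_distribution by (rule real_dist_normal_dist)
  interpret P: prob_space "M m" for m by (rule M)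
  note [measurable] = X V
  define G where "G x = 1 - cdf std_normal_distribution x" for x
  define g where "g m x = measure (M m) {\<omega> \<in> space (M m). x < X m \<omega>}" for m x
  have g: "g m x = 1 - cdf (distr (M m) borel (X m)) x" for m x
  proof -
    have "cdf (distr (M m) borel (X m)) x = measure (M m) {\<omega> \<in> space (M m). X m \<omega> \<le> x}"
      unfolding cdf_def by (subst measure_distr) (auto intro!: arg_cong[where f = "measure (M m)"])
    moreover have "g m x = measure (M m) (space (M m) - {\<omega> \<in> space (M m). X m \<omega> \<le> x})"
      unfolding g_def by (intro arg_cong[where f = "measure (M m)"]) auto
    moreover have "\<dots> = 1 - measure (M m) {\<omega> \<in> space (M m). X m \<omega> \<le> x}"
      by (rule P.prob_compl) measurable
    ultimately show ?thesis by simp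
  qed
  have gG: "(\<lambda>m. g m x) \<longlonglongrightarrow> G x" for x
    using conv isCont_cdf_std_normal unfolding weak_conv_m_def weak_conv_def g G_def
    by (intro tendsto_diff tendsto_const) auto
  have G\<xi>: "measure std_normal_distribution {\<xi>..} = G \<xi>"
  proof -
    have "measure std_normal_distribution {\<xi>..} = measure std_normal_distribution {\<xi>} + measure
        std_normal_distribution {\<xi><..}"
      by (subst S.finite_measure_Union[symmetric]) (auto intro!: arg_cong[where f = "measure _"])
    moreover have "measure std_normal_distribution {\<xi><..} = measure std_normal_distribution (space
        std_normal_distribution - {..\<xi>})"
      by (intro arg_cong[where f = "measure _"]) auto
    moreover have "\<dots> = 1 - measure std_normal_distribution {..\<xi>}"
      by (rule S.prob_compl) simp
    ultimately show ?thesis by (simp add: G_def cdf_def measure_std_normal_singleton)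
  qed
  have Gc: "isCont G \<xi>" unfolding G_def by (intro continuous_intros isCont_cdf_std_normal)
  define q where "q m = measure (M m) {\<omega> \<in> space (M m). \<xi> \<le> X m \<omega> / sqrt (V m \<omega>)}" for m
  have "q \<longlonglongrightarrow> G \<xi>"
  proof (rule LIMSEQ_I)
    fix e :: real assume e: "0 < e"
    obtain d where d: "0 < d" "\<And>x. \<bar>x - \<xi>\<bar> < d \<Longrightarrow> \<bar>G x - G \<xi>\<bar> < e / 3"
      using Gc e unfolding continuous_at_eps_delta by (metis divide_pos_pos dist_real_def zero_less_numeral)
    define t where "t = d / 2"
    have t: "0 < t" "\<bar>G (\<xi> + t) - G \<xi>\<bar> < e / 3" "\<bar>G (\<xi> - t) - G \<xi>\<bar> < e / 3"
      using d by (auto simp: t_def)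
    have "isCont (\<lambda>v. \<xi> * sqrt v) 1" by (intro continuous_intros)
    then obtain c where c: "0 < c" "\<And>v. \<bar>v - 1\<bar> < c \<Longrightarrow> \<bar>\<xi> * sqrt v - \<xi>\<bar> < t"
      using t(1) unfolding continuous_at_eps_delta dist_real_def by (metis mult.right_neutral real_sqrt_one)
    \<comment> \<open>The bound 1 forces \<open>v\<close> to be positive, so that multiplying by
      \<open>sqrt v\<close> preserves inequalities.\<close>
    define \<eta> where "\<eta> = min c 1"
    have \<eta>: "0 < \<eta>" using c by (simp add: \<eta>_def)
    have good: "0 < sqrt v" "\<bar>\<xi> * sqrt v - \<xi>\<bar> < t" if "\<bar>v - 1\<bar> < \<eta>" for v
      using that c(2)[of v] by (auto simp: \<eta>_def)
    define b where "b m = measure (M m) {\<omega> \<in> space (M m). \<eta> \<le> \<bar>V m \<omega> - 1\<bar>}" for m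
    \<comment> \<open>Outside the bad event, studentization moves the threshold \<xi> by less than
      \<open>t\<close>.\<close>
    have up: "q m \<le> g m (\<xi> - t) + b m" for m
    proof -
      have "q m \<le> measure (M m) ({\<omega> \<in> space (M m). \<xi> - t < X m \<omega>} \<union> {\<omega> \<in> space (M m). \<eta> \<le> \<bar>V m \<omega> - 1\<bar>})"
        unfolding q_def
      proof (rule P.finite_measure_mono)
        show "{\<omega> \<in> space (M m). \<xi> \<le> X m \<omega> / sqrt (V m \<omega>)} \<subseteq> {\<omega> \<in> space (M m). \<xi> - t < X m \<omega>} \<union> {\<omega> \<in> space (M
            m). \<eta> \<le> \<bar>V m \<omega> - 1\<bar>}"
        proof safe
          fix \<omega> assume "\<omega> \<in> space (M m)" "\<xi> \<le> X m \<omega> / sqrt (V m \<omega>)" "\<not> \<eta> \<le> \<bar>V m \<omega> - 1\<bar>"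
          with good[of "V m \<omega>"] show "\<xi> - t < X m \<omega>" by (simp add: le_divide_eq)
        qed
      qed measurable
      also have "\<dots> \<le> g m (\<xi> - t) + b m"
        unfolding g_def b_def by (intro measure_Un_le) measurable
      finally show ?thesis .
    qed
    have low: "g m (\<xi> + t) \<le> q m + b m" for m
    proof -
      have "g m (\<xi> + t) \<le> measure (M m) ({\<omega> \<in> space (M m). \<xi> \<le> X m \<omega> / sqrt (V m \<omega>)} \<union> {\<omega> \<in> space (M m). \<eta> \<le>
          \<bar>V m \<omega> - 1\<bar>})"
        unfolding g_def
      proof (rule P.finite_measure_mono)
        show "{\<omega> \<in> space (M m). \<xi> + t < X m \<omega>} \<subseteq> {\<omega> \<in> space (M m). \<xi> \<le> X m \<omega> / sqrt (V m \<omega>)} \<union> {\<omega> \<in> space (M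
            m). \<eta> \<le> \<bar>V m \<omega> - 1\<bar>}"
        proof safe
          fix \<omega> assume "\<omega> \<in> space (M m)" "\<xi> + t < X m \<omega>" "\<not> \<eta> \<le> \<bar>V m \<omega> - 1\<bar>"
          with good[of "V m \<omega>"] show "\<xi> \<le> X m \<omega> / sqrt (V m \<omega>)" by (simp add: le_divide_eq)
        qed
      qed measurable
      also have "\<dots> \<le> q m + b m"
        unfolding q_def b_def by (intro measure_Un_le) measurable
      finally show ?thesis .
    qed
    have e3: "0 < e / 3" using e by simp
    have "\<forall>\<^sub>F m in sequentially. \<bar>g m (\<xi> - t) - G (\<xi> - t)\<bar> < e / 3"
      using tendstoD[OF gG[of "\<xi> - t"] e3] by (simp add: dist_real_def)
    moreover have "\<forall>\<^sub>F m in sequentially. \<bar>g m (\<xi> + t) - G (\<xi> + t)\<bar> < e / 3"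
      using tendstoD[OF gG[of "\<xi> + t"] e3] by (simp add: dist_real_def)
    moreover have "\<forall>\<^sub>F m in sequentially. \<bar>b m\<bar> < e / 3"
      using tendstoD[OF ratio[OF \<eta>] e3] by (simp add: dist_real_def b_def)
    ultimately have "\<forall>\<^sub>F m in sequentially. norm (q m - G \<xi>) < e"
    proof eventually_elim
      case (elim m)
      thus ?case using up[of m] low[of m] t unfolding real_norm_def abs_less_iff by linarith
    qed
    thus "\<exists>m0. \<forall>m\<ge>m0. norm (q m - G \<xi>) < e" by (simp add: eventually_sequentially)
  qed
  thus ?thesis unfolding q_def G\<xi> .
qed

section \<open>The test statistic under the null hypothesis\<close>

lemma dcen_image:
  assumes "inj_on f I" "inj_on g I'"
  shows "dcen (f ` I) (g ` I') F (f a) (g b) = dcen I I' (\<lambda>a b. F (f a) (g b)) a b"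
  using assms unfolding dcen_def by (simp add: sum.reindex card_image)

text \<open>These conditions hold for all late members of the sequence, with one \<delta>. The size
  6 leaves at least two observations in each part of a split group, and the bound 4 keeps each part
  at least of size \<delta> n / 4.\<close>

locale factor_null = factor_model M k N p r \<mu> \<Gamma> z \<gamma>
  for M :: "'a measure" and k :: nat and N :: "nat \<Rightarrow> nat" and p r :: nat
    and \<mu> :: "nat \<Rightarrow> real Matrix.vec" and \<Gamma> :: "nat \<Rightarrow> real Matrix.mat"
    and z :: "nat \<Rightarrow> nat \<Rightarrow> nat \<Rightarrow> 'a \<Rightarrow> real" and \<gamma> :: "nat \<Rightarrow> real" +
  fixes \<delta> :: real
  assumes p_pos: "0 < p"
    and null: "\<And>l s. l \<in> {1..k} \<Longrightarrow> s \<in> {1..k} \<Longrightarrow> \<mu> l = \<mu> s"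
    and \<delta>_pos: "0 < \<delta>"
    and balanced: "\<And>l. l \<in> {1..k} \<Longrightarrow> \<delta> * real (total_size k N) \<le> real (N l)"
    and large: "\<And>l. l \<in> {1..k} \<Longrightarrow> 6 \<le> N l" "4 \<le> \<delta> * real (total_size k N)"

text \<open>One bound for the fourth moments 3 + \<gamma>_l of all groups; it depends only on
  \<open>k\<close> and \<gamma> and so stays fixed along the sequence.\<close>

definition moment_bound :: "nat \<Rightarrow> (nat \<Rightarrow> real) \<Rightarrow> real" where
  "moment_bound k \<gamma> = 3 + (\<Sum>l=1..k. \<bar>\<gamma> l\<bar>)"

sublocale factor_null \<subseteq> F: obs_family M "obs_set k N" r "\<lambda>((l, i), j). z l i j" "moment_bound k \<gamma>" p "\<lambda>a x
    j. \<Gamma> (fst a) $$ (x, j)"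
proof unfold_locales
  let ?J = "obs_set k N \<times> {..<r}" and ?\<zeta> = "\<lambda>((l, i), j). z l i j"
  have J: "fst (fst i) \<in> {1..k}" "snd (fst i) \<in> {1..N (fst (fst i))}" "snd i < r" if "i \<in> ?J" for i
    using that by (auto simp: obs_set_def)
  have \<zeta>: "?\<zeta> i = z (fst (fst i)) (snd (fst i)) (snd i)" for i
    by (simp add: split_def)
  show "finite ?J" by (simp add: obs_set_def)
  define f where "f = (\<lambda>((l, i), j). (l, i, j) :: nat \<times> nat \<times> nat)"
  have "indep_vars (\<lambda>_. borel) (\<lambda>i. (\<lambda>(l, i, j). z l i j) (f i)) ?J"
    by (rule indep_vars_reindex[OF indep]) (auto simp: f_def inj_on_def obs_set_def)
  thus "indep_vars (\<lambda>_. borel) ?\<zeta> ?J"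
    by (simp add: f_def split_def cong: indep_vars_cong)
  fix i assume i: "i \<in> ?J"
  show "expectation (?\<zeta> i) = 0" unfolding \<zeta> by (rule mean_zero[OF J[OF i]])
  show "expectation (\<lambda>\<omega>. ?\<zeta> i \<omega> ^ 2) = 1"
    unfolding \<zeta> power2_eq_square using cov_identity[OF J(1,2,3)[OF i] J(3)[OF i]] by simp
  show "integrable M (\<lambda>\<omega>. ?\<zeta> i \<omega> ^ 4)" unfolding \<zeta> by (rule fourth_moment_finite[OF J[OF i]])
  have "\<bar>\<gamma> (fst (fst i))\<bar> \<le> (\<Sum>l=1..k. \<bar>\<gamma> l\<bar>)"
    using J(1)[OF i] by (intro member_le_sum) auto
  thus "expectation (\<lambda>\<omega>. ?\<zeta> i \<omega> ^ 4) \<le> moment_bound k \<gamma>"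
    unfolding \<zeta> using fourth_moment[OF J[OF i]] by (simp add: moment_bound_def)
next
  show "1 \<le> moment_bound k \<gamma>" by (simp add: moment_bound_def sum_nonneg add_increasing2)
  show "0 < r" using p_pos dims by simp
qed

section \<open>Size of the variance and of the squared kernel\<close>

context factor_null
begin

abbreviation K0 :: real where "K0 \<equiv> moment_bound k \<gamma>"
abbreviation n :: real where "n \<equiv> real (total_size k N)"
abbreviation X :: "'a \<Rightarrow> nat \<Rightarrow> nat \<Rightarrow> real Matrix.vec" where "X \<equiv> factor_obs r \<mu> \<Gamma> z"
abbreviation w :: "nat \<times> nat \<Rightarrow> nat \<times> nat \<Rightarrow> real" where "w \<equiv> pair_weight k N"
abbreviation Obs :: "(nat \<times> nat) set" where "Obs \<equiv> obs_set k N"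

definition tr2 :: "nat \<Rightarrow> nat \<Rightarrow> real" where
  "tr2 l s = mat_trace (pop_cov \<Gamma> l * pop_cov \<Gamma> s)"

definition tr4 :: "nat \<Rightarrow> nat \<Rightarrow> nat \<Rightarrow> nat \<Rightarrow> real" where
  "tr4 l s i j = mat_trace (pop_cov \<Gamma> l * pop_cov \<Gamma> s * pop_cov \<Gamma> i * pop_cov \<Gamma> j)"

text \<open>\<open>var_est\<close> with the true traces in place of the estimates; under the null
  hypothesis it is the exact variance of the statistic.\<close>

definition var_T :: real where
  "var_T = 2 / n^2 * ((\<Sum>l=1..k. real (N l) * (n - real (N l))^2 / (real (N l) - 1) * tr2 l l)
              + (\<Sum>l=1..k. \<Sum>s\<in>{1..k} - {l}. real (N l) * real (N s) * tr2 l s))"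

lemma Obs_fst: "a \<in> Obs \<Longrightarrow> fst a \<in> {1..k}"
  by (auto simp: obs_set_def)

lemma n_pos: "0 < n" and n_eq: "n = (\<Sum>l=1..k. real (N l))"
proof -
  show "n = (\<Sum>l=1..k. real (N l))" by (simp add: total_size_def)
  show "0 < n" using large(2) \<delta>_pos by (metis less_le_trans mult_zero_right of_nat_0_less_iff
      zero_less_numeral gr0I of_nat_0 not_le)
qed

text \<open>As there are at least two groups, the complement of one group contains another, whose
  share is at least \<delta>.\<close>

lemma N_complement: "l \<in> {1..k} \<Longrightarrow> \<delta> * n \<le> n - real (N l)" and N_le_n: "l \<in> {1..k} \<Longrightarrow> real (N l) \<le> n"
proof -
  assume l: "l \<in> {1..k}"
  then obtain s where s: "s \<in> {1..k}" "s \<noteq> l"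
    using groups by (metis One_nat_def Suc_1 Suc_le_eq atLeastAtMost_iff le_refl nat_less_le not_less_eq_eq)
  have "(\<Sum>i\<in>{l, s}. real (N i)) \<le> (\<Sum>i=1..k. real (N i))"
    using l s by (intro sum_mono2) auto
  hence "real (N l) + real (N s) \<le> n" using s n_eq by simp
  thus "\<delta> * n \<le> n - real (N l)" using balanced[OF s(1)] by linarith
  thus "real (N l) \<le> n" using \<delta>_pos n_pos by (smt (verit) mult_pos_pos)
qed

lemma card_Obs: "real (card Obs) = n"
  unfolding n_eq obs_set_def by (subst card_SigmaI) auto

lemma loading: "l \<in> {1..k} \<Longrightarrow> \<Gamma> l \<in> carrier_mat p r"
  by (rule loading_dim)

lemma ker_eq: "fst a \<in> {1..k} \<Longrightarrow> fst b \<in> {1..k} \<Longrightarrow> i < r \<Longrightarrow> j < r \<Longrightarrow>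
    F.ker a b i j = load_prod \<Gamma> (fst a) (fst b) $$ (i, j)"
  unfolding F.ker_def by (subst load_prod_index[where p = p and r = r]) (auto intro: loading)

lemma tr_prod_eq:
  assumes "fst a \<in> {1..k}" "fst b \<in> {1..k}"
  shows "F.tr_prod a b = tr2 (fst a) (fst b)"
proof -
  have "F.tr_prod a b = (\<Sum>i<r. \<Sum>j<r. load_prod \<Gamma> (fst a) (fst b) $$ (i, j) ^ 2)"
    unfolding F.tr_prod_def using assms by (simp add: ker_eq)
  also have "\<dots> = tr2 (fst a) (fst b)"
    unfolding tr2_def using assms by (intro sum_load_prod_sq[where p = p and r = r] loading)
  finally show ?thesis .
qed

lemma tr_prod_Obs: "a \<in> Obs \<Longrightarrow> b \<in> Obs \<Longrightarrow> F.tr_prod a b = tr2 (fst a) (fst b)"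
  by (intro tr_prod_eq Obs_fst)

lemma ker_Obs: "a \<in> Obs \<Longrightarrow> b \<in> Obs \<Longrightarrow> i < r \<Longrightarrow> j < r \<Longrightarrow>
    F.ker a b i j = load_prod \<Gamma> (fst a) (fst b) $$ (i, j)"
  by (intro ker_eq Obs_fst)

lemma tr2_nonneg: "l \<in> {1..k} \<Longrightarrow> s \<in> {1..k} \<Longrightarrow> 0 \<le> tr2 l s"
  using tr_prod_eq[of "(l, 1)" "(s, 1)"] F.tr_prod_nonneg[of "(l, 1)" "(s, 1)"] by simp

lemma tr2_pos: "l \<in> {1..k} \<Longrightarrow> 0 < tr2 l l"
  unfolding tr2_def using mat_trace_pop_cov_sq_pos[OF loading pos_def p_pos] by simp

lemma obs_index:
  assumes "l \<in> {1..k}" "i \<in> {1..N l}" "x < p"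
  shows "X \<omega> l i $ x = F.obs (l, i) x \<omega> + \<mu> 1 $ x"
proof -
  have "1 \<in> {1..k}" using groups by simp
  hence \<mu>: "\<mu> l = \<mu> 1" using null assms by blast
  have "dim_vec (\<mu> l) = p" "dim_row (\<Gamma> l) = p" "dim_col (\<Gamma> l) = r"
    using mean_dim[OF assms(1)] loading[OF assms(1)] by auto
  thus ?thesis
    using assms \<mu> by (auto simp: factor_obs_def F.obs_def scalar_prod_def atLeast0LessThan)
qed

lemma obs_dim: "l \<in> {1..k} \<Longrightarrow> dim_vec (X \<omega> l i) = p"
  using mean_dim by (auto simp: factor_obs_def)

lemma T_gram: "T_stat k N p (X \<omega>) = (\<Sum>a\<in>Obs. \<Sum>b\<in>Obs. w a b * F.gram a b \<omega>)"
  unfolding F.gram_def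
proof (rule T_stat_eq[where m = "\<lambda>x. \<mu> 1 $ x"])
  show "2 \<le> N l" if "l \<in> {1..k}" for l using large(1)[OF that] by simp
qed (use groups obs_dim obs_index in auto)

text \<open>Within a group the squared weight has (N_l - 1)^2 in its denominator and there are N_l
  (N_l - 1) ordered pairs, so one factor N_l - 1 remains. The identity gives the rescaled form
  variance one.\<close>

lemma var_T_eq: "var_T = 2 * (\<Sum>a\<in>Obs. \<Sum>b\<in>Obs. w a b ^ 2 * F.tr_prod a b)"
proof -
  define A where "A l = (n - real (N l)) / (n * (real (N l) - 1))" for l
  have "(\<Sum>a\<in>Obs. \<Sum>b\<in>Obs. w a b ^ 2 * F.tr_prod a b) = (\<Sum>a\<in>Obs. \<Sum>b\<in>Obs. w a b ^ 2 * tr2 (fst a) (fst b))"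
    by (intro sum.cong refl) (simp add: tr_prod_Obs)
  also have "\<dots> = (\<Sum>l=1..k. A l ^ 2 * (\<Sum>i=1..N l. \<Sum>j\<in>{1..N l} - {i}. tr2 (fst (l, i)) (fst (l, j))))
    + (\<Sum>l=1..k. \<Sum>s\<in>{1..k} - {l}. (1 / n) ^ 2 * (\<Sum>i=1..N l. \<Sum>j=1..N s. tr2 (fst (l, i)) (fst (s, j))))"
    by (rule sum_pair_weight) (auto simp: pair_weight_def Let_def A_def)
  also have "(\<Sum>l=1..k. A l ^ 2 * (\<Sum>i=1..N l. \<Sum>j\<in>{1..N l} - {i}. tr2 (fst (l, i)) (fst (l, j)))) =
     (\<Sum>l=1..k. real (N l) * (n - real (N l))^2 / (real (N l) - 1) * tr2 l l) / n ^ 2"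
    unfolding sum_divide_distrib
  proof (rule sum.cong[OF refl])
    fix l assume l: "l \<in> {1..k}"
    have N: "real (N l) - 1 > 0" using large(1)[OF l] by simp
    have "(\<Sum>i=1..N l. \<Sum>j\<in>{1..N l} - {i}. tr2 (fst (l, i)) (fst (l, j))) = (\<Sum>i=1..N l. (real (N l) - 1) * tr2
        l l)"
      using large(1)[OF l] by (intro sum.cong refl) (simp add: card_Diff_singleton of_nat_diff)
    also have "\<dots> = real (N l) * (real (N l) - 1) * tr2 l l" by simp
    finally show "A l ^ 2 * (\<Sum>i=1..N l. \<Sum>j\<in>{1..N l} - {i}. tr2 (fst (l, i)) (fst (l, j))) =
      real (N l) * (n - real (N l))^2 / (real (N l) - 1) * tr2 l l / n ^ 2"
      using N n_pos by (simp add: A_def power_divide power_mult_distrib) (simp add: power2_eq_square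
          mult_ac)
  qed
  also have "(\<Sum>l=1..k. \<Sum>s\<in>{1..k} - {l}. (1 / n) ^ 2 * (\<Sum>i=1..N l. \<Sum>j=1..N s. tr2 (fst (l, i)) (fst (s, j))))
      =
     (\<Sum>l=1..k. \<Sum>s\<in>{1..k} - {l}. real (N l) * real (N s) * tr2 l s) / n ^ 2"
    unfolding sum_divide_distrib by (intro sum.cong refl) (simp add: power_divide)
  finally show ?thesis by (simp add: var_T_def add_divide_distrib distrib_left)
qed

definition tr_A2 :: real where
  "tr_A2 = mat_trace (pop_cov_sum k p \<Gamma> * pop_cov_sum k p \<Gamma>)"

lemma tr_A2_eq: "tr_A2 = (\<Sum>l=1..k. \<Sum>s=1..k. tr2 l s)"
  unfolding tr_A2_def tr2_def by (rule mat_trace_pop_cov_sum[OF loading])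

lemma tr_A2_pos: "0 < tr_A2"
proof -
  have "0 < tr2 1 1" using groups by (intro tr2_pos) auto
  also have "\<dots> \<le> (\<Sum>s=1..k. tr2 1 s)"
    using groups tr2_nonneg by (intro member_le_sum[where f = "tr2 1"]) auto
  also have "\<dots> \<le> (\<Sum>l=1..k. \<Sum>s=1..k. tr2 l s)"
    using groups tr2_nonneg by (intro member_le_sum[where f = "\<lambda>l. \<Sum>s=1..k. tr2 l s"]) (auto intro!:
        sum_nonneg)
  finally show ?thesis unfolding tr_A2_eq .
qed

text \<open>Apart from the factor 2 / n^2, every coefficient is at least (\<delta> n)^2, and the
  traces over all pairs of groups add up to tr (A^2).\<close>

lemma var_T_ge: "2 * \<delta> ^ 2 * tr_A2 \<le> var_T"
proof -
  have d: "\<delta> * n > 0" using \<delta>_pos n_pos by simp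
  have 1: "\<delta> ^ 2 * n ^ 2 * tr2 l l \<le> real (N l) * (n - real (N l))^2 / (real (N l) - 1) * tr2 l l" if l: "l
      \<in> {1..k}" for l
  proof (rule mult_right_mono[OF _ tr2_nonneg[OF l l]])
    have N: "real (N l) - 1 > 0" using large(1)[OF l] by simp
    have "\<delta> ^ 2 * n ^ 2 \<le> (n - real (N l)) ^ 2"
      using N_complement[OF l] d by (subst power_mult_distrib[symmetric]) (intro power_mono, auto)
    also have "\<dots> \<le> real (N l) / (real (N l) - 1) * (n - real (N l)) ^ 2"
      using N mult_right_mono[of 1 "real (N l) / (real (N l) - 1)" "(n - real (N l)) ^ 2"] by simp
    finally show "\<delta> ^ 2 * n ^ 2 \<le> real (N l) * (n - real (N l))^2 / (real (N l) - 1)" by simp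
  qed
  have 2: "\<delta> ^ 2 * n ^ 2 * tr2 l s \<le> real (N l) * real (N s) * tr2 l s" if "l \<in> {1..k}" "s \<in> {1..k}" for l s
  proof (rule mult_right_mono[OF _ tr2_nonneg[OF that]])
    have "(\<delta> * n) * (\<delta> * n) \<le> real (N l) * real (N s)"
      using balanced that d by (intro mult_mono) auto
    thus "\<delta> ^ 2 * n ^ 2 \<le> real (N l) * real (N s)" by (simp add: power2_eq_square mult_ac)
  qed
  have "\<delta> ^ 2 * n ^ 2 * tr_A2 = (\<Sum>l=1..k. \<delta> ^ 2 * n ^ 2 * tr2 l l) + (\<Sum>l=1..k. \<Sum>s\<in>{1..k} - {l}. \<delta> ^ 2 * n ^
      2 * tr2 l s)"
    unfolding tr_A2_eq sum_distrib_left sum.distrib[symmetric] by (intro sum.cong refl sum.remove) auto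
  also have "\<dots> \<le> (\<Sum>l=1..k. real (N l) * (n - real (N l))^2 / (real (N l) - 1) * tr2 l l)
              + (\<Sum>l=1..k. \<Sum>s\<in>{1..k} - {l}. real (N l) * real (N s) * tr2 l s)"
    using 1 2 by (intro add_mono sum_mono) auto
  finally have "2 / n ^ 2 * (\<delta> ^ 2 * n ^ 2 * tr_A2) \<le> var_T"
    unfolding var_T_def by (rule mult_left_mono) simp
  thus ?thesis using n_pos by simp
qed

lemma var_T_pos: "0 < var_T"
  using var_T_ge tr_A2_pos \<delta>_pos by (smt (verit) mult_pos_pos zero_less_power)

text \<open>All weights are of order 1/n: within a group by \<delta> n \<le> N_l \<le> 2 (N_l - 1),
  between groups by \<delta> \<le> 1.\<close>

lemma pair_weight_bound:
  assumes "a \<in> Obs" "b \<in> Obs"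
  shows "\<bar>w a b\<bar> \<le> 2 / (\<delta> * n)"
proof -
  have d: "\<delta> * n > 0" using \<delta>_pos n_pos by simp
  have l: "fst a \<in> {1..k}" using assms by (rule_tac Obs_fst)
  have "\<delta> * n \<le> n" using balanced[OF l] N_le_n[OF l] by linarith
  hence 1: "1 / n \<le> 2 / (\<delta> * n)" using d n_pos by (simp add: field_simps)
  have N: "real (N (fst a)) - 1 > 0" "real (N (fst a)) \<le> 2 * (real (N (fst a)) - 1)" using large(1)[OF l] by
      auto
  have "\<bar>(n - real (N (fst a))) / (n * (real (N (fst a)) - 1))\<bar> = (n - real (N (fst a))) / n * (1 / (real (N
      (fst a)) - 1))"
    using N N_le_n[OF l] n_pos by (simp add: abs_mult)
  also have "\<dots> \<le> 1 * (1 / (real (N (fst a)) - 1))"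
    using N n_pos by (intro mult_right_mono) auto
  also have "\<dots> \<le> 2 / real (N (fst a))" using N by (simp add: field_simps)
  also have "\<dots> \<le> 2 / (\<delta> * n)" using balanced[OF l] d by (intro divide_left_mono) auto
  finally have 2: "\<bar>(n - real (N (fst a))) / (n * (real (N (fst a)) - 1))\<bar> \<le> 2 / (\<delta> * n)" .
  show ?thesis using 1 2 d n_pos by (auto simp: pair_weight_def Let_def)
qed

definition tr4_sum :: real where
  "tr4_sum = (\<Sum>l=1..k. \<Sum>s=1..k. \<Sum>i=1..k. \<Sum>j=1..k. \<bar>tr4 l s i j\<bar>)"

lemma tr4_le_sum:
  assumes "l \<in> {1..k}" "s \<in> {1..k}" "i \<in> {1..k}" "j \<in> {1..k}"
  shows "\<bar>tr4 l s i j\<bar> \<le> tr4_sum"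
proof -
  have "\<bar>tr4 l s i j\<bar> \<le> (\<Sum>j=1..k. \<bar>tr4 l s i j\<bar>)"
    using assms by (intro member_le_sum[where f = "\<lambda>j. \<bar>tr4 l s i j\<bar>"]) auto
  also have "\<dots> \<le> (\<Sum>i=1..k. \<Sum>j=1..k. \<bar>tr4 l s i j\<bar>)"
    using assms by (intro member_le_sum[where f = "\<lambda>i. \<Sum>j=1..k. \<bar>tr4 l s i j\<bar>"]) (auto intro!: sum_nonneg)
  also have "\<dots> \<le> (\<Sum>s=1..k. \<Sum>i=1..k. \<Sum>j=1..k. \<bar>tr4 l s i j\<bar>)"
    using assms by (intro member_le_sum[where f = "\<lambda>s. \<Sum>i=1..k. \<Sum>j=1..k. \<bar>tr4 l s i j\<bar>"]) (auto intro!: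
        sum_nonneg)
  also have "\<dots> \<le> tr4_sum"
    unfolding tr4_sum_def
    using assms by (intro member_le_sum[where f = "\<lambda>l. \<Sum>s=1..k. \<Sum>i=1..k. \<Sum>j=1..k. \<bar>tr4 l s i j\<bar>"]) (auto
        intro!: sum_nonneg)
  finally show ?thesis .
qed

text \<open>Squaring an entry of W^2 produces two intermediate observations. With the two end points
  this makes n^4 cycles, each contributing at most \<open>c ^ 4 * tr4_sum\<close>.\<close>

lemma squared_kernel_bound:
  assumes c: "\<And>a b. a \<in> Obs \<Longrightarrow> b \<in> Obs \<Longrightarrow> \<bar>u a b\<bar> \<le> c" and c0: "0 \<le> c"
  defines "W \<equiv> \<lambda>i k. u (fst i) (fst k) * F.ker (fst i) (fst k) (snd i) (snd k)"
  shows "(\<Sum>i\<in>Obs \<times> {..<r}. \<Sum>k\<in>Obs \<times> {..<r}. (\<Sum>h\<in>Obs \<times> {..<r}. W i h * W h k) ^ 2) \<le> (c * n) ^ 4 * tr4_sum"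
proof -
  have Wsum: "(\<Sum>h\<in>Obs \<times> {..<r}. W (a, i) h * W h (d, j)) =
     (\<Sum>b\<in>Obs. u a b * u b d * load_cycle \<Gamma> (fst a) (fst b) (fst d) $$ (i, j))"
    if "a \<in> Obs" "d \<in> Obs" "i < r" "j < r" for a d i j
  proof -
    have "(\<Sum>h\<in>Obs \<times> {..<r}. W (a, i) h * W h (d, j)) =
       (\<Sum>b\<in>Obs. \<Sum>h<r. u a b * F.ker a b i h * (u b d * F.ker b d h j))"
      by (simp add: sum.cartesian_product' W_def)
    also have "\<dots> = (\<Sum>b\<in>Obs. u a b * u b d * (\<Sum>h<r. load_prod \<Gamma> (fst a) (fst b) $$ (i, h) * load_prod \<Gamma> (fst
        b) (fst d) $$ (h, j)))"
      using that by (intro sum.cong refl) (simp add: sum_distrib_left ker_Obs mult_ac)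
    also have "\<dots> = (\<Sum>b\<in>Obs. u a b * u b d * load_cycle \<Gamma> (fst a) (fst b) (fst d) $$ (i, j))"
      using that Obs_fst by (intro sum.cong refl arg_cong2[where f = "(*)"] load_cycle_index[symmetric,
          where p = p and r = r] loading)
    finally show ?thesis .
  qed
  define L where "L a b d = load_cycle \<Gamma> (fst a) (fst b) (fst d)" for a b d :: "nat \<times> nat"
  have "(\<Sum>i\<in>Obs \<times> {..<r}. \<Sum>k\<in>Obs \<times> {..<r}. (\<Sum>h\<in>Obs \<times> {..<r}. W i h * W h k) ^ 2) =
     (\<Sum>a\<in>Obs. \<Sum>i<r. \<Sum>d\<in>Obs. \<Sum>j<r. (\<Sum>h\<in>Obs \<times> {..<r}. W (a, i) h * W h (d, j)) ^ 2)"
    by (simp only: sum.cartesian_product')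
  also have "\<dots> = (\<Sum>a\<in>Obs. \<Sum>i<r. \<Sum>d\<in>Obs. \<Sum>j<r. (\<Sum>b\<in>Obs. u a b * u b d * L a b d $$ (i, j)) ^ 2)"
    by (intro sum.cong refl) (simp add: Wsum L_def)
  also have "\<dots> = (\<Sum>a\<in>Obs. \<Sum>d\<in>Obs. \<Sum>i<r. \<Sum>j<r. (\<Sum>b\<in>Obs. u a b * u b d * L a b d $$ (i, j)) ^ 2)"
    by (intro sum.cong refl sum.swap)
  also have "\<dots> \<le> (\<Sum>a\<in>Obs. \<Sum>d\<in>Obs. \<Sum>b\<in>Obs. \<Sum>b'\<in>Obs. c ^ 4 * tr4_sum)"
  proof (intro sum_mono)
    fix a d assume ad: "a \<in> Obs" "d \<in> Obs"
    have "(\<Sum>i<r. \<Sum>j<r. (\<Sum>b\<in>Obs. u a b * u b d * L a b d $$ (i, j)) ^ 2) =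
       (\<Sum>i<r. \<Sum>j<r. \<Sum>b\<in>Obs. \<Sum>b'\<in>Obs. (u a b * u b d) * (u a b' * u b' d) * (L a b d $$ (i, j) * L a b' d $$
           (i, j)))"
      unfolding power2_eq_square sum_product by (simp add: mult_ac)
    also have "\<dots> = (\<Sum>b\<in>Obs. \<Sum>b'\<in>Obs. \<Sum>i<r. \<Sum>j<r. (u a b * u b d) * (u a b' * u b' d) * (L a b d $$ (i, j) *
        L a b' d $$ (i, j)))"
      by (rule sum_swap_blocks)
    also have "\<dots> = (\<Sum>b\<in>Obs. \<Sum>b'\<in>Obs. (u a b * u b d) * (u a b' * u b' d) * tr4 (fst b) (fst d) (fst b') (fst
        a))"
      unfolding sum_distrib_left[symmetric] L_def tr4_def using ad Obs_fst
      by (intro sum.cong refl arg_cong2[where f = "(*)"] sum_load_cycle[where p = p and r = r] loading)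
    also have "\<dots> \<le> (\<Sum>b\<in>Obs. \<Sum>b'\<in>Obs. c ^ 4 * tr4_sum)"
    proof (intro sum_mono)
      fix b b' assume bb: "b \<in> Obs" "b' \<in> Obs"
      have "\<bar>(u a b * u b d) * (u a b' * u b' d) * tr4 (fst b) (fst d) (fst b') (fst a)\<bar> \<le> ((c * c) * (c *
          c)) * tr4_sum"
        unfolding abs_mult using ad bb c c0 Obs_fst
        by (intro mult_mono tr4_le_sum) auto
      thus "(u a b * u b d) * (u a b' * u b' d) * tr4 (fst b) (fst d) (fst b') (fst a) \<le> c ^ 4 * tr4_sum"
        by (simp add: power4_eq_xxxx mult.assoc)
    qed
    finally show "(\<Sum>i<r. \<Sum>j<r. (\<Sum>b\<in>Obs. u a b * u b d * L a b d $$ (i, j)) ^ 2) \<le> (\<Sum>b\<in>Obs. \<Sum>b'\<in>Obs. c ^ 4 *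
        tr4_sum)" .
  qed
  also have "\<dots> = (c * n) ^ 4 * tr4_sum"
    by (simp add: card_Obs power4_eq_xxxx mult_ac)
  finally show ?thesis .
qed

lemma T_measurable: "(\<lambda>\<omega>. T_stat k N p (X \<omega>)) \<in> borel_measurable M"
  unfolding T_gram using F.gram_measurable by auto

theorem T_char_bound:
  defines "D \<equiv> 4 / \<delta> ^ 8 * (tr4_sum / tr_A2 ^ 2)"
  shows "norm ((CLINT \<omega>|M. iexp (t * (T_stat k N p (X \<omega>) / sqrt var_T))) - of_real (exp (- (t ^ 2) / 2)))
    \<le> \<bar>t\<bar> * (6 * K0 ^ 2 * t ^ 2 * sqrt (sqrt D) + 2 * \<bar>t\<bar> * sqrt ((2 + K0) * D))"
proof -
  define s where "s = sqrt var_T"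
  have s: "0 < s" "s ^ 2 = var_T" using var_T_pos by (auto simp: s_def)
  define u where "u a b = w a b / s" for a b
  define W where "W i k = u (fst i) (fst k) * F.ker (fst i) (fst k) (snd i) (snd k)" for i k
  let ?J = "Obs \<times> {..<r}"
  define D' where "D' = (\<Sum>i\<in>?J. \<Sum>k\<in>?J. (\<Sum>h\<in>?J. W i h * W h k) ^ 2)"
  have q: "F.quad W ?J \<omega> = T_stat k N p (X \<omega>) / s" for \<omega>
    unfolding T_gram sum_divide_distrib W_def F.gram_sum_eq[symmetric] by (simp add: u_def)
  have "norm ((CLINT \<omega>|M. iexp (t * F.quad W ?J \<omega>)) - of_real (exp (- (t ^ 2) / 2)))
    \<le> \<bar>t\<bar> * (6 * K0 ^ 2 * t ^ 2 * sqrt (sqrt D') + 2 * \<bar>t\<bar> * sqrt ((2 + K0) * D'))"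
    unfolding D'_def
  proof (rule F.quad_char_bound)
    show "W i j = W j i" for i j
      by (simp add: W_def u_def F.ker_def pair_weight_def Let_def mult.commute eq_commute[of "fst i" "fst
          j"])
    show "W i i = 0" for i by (simp add: W_def u_def pair_weight_def)
    have "(\<Sum>i\<in>?J. \<Sum>j\<in>?J. W i j ^ 2) = (\<Sum>a\<in>Obs. \<Sum>b\<in>Obs. w a b ^ 2 * F.tr_prod a b) / s ^ 2"
      unfolding W_def F.sum_tr_prod by (simp add: u_def power_divide sum_divide_distrib)
    thus "2 * (\<Sum>i\<in>?J. \<Sum>j\<in>?J. W i j ^ 2) = 1"
      using s var_T_pos var_T_eq by (simp only: s(2)) simp
  qed
  also have "\<dots> \<le> \<bar>t\<bar> * (6 * K0 ^ 2 * t ^ 2 * sqrt (sqrt D) + 2 * \<bar>t\<bar> * sqrt ((2 + K0) * D))"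
  proof -
    define c where "c = 2 / (\<delta> * n) / s"
    have c0: "0 \<le> c" using \<delta>_pos n_pos s by (simp add: c_def)
    have tr4: "0 \<le> tr4_sum" by (auto simp: tr4_sum_def intro!: sum_nonneg)
    have "D' \<le> (c * n) ^ 4 * tr4_sum"
      unfolding D'_def W_def
    proof (rule squared_kernel_bound[OF _ c0])
      fix a b assume "a \<in> Obs" "b \<in> Obs"
      from divide_right_mono[OF pair_weight_bound[OF this], of s] s(1)
      show "\<bar>u a b\<bar> \<le> c" by (simp add: u_def c_def abs_divide)
    qed
    \<comment> \<open>The sample size cancels here. With the lower bound of \<open>var_T\<close> the
      constant becomes 16 / (\<delta>^4 (2 \<delta>^2)^2) = 4 / \<delta>^8.\<close>
    also have "c * n = 2 / \<delta> / s" using n_pos by (simp add: c_def)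
    also have "(2 / \<delta> / s) ^ 4 = 16 / \<delta> ^ 4 / var_T ^ 2"
      unfolding s(2)[symmetric] by (simp add: power_divide power_mult_distrib flip: power_mult)
    also have "\<dots> \<le> 16 / \<delta> ^ 4 / (2 * \<delta> ^ 2 * tr_A2) ^ 2"
      using var_T_ge var_T_pos tr_A2_pos \<delta>_pos by (intro divide_left_mono power_mono mult_pos_pos
          zero_less_power) auto
    also have "\<dots> = 4 / \<delta> ^ 8 / tr_A2 ^ 2"
      by (simp add: power_mult_distrib flip: power_mult power_add)
    finally have DD: "D' \<le> D" using tr4 by (simp add: D_def mult_right_mono)
    have K: "0 \<le> 2 + K0" using F.K_ge_1 by simp
    show ?thesis
      using DD K by (intro mult_left_mono add_mono real_sqrt_le_mono) auto
  qed
  finally show ?thesis unfolding q s_def .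
qed

end

section \<open>Ratio consistency of the variance estimators\<close>

text \<open>The relative form of \<open>rate\<close>, by (a + b) / (a b) = 1/a + 1/b. The factor 4
  allows a denominator that is only known to be at least a b / 4, and \<open>C + 1\<close> leaves
  room for the mismatch between that denominator and the number of pairs.\<close>

definition dev_rate :: "real \<Rightarrow> real \<Rightarrow> real \<Rightarrow> real" where
  "dev_rate C a b = 4 * (C + 1) * (1 / a + 1 / b) + 4 * C * sqrt (1 / a + 1 / b)"

lemma dev_rate_mono:
  assumes "0 \<le> C" "0 < h" "h \<le> a" "h \<le> b"
  shows "dev_rate C a b \<le> dev_rate C h h"
proof -
  have "1 / a + 1 / b \<le> 1 / h + 1 / h"
    using assms by (intro add_mono divide_left_mono) auto
  note y = this real_sqrt_le_mono[OF this]
  show ?thesis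
    unfolding dev_rate_def
    by (rule add_mono[OF mult_left_mono[OF y(1)] mult_left_mono[OF y(2)]]) (use assms in auto)
qed

lemma dev_rate_ge:
  assumes C: "0 \<le> C" and a: "0 < a" and b: "0 < b" and d: "a * b / 4 \<le> d"
  shows "(C * (a + b + sqrt (a * b * (a + b))) + (a + b)) / d \<le> dev_rate C a b"
proof -
  define y where "y = 1 / a + 1 / b"
  have y: "a + b = a * b * y" "0 \<le> y" using a b by (auto simp: y_def field_simps)
  have ab: "0 < a * b" using a b by simp
  have "sqrt (a * b * (a + b)) = sqrt ((a * b) ^ 2 * y)"
    using y by (simp add: power2_eq_square mult.assoc)
  also have "\<dots> = a * b * sqrt y" using ab by (simp add: real_sqrt_mult)
  finally have s: "sqrt (a * b * (a + b)) = a * b * sqrt y" .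
  have "(C * (a + b + sqrt (a * b * (a + b))) + (a + b)) / d \<le> (C * (a + b + sqrt (a * b * (a + b))) + (a +
      b)) / (a * b / 4)"
  proof (rule divide_left_mono[OF d])
    have "0 < d" using ab d by linarith
    thus "0 < d * (a * b / 4)" using a b by simp
  qed (use C a b in auto)
  also have "\<dots> = (C * (a * b * y + a * b * sqrt y) + a * b * y) / (a * b / 4)"
    unfolding s using y(1) by simp
  also have "\<dots> = 4 * (C + 1) * y + 4 * C * sqrt y"
  proof -
    have "C * (a * b * y + a * b * sqrt y) + a * b * y = (4 * (C + 1) * y + 4 * C * sqrt y) * (a * b / 4)"
      by (simp add: algebra_simps)
    thus ?thesis using a b by simp
  qed
  finally show ?thesis by (simp add: dev_rate_def y_def)
qed

context factor_null
begin

text \<open>The sum \<open>Y\<close> has the scale of its number \<open>e\<close> of pairs, while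
  the estimator divides by a normalization \<open>d\<close> of its own; the mismatch costs at most
  \<open>S\<close>.\<close>

lemma ratio_deviation:
  fixes Y :: "'a \<Rightarrow> real"
  assumes Y: "integrable M Y" "expectation (\<lambda>\<omega>. \<bar>Y \<omega> - c * e\<bar>) \<le> c * R"
    and c: "0 \<le> c" and d: "0 < d" and de: "\<bar>e - d\<bar> \<le> S"
  shows "expectation (\<lambda>\<omega>. \<bar>Y \<omega> / d - c\<bar>) \<le> c * ((R + S) / d)"
proof -
  have "expectation (\<lambda>\<omega>. \<bar>Y \<omega> / d - c\<bar>) \<le> expectation (\<lambda>\<omega>. (\<bar>Y \<omega> - c * e\<bar> + c * S) / d)"
  proof (rule integral_mono)
    fix \<omega>
    have "\<bar>Y \<omega> - c * d\<bar> \<le> \<bar>Y \<omega> - c * e\<bar> + \<bar>c * (e - d)\<bar>"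
      by (simp add: right_diff_distrib)
    also have "\<bar>c * (e - d)\<bar> \<le> c * S" using c de by (simp add: abs_mult mult_left_mono)
    finally have "\<bar>Y \<omega> - c * d\<bar> / d \<le> (\<bar>Y \<omega> - c * e\<bar> + c * S) / d"
      using d by (intro divide_right_mono) auto
    moreover have "\<bar>Y \<omega> / d - c\<bar> = \<bar>Y \<omega> - c * d\<bar> / d"
      using d by (simp add: field_simps abs_div_pos[symmetric])
    ultimately show "\<bar>Y \<omega> / d - c\<bar> \<le> (\<bar>Y \<omega> - c * e\<bar> + c * S) / d" by simp
  qed (use Y in auto)
  also have "\<dots> = (expectation (\<lambda>\<omega>. \<bar>Y \<omega> - c * e\<bar>) + c * S) / d"
    using Y by (simp add: prob_space)
  also have "\<dots> \<le> (c * R + c * S) / d"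
    using Y d by (intro divide_right_mono add_mono) auto
  finally show ?thesis by (simp add: distrib_left)
qed

lemma cross_estimate:
  assumes l: "l \<in> {1..k}" and s: "s \<in> {1..k}" and I: "I \<subseteq> {1..N l}" and I': "I' \<subseteq> {1..N s}"
    and dis: "l \<noteq> s \<or> I \<inter> I' = {}" and card: "2 \<le> card I" "2 \<le> card I'"
  defines "Q \<equiv> \<lambda>\<omega>. mat_trace (sample_cov p I (X \<omega> l) * sample_cov p I' (X \<omega> s))"
  shows "integrable M Q \<and> expectation (\<lambda>\<omega>. \<bar>Q \<omega> - tr2 l s\<bar>) \<le> dev_rate F.C5 (card I) (card I') * tr2 l s"
proof -
  have fin: "finite I" "finite I'" using I I' by (auto intro: finite_subset)
  have ne: "I \<noteq> {}" "I' \<noteq> {}" using card by auto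
  define m m' where "m = real (card I)" and "m' = real (card I')"
  have m: "2 \<le> m" "2 \<le> m'" using card by (auto simp: m_def m'_def)
  define Y where "Y \<omega> = (\<Sum>a\<in>Pair l ` I. \<Sum>b\<in>Pair s ` I'. dcen (Pair l ` I) (Pair s ` I') (\<lambda>a b. F.gram a b \<omega>)
      a b ^ 2)" for \<omega>
  define d where "d = (m - 1) * (m' - 1)"
  have d0: "0 < d" using m by (simp add: d_def)
  have inj: "inj_on (Pair l) I" "inj_on (Pair s) I'" by (auto simp: inj_on_def)
  have Q: "Q \<omega> = Y \<omega> / d" for \<omega>
  proof -
    have "Q \<omega> = (\<Sum>a\<in>I. \<Sum>b\<in>I'. dcen I I' (\<lambda>a b. \<Sum>x<p. F.obs (l, a) x \<omega> * F.obs (s, b) x \<omega>) a b ^ 2) / ((real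
        (card I) - 1) * (real (card I') - 1))"
      unfolding Q_def using fin ne I I' l s
      by (intro mat_trace_sample_cov_mult[where m = "\<lambda>x. \<mu> 1 $ x" and m' = "\<lambda>x. \<mu> 1 $ x"] obs_index) auto
    also have "(\<Sum>a\<in>I. \<Sum>b\<in>I'. dcen I I' (\<lambda>a b. \<Sum>x<p. F.obs (l, a) x \<omega> * F.obs (s, b) x \<omega>) a b ^ 2) = Y \<omega>"
      unfolding Y_def by (simp add: sum.reindex inj dcen_image F.gram_def)
    finally show ?thesis by (simp add: d_def m_def m'_def)
  qed
  have tp: "F.tr_prod a b = tr2 l s" if "a \<in> Pair l ` I" "b \<in> Pair s ` I'" for a b
    using tr_prod_eq[of a b] that l s by auto
  have O: "Pair l ` I \<subseteq> Obs" "Pair s ` I' \<subseteq> Obs" "Pair l ` I \<inter> Pair s ` I' = {}"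
    "Pair l ` I \<noteq> {}" "Pair s ` I' \<noteq> {}"
    using I I' l s dis ne by (auto simp: obs_set_def)
  have cc: "real (card (Pair l ` I)) = m" "real (card (Pair s ` I')) = m'"
    by (simp_all add: card_image inj m_def m'_def)
  have "integrable M Y \<and> expectation (\<lambda>\<omega>. \<bar>Y \<omega> - tr2 l s * (m * m')\<bar>) \<le> tr2 l s * F.rate m m'"
    using F.cross_trace_deviation[OF O(1,2,3) tp O(4,5)]
    unfolding cc Y_def[abs_def] .
  hence Y: "integrable M Y" "expectation (\<lambda>\<omega>. \<bar>Y \<omega> - tr2 l s * (m * m')\<bar>) \<le> tr2 l s * F.rate m m'"
    by auto
  have "expectation (\<lambda>\<omega>. \<bar>Y \<omega> / d - tr2 l s\<bar>) \<le> tr2 l s * ((F.rate m m' + (m + m')) / d)"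
    using m by (intro ratio_deviation[OF Y tr2_nonneg[OF l s] d0]) (simp add: d_def algebra_simps)
  also have "(F.rate m m' + (m + m')) / d \<le> dev_rate F.C5 m m'"
    unfolding F.rate_def
  proof (rule dev_rate_ge)
    have "(m / 2) * (m' / 2) \<le> d" unfolding d_def using m by (intro mult_mono) auto
    thus "m * m' / 4 \<le> d" by simp
  qed (use m F.C5_pos in auto)
  finally have "expectation (\<lambda>\<omega>. \<bar>Y \<omega> / d - tr2 l s\<bar>) \<le> dev_rate F.C5 m m' * tr2 l s"
    using tr2_nonneg[OF l s] by (simp add: mult.commute mult_right_mono)
  thus ?thesis using Y(1) unfolding Q m_def m'_def by simp
qed

lemma self_estimate:
  assumes l: "l \<in> {1..k}"
  shows "integrable M (\<lambda>\<omega>. tr_sq_tilde N p (X \<omega>) l) \<and>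
    expectation (\<lambda>\<omega>. \<bar>tr_sq_tilde N p (X \<omega>) l - tr2 l l\<bar>) \<le> 2 * dev_rate F.C5 (N l) (N l) * tr2 l l"
proof -
  define I where "I = {1..N l}"
  define m where "m = real (N l)"
  have m: "6 \<le> m" using large(1)[OF l] by (simp add: m_def)
  have cI: "card I = N l" and fin: "finite I" and ne: "I \<noteq> {}" using large(1)[OF l] by (auto simp: I_def)
  define Z where "Z \<omega> = (\<Sum>a\<in>Pair l ` I. dcen (Pair l ` I) (Pair l ` I) (\<lambda>a b. F.gram a b \<omega>) a a)" for \<omega>
  define Y where "Y \<omega> = (\<Sum>a\<in>Pair l ` I. \<Sum>b\<in>Pair l ` I. dcen (Pair l ` I) (Pair l ` I) (\<lambda>a b. F.gram a b \<omega>) a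
      b ^ 2)
    - Z \<omega> ^ 2 / (m - 1)" for \<omega>
  \<comment> \<open>The prefactor of the estimator replaces the denominator (m - 1)^2 by
    \<open>d\<close>, which differs from the number m (m - 1) of pairs by exactly 2.\<close>
  define d where "d = (m + 1) * (m - 2)"
  have d0: "0 < d" using m by (simp add: d_def)
  have inj: "inj_on (Pair l) I" by (auto simp: inj_on_def)
  have Q: "tr_sq_tilde N p (X \<omega>) l = Y \<omega> / d" for \<omega>
  proof -
    let ?S = "sample_cov p I (X \<omega> l)"
    have "mat_trace (?S * ?S) = (\<Sum>a\<in>I. \<Sum>b\<in>I. dcen I I (\<lambda>a b. \<Sum>x<p. F.obs (l, a) x \<omega> * F.obs (l, b) x \<omega>) a b
        ^ 2) / ((real (card I) - 1) * (real (card I) - 1))"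
      using fin ne l
      by (intro mat_trace_sample_cov_mult[where m = "\<lambda>x. \<mu> 1 $ x" and m' = "\<lambda>x. \<mu> 1 $ x"] obs_index) (auto
          simp: I_def)
    also have "(\<Sum>a\<in>I. \<Sum>b\<in>I. dcen I I (\<lambda>a b. \<Sum>x<p. F.obs (l, a) x \<omega> * F.obs (l, b) x \<omega>) a b ^ 2) = Y \<omega> + Z \<omega>
        ^ 2 / (m - 1)"
      unfolding Y_def by (simp add: sum.reindex inj dcen_image F.gram_def)
    finally have 1: "mat_trace (?S * ?S) = (Y \<omega> + Z \<omega> ^ 2 / (m - 1)) / (m - 1) ^ 2"
      by (simp add: cI m_def power2_eq_square)
    have "mat_trace ?S = (\<Sum>a\<in>I. dcen I I (\<lambda>a b. \<Sum>x<p. F.obs (l, a) x \<omega> * F.obs (l, b) x \<omega>) a a) / (real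
        (card I) - 1)"
      using fin ne l by (intro mat_trace_sample_cov[where m = "\<lambda>x. \<mu> 1 $ x"] obs_index) (auto simp: I_def)
    also have "(\<Sum>a\<in>I. dcen I I (\<lambda>a b. \<Sum>x<p. F.obs (l, a) x \<omega> * F.obs (l, b) x \<omega>) a a) = Z \<omega>"
      unfolding Z_def by (simp add: sum.reindex inj dcen_image F.gram_def)
    finally have 2: "mat_trace ?S = Z \<omega> / (m - 1)" by (simp add: cI m_def)
    have "tr_sq_tilde N p (X \<omega>) l = (m - 1) ^ 2 / d * (mat_trace (?S * ?S) - 1 / (m - 1) * mat_trace ?S ^
        2)"
      by (simp add: tr_sq_tilde_def Let_def m_def d_def I_def)
    also have "mat_trace (?S * ?S) - 1 / (m - 1) * mat_trace ?S ^ 2 = Y \<omega> / (m - 1) ^ 2"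
      unfolding 1 2 by (simp add: add_divide_distrib power_divide)
    also have "(m - 1) ^ 2 / d * (Y \<omega> / (m - 1) ^ 2) = Y \<omega> / d"
      using m by simp
    finally show ?thesis .
  qed
  have tr1: "F.tr_one (l, a) = F.tr_one (l, 1)" for a
    by (simp add: F.tr_one_def F.ker_def)
  have O: "Pair l ` I \<subseteq> Obs" using l by (auto simp: obs_set_def I_def)
  have tp: "F.tr_prod a b = tr2 l l" if "a \<in> Pair l ` I" "b \<in> Pair l ` I" for a b
    using tr_prod_eq[of a b] that l by auto
  have t1: "F.tr_one a = F.tr_one (l, 1)" if "a \<in> Pair l ` I" for a
    using that tr1 by auto
  have cc: "card (Pair l ` I) = N l" by (simp add: card_image inj cI)
  have c2: "2 \<le> card (Pair l ` I)" unfolding cc using large(1)[OF l] by simp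
  have "integrable M Y \<and> expectation (\<lambda>\<omega>. \<bar>Y \<omega> - tr2 l l * (m * (m - 1))\<bar>) \<le> tr2 l l * (2 * F.rate m m)"
    using F.self_trace_deviation[OF O tp t1 c2]
    unfolding cc m_def[symmetric] Y_def[abs_def] Z_def[abs_def] .
  hence Y: "integrable M Y" "expectation (\<lambda>\<omega>. \<bar>Y \<omega> - tr2 l l * (m * (m - 1))\<bar>) \<le> tr2 l l * (2 * F.rate m m)"
    by auto
  \<comment> \<open>The mismatch 2 is bounded generously by 2 (m + m), so that a common factor 2 can
    be taken out.\<close>
  have "expectation (\<lambda>\<omega>. \<bar>Y \<omega> / d - tr2 l l\<bar>) \<le> tr2 l l * ((2 * F.rate m m + 2 * (m + m)) / d)"
    using m by (intro ratio_deviation[OF Y tr2_nonneg[OF l l] d0]) (simp add: d_def algebra_simps)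
  also have "(2 * F.rate m m + 2 * (m + m)) / d = 2 * ((F.rate m m + (m + m)) / d)"
    by (simp add: add_divide_distrib)
  also have "tr2 l l * \<dots> \<le> tr2 l l * (2 * dev_rate F.C5 m m)"
  proof (intro mult_left_mono[OF _ tr2_nonneg[OF l l]] mult_left_mono)
    show "(F.rate m m + (m + m)) / d \<le> dev_rate F.C5 m m"
      unfolding F.rate_def
    proof (rule dev_rate_ge)
      have "6 * m \<le> m * m" using m by (intro mult_right_mono) auto
      moreover have "d = m * m - m - 2" by (simp add: d_def algebra_simps)
      ultimately show "m * m / 4 \<le> d" using m by linarith
    qed (use m F.C5_pos in auto)
  qed simp
  finally have "expectation (\<lambda>\<omega>. \<bar>Y \<omega> / d - tr2 l l\<bar>) \<le> 2 * dev_rate F.C5 m m * tr2 l l"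
    by (simp add: mult_ac)
  thus ?thesis using Y(1) unfolding Q m_def by simp
qed

text \<open>The factor 2 accommodates the estimator built from a whole group; \<delta> n / 4 is a
  lower bound for all sample sizes involved, those of split groups included.\<close>

definition est_rate :: real where
  "est_rate = 2 * dev_rate F.C5 (\<delta> * n / 4) (\<delta> * n / 4)"

lemma dev_rate_le_est_rate:
  assumes "\<delta> * n / 4 \<le> a" "\<delta> * n / 4 \<le> b"
  shows "2 * dev_rate F.C5 a b \<le> est_rate" "dev_rate F.C5 a b \<le> est_rate"
proof -
  have h: "0 < \<delta> * n / 4" using \<delta>_pos n_pos by simp
  show 1: "2 * dev_rate F.C5 a b \<le> est_rate"
    unfolding est_rate_def using dev_rate_mono[OF _ h assms] F.C5_pos by simp
  have "0 \<le> dev_rate F.C5 a b"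
    using h assms F.C5_pos by (auto simp: dev_rate_def intro!: add_nonneg_nonneg mult_nonneg_nonneg)
  with 1 show "dev_rate F.C5 a b \<le> est_rate" by linarith
qed

lemma size_ge: "l \<in> {1..k} \<Longrightarrow> \<delta> * n / 4 \<le> real (N l)"
proof -
  assume "l \<in> {1..k}"
  moreover have "0 < \<delta> * n" using \<delta>_pos n_pos by simp
  ultimately show ?thesis using balanced[of l] by linarith
qed

lemma tilde_estimate:
  assumes l: "l \<in> {1..k}"
  shows "integrable M (\<lambda>\<omega>. tr_sq_tilde N p (X \<omega>) l) \<and>
    expectation (\<lambda>\<omega>. \<bar>tr_sq_tilde N p (X \<omega>) l - tr2 l l\<bar>) \<le> est_rate * tr2 l l"
  using self_estimate[OF l] mult_right_mono[OF dev_rate_le_est_rate(1)[OF size_ge[OF l] size_ge[OF l]]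
      tr2_nonneg[OF l l]]
  by linarith

lemma hat_estimate:
  assumes l: "l \<in> {1..k}"
  shows "integrable M (\<lambda>\<omega>. tr_sq_hat N p (X \<omega>) l) \<and>
    expectation (\<lambda>\<omega>. \<bar>tr_sq_hat N p (X \<omega>) l - tr2 l l\<bar>) \<le> est_rate * tr2 l l"
proof -
  define n1 where "n1 = N l div 2 + 1"
  let ?I = "{1..n1}" and ?I' = "{n1 + 1..N l}"
  have N6: "6 \<le> N l" by (rule large(1)[OF l])
  have c: "card ?I = n1" "card ?I' = N l - n1" "n1 \<le> N l" using N6 by (auto simp: n1_def)
  have "N l \<le> 2 * n1" "N l \<le> 2 * (N l - n1) + 2" using N6 by (auto simp: n1_def)
  hence "real (N l) \<le> 2 * real n1" "real (N l) \<le> 2 * real (N l - n1) + 2" by linarith+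
  \<comment> \<open>The second part has at least N_l / 2 - 1 observations, hence at least \<delta> n
    / 4 because \<delta> n \<ge> 4.\<close>
  hence h: "\<delta> * n / 4 \<le> real (card ?I)" "\<delta> * n / 4 \<le> real (card ?I')"
    using balanced[OF l] large(2) unfolding c by linarith+
  have "integrable M (\<lambda>\<omega>. mat_trace (sample_cov p ?I (X \<omega> l) * sample_cov p ?I' (X \<omega> l))) \<and>
     expectation (\<lambda>\<omega>. \<bar>mat_trace (sample_cov p ?I (X \<omega> l) * sample_cov p ?I' (X \<omega> l)) - tr2 l l\<bar>) \<le> dev_rate
         F.C5 (card ?I) (card ?I') * tr2 l l"
    by (rule cross_estimate[OF l l]) (use N6 in \<open>auto simp: n1_def\<close>)
  thus ?thesis
    using mult_right_mono[OF dev_rate_le_est_rate(2)[OF h] tr2_nonneg[OF l l]]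
    unfolding tr_sq_hat_def Let_def n1_def[symmetric] by linarith
qed

lemma cross_hat_estimate:
  assumes l: "l \<in> {1..k}" and s: "s \<in> {1..k}" "l \<noteq> s"
  shows "integrable M (\<lambda>\<omega>. tr_cross_hat N p (X \<omega>) l s) \<and>
    expectation (\<lambda>\<omega>. \<bar>tr_cross_hat N p (X \<omega>) l s - tr2 l s\<bar>) \<le> est_rate * tr2 l s"
proof -
  have "integrable M (\<lambda>\<omega>. tr_cross_hat N p (X \<omega>) l s) \<and>
     expectation (\<lambda>\<omega>. \<bar>tr_cross_hat N p (X \<omega>) l s - tr2 l s\<bar>) \<le> dev_rate F.C5 (card {1..N l}) (card {1..N
         s}) * tr2 l s"
    unfolding tr_cross_hat_def
    by (rule cross_estimate[OF l s(1)]) (use large(1)[OF l] large(1)[OF s(1)] s in auto)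
  thus ?thesis
    using mult_right_mono[OF dev_rate_le_est_rate(2)[OF size_ge[OF l] size_ge[OF s(1)]] tr2_nonneg[OF l
        s(1)]]
    by (simp only: card_atLeastAtMost) simp
qed

text \<open>All coefficients are nonnegative, so a relative accuracy shared by the trace estimates
  is inherited by their combination. \<open>q\<close> stays abstract in order to treat both variance
  estimators at once.\<close>

lemma var_est_deviation:
  fixes q :: "'a \<Rightarrow> nat \<Rightarrow> real"
  assumes q: "\<And>l. l \<in> {1..k} \<Longrightarrow> integrable M (\<lambda>\<omega>. q \<omega> l) \<and> expectation (\<lambda>\<omega>. \<bar>q \<omega> l - tr2 l l\<bar>) \<le> est_rate *
      tr2 l l"
  defines "V \<equiv> \<lambda>\<omega>. var_est k N p (X \<omega>) (q \<omega>)"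
  shows "integrable M V" and "expectation (\<lambda>\<omega>. \<bar>V \<omega> - var_T\<bar>) \<le> est_rate * var_T"
proof -
  define A where "A l = real (N l) * (n - real (N l))^2 / (real (N l) - 1)" for l
  define B where "B l s = real (N l) * real (N s)" for l s
  have A0: "0 \<le> A l" if "l \<in> {1..k}" for l using large(1)[OF that] by (simp add: A_def)
  have B0: "0 \<le> B l s" for l s by (simp add: B_def)
  have V: "V \<omega> = 2 / n^2 * ((\<Sum>l=1..k. A l * q \<omega> l) + (\<Sum>l=1..k. \<Sum>s\<in>{1..k} - {l}. B l s * tr_cross_hat N p (X
      \<omega>) l s))" for \<omega>
    by (simp add: V_def var_est_def Let_def A_def B_def)
  have T: "var_T = 2 / n^2 * ((\<Sum>l=1..k. A l * tr2 l l) + (\<Sum>l=1..k. \<Sum>s\<in>{1..k} - {l}. B l s * tr2 l s))"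
    by (simp add: var_T_def A_def B_def)
  have ci: "integrable M (\<lambda>\<omega>. tr_cross_hat N p (X \<omega>) l s)" "expectation (\<lambda>\<omega>. \<bar>tr_cross_hat N p (X \<omega>) l s -
      tr2 l s\<bar>) \<le> est_rate * tr2 l s"
    if "l \<in> {1..k}" "s \<in> {1..k} - {l}" for l s
    using cross_hat_estimate[of l s] that by auto
  show "integrable M V" unfolding V using q ci
    by (intro integrable_mult_right Bochner_Integration.integrable_add Bochner_Integration.integrable_sum)
        auto
  define b where "b \<omega> = 2 / n^2 * ((\<Sum>l=1..k. A l * \<bar>q \<omega> l - tr2 l l\<bar>) + (\<Sum>l=1..k. \<Sum>s\<in>{1..k} - {l}. B l s *
      \<bar>tr_cross_hat N p (X \<omega>) l s - tr2 l s\<bar>))" for \<omega>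
  have ib: "integrable M b" unfolding b_def using q ci
    by (intro integrable_mult_right Bochner_Integration.integrable_add Bochner_Integration.integrable_sum
        integrable_abs Bochner_Integration.integrable_diff) auto
  have "expectation (\<lambda>\<omega>. \<bar>V \<omega> - var_T\<bar>) \<le> expectation b"
  proof (rule integral_mono)
    show "integrable M (\<lambda>\<omega>. \<bar>V \<omega> - var_T\<bar>)" using \<open>integrable M V\<close> by simp
    fix \<omega>
    have "V \<omega> - var_T = 2 / n^2 * ((\<Sum>l=1..k. A l * (q \<omega> l - tr2 l l)) + (\<Sum>l=1..k. \<Sum>s\<in>{1..k} - {l}. B l s *
        (tr_cross_hat N p (X \<omega>) l s - tr2 l s)))"
    proof -
      have "c * (a + b) - c * (a' + b') = c * ((a - a') + (b - b'))" for a b a' b' c :: real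
        by (simp add: algebra_simps)
      moreover have "(\<Sum>l=1..k. A l * (q \<omega> l - tr2 l l)) = (\<Sum>l=1..k. A l * q \<omega> l) - (\<Sum>l=1..k. A l * tr2 l l)"
        by (simp add: right_diff_distrib sum_subtractf)
      moreover have "(\<Sum>l=1..k. \<Sum>s\<in>{1..k} - {l}. B l s * (tr_cross_hat N p (X \<omega>) l s - tr2 l s)) =
          (\<Sum>l=1..k. \<Sum>s\<in>{1..k} - {l}. B l s * tr_cross_hat N p (X \<omega>) l s) - (\<Sum>l=1..k. \<Sum>s\<in>{1..k} - {l}. B l s
              * tr2 l s)"
        by (simp add: right_diff_distrib sum_subtractf)
      ultimately show ?thesis unfolding V T by presburger
    qed
    also have "\<bar>\<dots>\<bar> \<le> b \<omega>"
      unfolding abs_mult b_def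
    proof (intro mult_mono order_trans[OF abs_triangle_ineq] add_mono)
      show "\<bar>\<Sum>l=1..k. A l * (q \<omega> l - tr2 l l)\<bar> \<le> (\<Sum>l=1..k. A l * \<bar>q \<omega> l - tr2 l l\<bar>)"
        using A0 by (intro order_trans[OF sum_abs] sum_mono) (simp add: abs_mult)
      show "\<bar>\<Sum>l=1..k. \<Sum>s\<in>{1..k} - {l}. B l s * (tr_cross_hat N p (X \<omega>) l s - tr2 l s)\<bar> \<le>
          (\<Sum>l=1..k. \<Sum>s\<in>{1..k} - {l}. B l s * \<bar>tr_cross_hat N p (X \<omega>) l s - tr2 l s\<bar>)"
        using B0 by (intro order_trans[OF sum_abs] sum_mono) (simp add: abs_mult)
    qed auto
    finally show "\<bar>V \<omega> - var_T\<bar> \<le> b \<omega>" .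
  qed (rule ib)
  also have "expectation b = 2 / n^2 * ((\<Sum>l=1..k. A l * expectation (\<lambda>\<omega>. \<bar>q \<omega> l - tr2 l l\<bar>))
      + (\<Sum>l=1..k. \<Sum>s\<in>{1..k} - {l}. B l s * expectation (\<lambda>\<omega>. \<bar>tr_cross_hat N p (X \<omega>) l s - tr2 l s\<bar>)))"
  proof -
    have 1: "integrable M (\<lambda>\<omega>. A l * \<bar>q \<omega> l - tr2 l l\<bar>)" if "l \<in> {1..k}" for l
      using q[OF that] by simp
    have 2: "integrable M (\<lambda>\<omega>. B l s * \<bar>tr_cross_hat N p (X \<omega>) l s - tr2 l s\<bar>)" if "l \<in> {1..k}" "s \<in> {1..k}
        - {l}" for l s
      using ci[OF that] by simp
    have 3: "integrable M (\<lambda>\<omega>. \<Sum>l=1..k. A l * \<bar>q \<omega> l - tr2 l l\<bar>)"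
      using 1 by (rule Bochner_Integration.integrable_sum)
    have 4: "integrable M (\<lambda>\<omega>. \<Sum>s\<in>{1..k} - {l}. B l s * \<bar>tr_cross_hat N p (X \<omega>) l s - tr2 l s\<bar>)" if "l \<in>
        {1..k}" for l
      using 2[OF that] by (rule Bochner_Integration.integrable_sum)
    have 5: "integrable M (\<lambda>\<omega>. \<Sum>l=1..k. \<Sum>s\<in>{1..k} - {l}. B l s * \<bar>tr_cross_hat N p (X \<omega>) l s - tr2 l s\<bar>)"
      using 4 by (rule Bochner_Integration.integrable_sum)
    have 6: "expectation (\<lambda>\<omega>. \<Sum>l=1..k. A l * \<bar>q \<omega> l - tr2 l l\<bar>) = (\<Sum>l=1..k. A l * expectation (\<lambda>\<omega>. \<bar>q \<omega> l -
        tr2 l l\<bar>))"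
      using 1 by (subst Bochner_Integration.integral_sum) auto
    have 7: "expectation (\<lambda>\<omega>. \<Sum>l=1..k. \<Sum>s\<in>{1..k} - {l}. B l s * \<bar>tr_cross_hat N p (X \<omega>) l s - tr2 l s\<bar>) =
       (\<Sum>l=1..k. \<Sum>s\<in>{1..k} - {l}. B l s * expectation (\<lambda>\<omega>. \<bar>tr_cross_hat N p (X \<omega>) l s - tr2 l s\<bar>))"
    proof (subst Bochner_Integration.integral_sum[OF 4], assumption, rule sum.cong[OF refl])
      fix l assume l: "l \<in> {1..k}"
      show "expectation (\<lambda>\<omega>. \<Sum>s\<in>{1..k} - {l}. B l s * \<bar>tr_cross_hat N p (X \<omega>) l s - tr2 l s\<bar>) =
         (\<Sum>s\<in>{1..k} - {l}. B l s * expectation (\<lambda>\<omega>. \<bar>tr_cross_hat N p (X \<omega>) l s - tr2 l s\<bar>))"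
        by (subst Bochner_Integration.integral_sum[OF 2[OF l]]) auto
    qed
    show ?thesis
      unfolding b_def integral_mult_right_zero Bochner_Integration.integral_add[OF 3 5] 6 7 ..
  qed
  also have "\<dots> \<le> 2 / n^2 * ((\<Sum>l=1..k. A l * (est_rate * tr2 l l)) + (\<Sum>l=1..k. \<Sum>s\<in>{1..k} - {l}. B l s *
      (est_rate * tr2 l s)))"
    using q ci A0 B0 by (intro mult_left_mono add_mono sum_mono) auto
  also have "\<dots> = est_rate * var_T"
    unfolding T by (simp add: sum_distrib_left distrib_left mult_ac)
  finally show "expectation (\<lambda>\<omega>. \<bar>V \<omega> - var_T\<bar>) \<le> est_rate * var_T" .
qed

lemma var_est_ratio_tail:
  fixes q :: "'a \<Rightarrow> nat \<Rightarrow> real"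
  assumes q: "\<And>l. l \<in> {1..k} \<Longrightarrow> integrable M (\<lambda>\<omega>. q \<omega> l) \<and> expectation (\<lambda>\<omega>. \<bar>q \<omega> l - tr2 l l\<bar>) \<le> est_rate *
      tr2 l l"
    and \<eta>: "0 < \<eta>"
  shows "prob {\<omega> \<in> space M. \<eta> \<le> \<bar>var_est k N p (X \<omega>) (q \<omega>) / var_T - 1\<bar>} \<le> est_rate / \<eta>"
proof -
  let ?V = "\<lambda>\<omega>. var_est k N p (X \<omega>) (q \<omega>)"
  note V = var_est_deviation[OF q]
  have eq: "\<bar>?V \<omega> / var_T - 1\<bar> = \<bar>?V \<omega> - var_T\<bar> / var_T" for \<omega>
    using var_T_pos by (simp add: field_simps abs_div_pos[symmetric])
  have "prob {\<omega> \<in> space M. \<eta> \<le> \<bar>?V \<omega> / var_T - 1\<bar>} \<le> expectation (\<lambda>\<omega>. \<bar>?V \<omega> / var_T - 1\<bar>) / \<eta>"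
    using V(1) \<eta> by (intro integral_Markov_inequality_measure[where A = "space M"]) auto
  also have "expectation (\<lambda>\<omega>. \<bar>?V \<omega> / var_T - 1\<bar>) = expectation (\<lambda>\<omega>. \<bar>?V \<omega> - var_T\<bar>) / var_T"
    unfolding eq by simp
  also have "\<dots> \<le> est_rate"
    using V(2) var_T_pos by (simp add: divide_le_eq)
  finally show ?thesis using \<eta> by (simp add: divide_right_mono)
qed

end

section \<open>The limiting size of the tests\<close>

text \<open>Exports what the limit argument needs from one model, with explicit bounds and the
  variance behind an existential, so that one interpretation per index is enough.\<close>

lemma (in factor_null) asymptotic_summary:
  "\<exists>v>0. (\<lambda>\<omega>. T_stat k N p (X \<omega>)) \<in> borel_measurable M
    \<and> (\<forall>t. norm ((CLINT \<omega>|M. iexp (t * (T_stat k N p (X \<omega>) / sqrt v))) - of_real (exp (- (t ^ 2) / 2)))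
      \<le> \<bar>t\<bar> * (6 * K0 ^ 2 * t ^ 2 * sqrt (sqrt (4 / \<delta> ^ 8 * (tr4_sum / tr_A2 ^ 2)))
          + 2 * \<bar>t\<bar> * sqrt ((2 + K0) * (4 / \<delta> ^ 8 * (tr4_sum / tr_A2 ^ 2)))))
    \<and> (\<forall>q \<in> {tr_sq_hat N p, tr_sq_tilde N p}.
        (\<lambda>\<omega>. var_est k N p (X \<omega>) (q (X \<omega>))) \<in> borel_measurable M
      \<and> (\<forall>\<eta>>0. prob {\<omega> \<in> space M. \<eta> \<le> \<bar>var_est k N p (X \<omega>) (q (X \<omega>)) / v - 1\<bar>} \<le> est_rate / \<eta>))"
proof (intro exI[of _ var_T] conjI allI ballI impI)
  fix q assume "q \<in> {tr_sq_hat N p, tr_sq_tilde N p}"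
  hence q: "integrable M (\<lambda>\<omega>. q (X \<omega>) l) \<and> expectation (\<lambda>\<omega>. \<bar>q (X \<omega>) l - tr2 l l\<bar>) \<le> est_rate * tr2 l l"
    if "l \<in> {1..k}" for l
    using hat_estimate[OF that] tilde_estimate[OF that] by auto
  show "(\<lambda>\<omega>. var_est k N p (X \<omega>) (q (X \<omega>))) \<in> borel_measurable M"
    using var_est_deviation(1)[of "\<lambda>\<omega>. q (X \<omega>)"] q by blast
  show "prob {\<omega> \<in> space M. \<eta> \<le> \<bar>var_est k N p (X \<omega>) (q (X \<omega>)) / var_T - 1\<bar>} \<le> est_rate / \<eta>" if "\<eta> > 0" for \<eta>
    using var_est_ratio_tail[of "\<lambda>\<omega>. q (X \<omega>)"] q that by blast
qed (use var_T_pos T_measurable T_char_bound in auto)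

theorem theorem1:
  fixes M :: "nat \<Rightarrow> 'a measure"
    and k :: nat
    and N :: "nat \<Rightarrow> nat \<Rightarrow> nat"
    and p r :: "nat \<Rightarrow> nat"
    and \<mu> :: "nat \<Rightarrow> nat \<Rightarrow> real Matrix.vec"
    and \<Gamma> :: "nat \<Rightarrow> nat \<Rightarrow> real Matrix.mat"
    and z :: "nat \<Rightarrow> nat \<Rightarrow> nat \<Rightarrow> nat \<Rightarrow> 'a \<Rightarrow> real"
    and \<gamma> lam :: "nat \<Rightarrow> real"
    and \<alpha> \<xi> :: real
  assumes alpha: "0 < \<alpha>" "\<alpha> < 1"
    and upper_quantile: "measure std_normal_distribution {\<xi>..} = \<alpha>"
    and model: "\<And>m. factor_model (M m) k (N m) (p m) (r m) (\<mu> m) (\<Gamma> m) (z m) \<gamma>"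
    and n_to_infinity: "filterlim (\<lambda>m. total_size k (N m)) at_top sequentially"
    and p_to_infinity: "filterlim p at_top sequentially"
    and A1: "\<And>l. l \<in> {1..k} \<Longrightarrow> 0 < lam l \<and> lam l < 1 \<and>
               (\<lambda>m. real (N m l) / real (total_size k (N m))) \<longlonglongrightarrow> lam l"
    and A3: "\<And>l s i j. l \<in> {1..k} \<Longrightarrow> s \<in> {1..k} \<Longrightarrow> i \<in> {1..k} \<Longrightarrow> j \<in> {1..k} \<Longrightarrow>
               (\<lambda>m. mat_trace (pop_cov (\<Gamma> m) l * pop_cov (\<Gamma> m) s
                              * pop_cov (\<Gamma> m) i * pop_cov (\<Gamma> m) j))
               \<in> o[sequentially](\<lambda>m. (mat_trace (pop_cov_sum k (p m) (\<Gamma> m)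
                                                * pop_cov_sum k (p m) (\<Gamma> m)))^2)"
    and H0: "\<And>m l s. l \<in> {1..k} \<Longrightarrow> s \<in> {1..k} \<Longrightarrow> \<mu> m l = \<mu> m s"
  shows "((\<lambda>m. measure (M m) {\<omega> \<in> space (M m).
             T1_hat k (N m) (p m) (factor_obs (r m) (\<mu> m) (\<Gamma> m) (z m) \<omega>) \<ge> \<xi>}) \<longlonglongrightarrow> \<alpha>)
       \<and> ((\<lambda>m. measure (M m) {\<omega> \<in> space (M m).
             T2_hat k (N m) (p m) (factor_obs (r m) (\<mu> m) (\<Gamma> m) (z m) \<omega>) \<ge> \<xi>}) \<longlonglongrightarrow> \<alpha>)"
proof -
  define n where "n m = real (total_size k (N m))" for m
  define X where "X m = factor_obs (r m) (\<mu> m) (\<Gamma> m) (z m)" for m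
  \<comment> \<open>Half the smallest limiting proportion lies strictly below all the limits, so
    every group eventually exceeds it.\<close>
  define \<delta> where "\<delta> = Min (lam ` {1..k}) / 2"
  have k2: "2 \<le> k" using model[of 0] by (simp add: factor_model_def factor_model_axioms_def)
  have fin: "finite (lam ` {1..k})" "lam ` {1..k} \<noteq> {}" using k2 by auto
  have \<delta>: "0 < \<delta>" using A1 fin by (simp add: \<delta>_def)
  have \<delta>_lam: "\<delta> < lam l" if "l \<in> {1..k}" for l
  proof -
    have "Min (lam ` {1..k}) \<le> lam l" using fin that by (intro Min_le) auto
    thus ?thesis using \<delta> by (simp add: \<delta>_def)
  qed
  have n_top: "filterlim n at_top sequentially"
    unfolding n_def by (rule filterlim_compose[OF filterlim_real_sequentially n_to_infinity])
  have \<delta>n_top: "filterlim (\<lambda>m. \<delta> * n m) at_top sequentially"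
    by (rule filterlim_tendsto_pos_mult_at_top[OF tendsto_const \<delta> n_top])
  define good where "good m \<longleftrightarrow> factor_null (M m) k (N m) (p m) (r m) (\<mu> m) (\<Gamma> m) (z m) \<gamma> \<delta>" for m
  have ev_good: "\<forall>\<^sub>F m in sequentially. good m"
  proof -
    have "\<forall>\<^sub>F m in sequentially. 1 \<le> p m"
      using p_to_infinity unfolding filterlim_at_top by blast
    \<comment> \<open>The bound 6 serves both size conditions: it exceeds 4, and \<delta> n \<le>
      N_l turns it into 6 \<le> N_l.\<close>
    moreover have "\<forall>\<^sub>F m in sequentially. 6 \<le> \<delta> * n m"
      using \<delta>n_top by (auto simp: filterlim_at_top)
    moreover have "\<forall>\<^sub>F m in sequentially. \<forall>l\<in>{1..k}. \<delta> < real (N m l) / n m"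
      using order_tendstoD(1)[OF conjunct2[OF conjunct2[OF A1]] \<delta>_lam]
      by (intro eventually_ball_finite) (auto simp: n_def)
    ultimately show ?thesis
    proof eventually_elim
      case (elim m)
      have n0: "0 < n m" using elim(2) \<delta> by (smt (verit) mult_nonneg_nonpos)
      have bal: "\<delta> * n m \<le> real (N m l)" if "l \<in> {1..k}" for l
        using elim(3) that n0 by (auto simp: field_simps intro: less_imp_le)
      show ?case unfolding good_def factor_null_def factor_null_axioms_def
      proof (intro conjI allI impI model)
        show "\<mu> m l = \<mu> m s" if "l \<in> {1..k}" "s \<in> {1..k}" for l s by (rule H0[OF that])
        show "6 \<le> N m l" if "l \<in> {1..k}" for l using bal[OF that] elim(2) by linarith
      qed (use elim \<delta> bal in \<open>auto simp: n_def\<close>)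
    qed
  qed
  let ?K = "moment_bound k \<gamma>"
  \<comment> \<open>The error bounds of the locale, restated as sequences in \<open>m\<close> so
    that their limits can be taken.\<close>
  define D where "D m = 4 / \<delta> ^ 8 * ((\<Sum>l=1..k. \<Sum>s=1..k. \<Sum>i=1..k. \<Sum>j=1..k.
      \<bar>mat_trace (pop_cov (\<Gamma> m) l * pop_cov (\<Gamma> m) s * pop_cov (\<Gamma> m) i * pop_cov (\<Gamma> m) j)\<bar>)
      / (mat_trace (pop_cov_sum k (p m) (\<Gamma> m) * pop_cov_sum k (p m) (\<Gamma> m))) ^ 2)" for m
  define E where "E m = 2 * dev_rate (obs_family.C5 ?K) (\<delta> * n m / 4) (\<delta> * n m / 4)" for m
  define B where "B m t = \<bar>t\<bar> * (6 * ?K ^ 2 * t ^ 2 * sqrt (sqrt (D m)) + 2 * \<bar>t\<bar> * sqrt ((2 + ?K) * D m))"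
      for m t
  have D0: "D \<longlonglongrightarrow> 0"
  proof -
    let ?f = "\<lambda>l s i j m. mat_trace (pop_cov (\<Gamma> m) l * pop_cov (\<Gamma> m) s * pop_cov (\<Gamma> m) i * pop_cov (\<Gamma> m) j)"
    let ?g = "\<lambda>m. (mat_trace (pop_cov_sum k (p m) (\<Gamma> m) * pop_cov_sum k (p m) (\<Gamma> m))) ^ 2"
    have "(\<lambda>m. \<bar>?f l s i j m / ?g m\<bar>) \<longlonglongrightarrow> 0" if "l \<in> {1..k}" "s \<in> {1..k}" "i \<in> {1..k}" "j \<in> {1..k}" for l s i
        j
      using smalloD_tendsto[OF A3[OF that]] by (rule tendsto_rabs_zero)
    hence "(\<lambda>m. 4 / \<delta> ^ 8 * (\<Sum>l=1..k. \<Sum>s=1..k. \<Sum>i=1..k. \<Sum>j=1..k. \<bar>?f l s i j m / ?g m\<bar>)) \<longlonglongrightarrow> 4 / \<delta> ^ 8 *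
        (\<Sum>l=1..k. \<Sum>s=1..k. \<Sum>i=1..k. \<Sum>j=1..k. 0)"
      by (intro tendsto_mult tendsto_const tendsto_sum)
    thus ?thesis by (simp add: D_def[abs_def] sum_divide_distrib abs_divide)
  qed
  have E0: "E \<longlonglongrightarrow> 0"
  proof -
    have "filterlim (\<lambda>m. \<delta> * n m / 4) at_top sequentially"
      using filterlim_tendsto_pos_mult_at_top[OF tendsto_const[of "1/4 :: real"] _ \<delta>n_top] by simp
    hence i: "(\<lambda>m. 1 / (\<delta> * n m / 4)) \<longlonglongrightarrow> 0"
      by (intro tendsto_divide_0[OF tendsto_const] filterlim_at_top_imp_at_infinity)
    hence "(\<lambda>m. 2 * (4 * (obs_family.C5 ?K + 1) * (1 / (\<delta> * n m / 4) + 1 / (\<delta> * n m / 4))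
        + 4 * obs_family.C5 ?K * sqrt (1 / (\<delta> * n m / 4) + 1 / (\<delta> * n m / 4)))) \<longlonglongrightarrow>
        2 * (4 * (obs_family.C5 ?K + 1) * (0 + 0) + 4 * obs_family.C5 ?K * sqrt (0 + 0))"
      by (intro tendsto_intros)
    thus ?thesis by (simp add: E_def[abs_def] dev_rate_def)
  qed
  have B0: "(\<lambda>m. B m t) \<longlonglongrightarrow> 0" for t
  proof -
    have "(\<lambda>m. B m t) \<longlonglongrightarrow> \<bar>t\<bar> * (6 * ?K ^ 2 * t ^ 2 * sqrt (sqrt 0) + 2 * \<bar>t\<bar> * sqrt ((2 + ?K) * 0))"
      unfolding B_def by (intro tendsto_intros D0)
    thus ?thesis by simp
  qed
  define ok where "ok m v \<longleftrightarrow> v > 0 \<and> (\<lambda>\<omega>. T_stat k (N m) (p m) (X m \<omega>)) \<in> borel_measurable (M m)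
    \<and> (\<forall>t. norm ((CLINT \<omega>|M m. iexp (t * (T_stat k (N m) (p m) (X m \<omega>) / sqrt v))) - of_real (exp (- (t ^ 2)
        / 2))) \<le> B m t)
    \<and> (\<forall>q \<in> {tr_sq_hat (N m) (p m), tr_sq_tilde (N m) (p m)}.
        (\<lambda>\<omega>. var_est k (N m) (p m) (X m \<omega>) (q (X m \<omega>))) \<in> borel_measurable (M m)
      \<and> (\<forall>\<eta>>0. measure (M m) {\<omega> \<in> space (M m). \<eta> \<le> \<bar>var_est k (N m) (p m) (X m \<omega>) (q (X m \<omega>)) / v - 1\<bar>} \<le> E
          m / \<eta>))" for m v
  have ok_ex: "\<exists>v. ok m v"
    if "good m" for m
  proof -
    interpret Fm: factor_null "M m" k "N m" "p m" "r m" "\<mu> m" "\<Gamma> m" "z m" \<gamma> \<delta>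
      using that by (simp add: good_def)
    show ?thesis
      using Fm.asymptotic_summary
      unfolding Fm.tr4_sum_def Fm.tr4_def Fm.tr_A2_def Fm.est_rate_def
      unfolding ok_def X_def B_def D_def E_def n_def .
  qed
  define v where "v m = (SOME v. ok m v)" for m
  have ok: "ok m (v m)" if "good m" for m
    unfolding v_def by (rule someI_ex[OF ok_ex[OF that]])
  have v: "\<And>m. good m \<Longrightarrow> v m > 0"
    and Tm: "\<And>m. good m \<Longrightarrow> (\<lambda>\<omega>. T_stat k (N m) (p m) (X m \<omega>)) \<in> borel_measurable (M m)"
    and Tc: "\<And>m t. good m \<Longrightarrow> norm ((CLINT \<omega>|M m. iexp (t * (T_stat k (N m) (p m) (X m \<omega>) / sqrt (v m)))) -
        of_real (exp (- (t ^ 2) / 2))) \<le> B m t"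
    and Vm: "\<And>m q. good m \<Longrightarrow> q \<in> {tr_sq_hat (N m) (p m), tr_sq_tilde (N m) (p m)} \<Longrightarrow>
        (\<lambda>\<omega>. var_est k (N m) (p m) (X m \<omega>) (q (X m \<omega>))) \<in> borel_measurable (M m)"
    and Vt: "\<And>m q \<eta>. good m \<Longrightarrow> q \<in> {tr_sq_hat (N m) (p m), tr_sq_tilde (N m) (p m)} \<Longrightarrow> \<eta> > 0 \<Longrightarrow>
        measure (M m) {\<omega> \<in> space (M m). \<eta> \<le> \<bar>var_est k (N m) (p m) (X m \<omega>) (q (X m \<omega>)) / v m - 1\<bar>} \<le> E m /
            \<eta>"
    using ok unfolding ok_def by blast+
  have prob: "prob_space (M m)" for m using model[of m] by (simp add: factor_model_def)
  \<comment> \<open>The value 0 at the finitely many remaining \<open>m\<close> makes every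
    \<open>S m\<close> measurable, as the continuity theorem asks for a whole sequence of
    distributions.\<close>
  define S where "S m \<omega> = (if good m then T_stat k (N m) (p m) (X m \<omega>) / sqrt (v m) else 0)" for m \<omega>
  have Sm: "S m \<in> borel_measurable (M m)" for m
    using Tm[of m] by (cases "good m") (auto simp: S_def[abs_def])
  have Sconv: "weak_conv_m (\<lambda>m. distr (M m) borel (S m)) std_normal_distribution"
  proof (rule levy_continuity)
    show "real_distribution (distr (M m) borel (S m))" for m
      by (rule prob_space.real_distribution_distr[OF prob Sm])
    show "real_distribution std_normal_distribution" by (rule real_dist_normal_dist)
    fix t
    have ch: "char (distr (M m) borel (S m)) t = (CLINT \<omega>|M m. iexp (t * S m \<omega>))" for m
      unfolding char_def using Sm by (subst integral_distr) auto
    have "\<forall>\<^sub>F m in sequentially. norm (char (distr (M m) borel (S m)) t - of_real (exp (- (t ^ 2) / 2))) \<le> B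
        m t"
      using ev_good
    proof eventually_elim
      case (elim m)
      show ?case using Tc[OF elim, of t] elim unfolding ch by (simp add: S_def)
    qed
    hence "(\<lambda>m. char (distr (M m) borel (S m)) t - of_real (exp (- (t ^ 2) / 2))) \<longlonglongrightarrow> 0"
      using B0 by (rule Lim_null_comparison)
    hence "(\<lambda>m. char (distr (M m) borel (S m)) t) \<longlonglongrightarrow> of_real (exp (- (t ^ 2) / 2))"
      by (rule LIM_zero_cancel)
    thus "(\<lambda>m. char (distr (M m) borel (S m)) t) \<longlonglongrightarrow> char std_normal_distribution t"
      by (simp add: char_std_normal_distribution)
  qed
  have main: "(\<lambda>m. measure (M m) {\<omega> \<in> space (M m).
      T_stat k (N m) (p m) (X m \<omega>) / sqrt (var_est k (N m) (p m) (X m \<omega>) (q m (X m \<omega>))) \<ge> \<xi>}) \<longlonglongrightarrow> \<alpha>"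
    if q: "\<And>m. q m \<in> {tr_sq_hat (N m) (p m), tr_sq_tilde (N m) (p m)}" for q
  proof -
    \<comment> \<open>The default 1 is the limit of the ratio, so the exceptional \<open>m\<close>
      contribute no deviation.\<close>
    define V where "V m \<omega> = (if good m then var_est k (N m) (p m) (X m \<omega>) (q m (X m \<omega>)) / v m else 1)" for m
        \<omega>
    have "(\<lambda>m. measure (M m) {\<omega> \<in> space (M m). \<xi> \<le> S m \<omega> / sqrt (V m \<omega>)}) \<longlonglongrightarrow> measure std_normal_distribution
        {\<xi>..}"
    proof (rule slutsky_tail[OF prob Sm _ Sconv])
      show "V m \<in> borel_measurable (M m)" for m
        using Vm[OF _ q] by (cases "good m") (auto simp: V_def[abs_def])
      fix \<eta> :: real assume \<eta>: "0 < \<eta>"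
      show "(\<lambda>m. measure (M m) {\<omega> \<in> space (M m). \<eta> \<le> \<bar>V m \<omega> - 1\<bar>}) \<longlonglongrightarrow> 0"
      proof (rule Lim_null_comparison)
        show "\<forall>\<^sub>F m in sequentially. norm (measure (M m) {\<omega> \<in> space (M m). \<eta> \<le> \<bar>V m \<omega> - 1\<bar>}) \<le> E m / \<eta>"
          using ev_good
        proof eventually_elim
          case (elim m)
          thus ?case using Vt[OF elim q \<eta>] by (simp add: V_def)
        qed
        show "(\<lambda>m. E m / \<eta>) \<longlonglongrightarrow> 0" using tendsto_divide[OF E0 tendsto_const, of \<eta>] \<eta> by simp
      qed
    qed
    \<comment> \<open>The unknown variance cancels between numerator and denominator, so for good
      \<open>m\<close> the quotient is the test statistic itself.\<close>
    moreover have "\<forall>\<^sub>F m in sequentially. measure (M m) {\<omega> \<in> space (M m). \<xi> \<le> S m \<omega> / sqrt (V m \<omega>)} =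
      measure (M m) {\<omega> \<in> space (M m). T_stat k (N m) (p m) (X m \<omega>) / sqrt (var_est k (N m) (p m) (X m \<omega>) (q
          m (X m \<omega>))) \<ge> \<xi>}"
      using ev_good
    proof eventually_elim
      case (elim m)
      thus ?case using v[OF elim] by (simp add: S_def V_def real_sqrt_divide)
    qed
    ultimately show ?thesis unfolding upper_quantile by (rule Lim_transform_eventually)
  qed
  show ?thesis
    using main[of "\<lambda>m. tr_sq_hat (N m) (p m)"] main[of "\<lambda>m. tr_sq_tilde (N m) (p m)"]
    unfolding T1_hat_def T2_hat_def X_def by simp
qed

end
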